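(* Let $\alpha<\beta$ be real numbers and $\Omega=(\alpha,\beta)$. Consider the mixed problem $$\partial_t u=\partial_{xx}u+u\ln(u^2)\ \ (t>0,\ x\in\Omega),\qquad u_{\mid\partial\Omega}=0\ \ (t>0),\qquad u_{\mid t=0}=u_0.\qquad (P)$$ (1) There are nonnegative initial data $u_0\in C^1_c(\Omega)$ such that (P) has a unique solution $u$, whose $L^2$ and $L^\infty$ norms decay at least like a double exponential in time: there exist $C,\eta>0$ such that for all $t\ge0$, $$\|u(t)\|_{L^2(\Omega)}\le|\Omega|^{1/2}\|u(t)\|_{L^\infty(\Omega)}\le C e^{-\eta e^{2t}}.$$ (2) There are nonnegative initial data $u_0\in C^1_c(\Omega)$ such that (P) has a unique solution $u$, whose $L^2$ and $L^\infty$ norms grow at least like a double exponential in time: there exist $C,\eta>0$ such that for all $t\ge0$, $$|\Omega|^{1/2}\|u(t)\|_{L^\infty(\Omega)}\ge\|u(t)\|_{L^2(\Omega)}\ge C e^{\eta e^{2t}}.$$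
   Context: $C^1_c(\Omega)$ is the set of $C^1$ functions with compact support in $\Omega$; $|\Omega|=\beta-\alpha$. The nonlinearity $z\mapsto z\ln(z^2)$ is extended by the value $0$ at $z=0$. Notion of solution: a function $u:[0,\infty)\times[\alpha,\beta]\to\mathbb{R}$ such that, for every $T>0$, $u$ is continuous (hence bounded) on $[0,T]\times[\alpha,\beta]$, $u_t,u_x,u_{xx}$ exist and are continuous on $(0,T]\times\Omega$, the equation holds on $(0,T]\times\Omega$, $u(t,\alpha)=u(t,\beta)=0$ for $t>0$, and $u(0,\cdot)=u_0$ on $[\alpha,\beta]$ ($u_0$ extended by $0$ to the endpoints). *)

theory Defs
  imports "HOL-Analysis.Analysis" "HOL-Probability.Essential_Supremum"
begin

text \<open>Only the values of \<open>f\<close> on the open set \<open>S\<close> matter; the closure is taken in \<open>\<real>\<close>, so that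
  its being compact and inside \<open>S\<close> says that the support of \<open>f\<close> is compact in \<open>S\<close>.\<close>

definition C1_compact_support :: "real set \<Rightarrow> (real \<Rightarrow> real) set" where
  "C1_compact_support S = {f. f C1_differentiable_on S \<and>
     compact (closure (support_on S f)) \<and> closure (support_on S f) \<subseteq> S}"

definition log_nonlinearity :: "real \<Rightarrow> real" where
  "log_nonlinearity z = (if z = 0 then 0 else z * ln (z\<^sup>2))"

text \<open>The functions \<open>ut\<close>, \<open>ux\<close>, \<open>uxx\<close> are the partial derivatives. The two-sided derivative in time
  at \<open>t = T\<close> only involves values of \<open>u\<close> at positive times, and is no extra requirement because
  \<open>T\<close> is arbitrary. The values of \<open>u\<close> outside \<open>[0,\<infinity>) \<times> [\<alpha>,\<beta>]\<close> are irrelevant.\<close>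

definition log_heat_solution ::
  "real \<Rightarrow> real \<Rightarrow> (real \<Rightarrow> real) \<Rightarrow> (real \<Rightarrow> real \<Rightarrow> real) \<Rightarrow> bool" where
  "log_heat_solution \<alpha> \<beta> u0 u \<longleftrightarrow>
     (\<forall>T>0.
        continuous_on ({0..T} \<times> {\<alpha>..\<beta>}) (\<lambda>(t, x). u t x) \<and>
        (\<exists>ut ux uxx.
           continuous_on ({0<..T} \<times> {\<alpha><..<\<beta>}) (\<lambda>(t, x). ut t x) \<and>
           continuous_on ({0<..T} \<times> {\<alpha><..<\<beta>}) (\<lambda>(t, x). ux t x) \<and>
           continuous_on ({0<..T} \<times> {\<alpha><..<\<beta>}) (\<lambda>(t, x). uxx t x) \<and>
           (\<forall>t\<in>{0<..T}. \<forall>x\<in>{\<alpha><..<\<beta>}.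
              ((\<lambda>s. u s x) has_real_derivative ut t x) (at t) \<and>
              ((\<lambda>y. u t y) has_real_derivative ux t x) (at x) \<and>
              ((\<lambda>y. ux t y) has_real_derivative uxx t x) (at x) \<and>
              ut t x = uxx t x + log_nonlinearity (u t x)))) \<and>
     (\<forall>t>0. u t \<alpha> = 0 \<and> u t \<beta> = 0) \<and>
     (\<forall>x\<in>{\<alpha>..\<beta>}. u 0 x = (if x \<in> {\<alpha><..<\<beta>} then u0 x else 0))"

definition unique_log_heat_solution ::
  "real \<Rightarrow> real \<Rightarrow> (real \<Rightarrow> real) \<Rightarrow> (real \<Rightarrow> real \<Rightarrow> real) \<Rightarrow> bool" where
  "unique_log_heat_solution \<alpha> \<beta> u0 u \<longleftrightarrow>
     log_heat_solution \<alpha> \<beta> u0 u \<and>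
     (\<forall>v. log_heat_solution \<alpha> \<beta> u0 v \<longrightarrow> (\<forall>t\<ge>0. \<forall>x\<in>{\<alpha>..\<beta>}. v t x = u t x))"

text \<open>The two norms are real-valued and meaningful for bounded measurable \<open>f\<close> on a bounded \<open>S\<close>. They
  are only applied to time slices of solutions, which are continuous on \<open>[\<alpha>,\<beta>]\<close>.\<close>

definition L2_norm_on :: "real set \<Rightarrow> (real \<Rightarrow> real) \<Rightarrow> real" where
  "L2_norm_on S f = sqrt (LINT x:S|lborel. (f x)\<^sup>2)"

definition Linf_norm_on :: "real set \<Rightarrow> (real \<Rightarrow> real) \<Rightarrow> real" where
  "Linf_norm_on S f = real_of_ereal (esssup (restrict_space lborel S) (\<lambda>x. ereal \<bar>f x\<bar>))"

end

theory Submission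
  imports Defs "HOL-Probability.Distributions" "HOL-Real_Asymp.Real_Asymp"
begin

text \<open>Since \<open>exp (c * exp (2 * t)) * u\<close> solves the equation whenever \<open>u\<close> does, one nonnegative solution
  \<open>u\<close> that lies between \<open>exp (- K * exp (2 * t)) * \<phi>\<close> and \<open>1\<close>, with \<open>\<phi>\<close> nonzero, gives
  both claims: take \<open>c = - 1\<close> and \<open>c = K + 1\<close>. Its initial datum is a bump
  whose odd reflections about both endpoints make it a function on the whole line; the solution of the
  Cauchy problem inherits the oddness and so satisfies the Dirichlet condition. That solution is
  the limit of the Picard iteration for Duhamel's formula with the nonlinearity frozen outside
  \<open>[-1, 1]\<close>. The nonlinearity is not Lipschitz at \<open>0\<close>, but it has the Osgood
  modulus \<open>r * \<bar>ln r\<bar>\<close>, which suffices for convergence, and it is Hoelder continuous, which makes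
  the solution classical. The two bounds and uniqueness come from the parabolic maximum
  principle, because the nonlinearity is Lipschitz from above on bounded sets.\<close>

section \<open>The nonlinearity\<close>

text \<open>The scaling symmetry dictates the rate: multiplying \<open>u\<close> by
  \<open>exp r\<close> adds \<open>2 * r\<close> times the rescaled function to the nonlinearity,
  and \<open>r = c * exp (2 * t)\<close> solves \<open>r' = 2 * r\<close>. What has to be excluded
  is a decay of \<open>u\<close> beyond this scale. Near \<open>0\<close> the nonlinearity is an
  absorption whose relative rate \<open>ln (u^2)\<close> is unbounded, so a lower barrier is
  required. It is a stationary subsolution \<open>exp K * datum\<close>, scaled down by
  \<open>exp (- K * exp (2 * t))\<close>; the two factors cancel at time \<open>0\<close>, where the
  barrier is the datum itself. The datum vanishes quadratically at the edge of its support, so that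
  its second derivative stays positive there while the absorption tends to \<open>0\<close>. The
  upper barrier is the constant \<open>1\<close>, a zero of the nonlinearity. The datum is an odd
  function of a sine because that sine is odd about both endpoints at once, which makes the
  reflections automatic.\<close>

lemma xlnx_minus_ge:
  fixes a b q :: real
  assumes "0 \<le> b" "b \<le> a"
  shows "a * ln a - b * ln b \<ge> - q * (a - b) - exp (- 1 - q)"
proof -
  \<comment> \<open>Convexity of \<open>x * ln x\<close>: the graph lies above its tangents.\<close>
  have tangent: "x * ln x \<ge> y * ln y + (1 + ln y) * (x - y)" if "0 \<le> x" "0 < y" for x y :: real
  proof (cases "x = 0")
    case False
    then have "x > 0" using that by simp
    have "ln (y / x) \<le> y / x - 1" using \<open>x > 0\<close> that by (intro ln_le_minus_one) simp
    then have "x * (ln y - ln x) \<le> x * (y / x - 1)"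
      using \<open>x > 0\<close> that by (intro mult_left_mono) (auto simp: ln_div)
    then show ?thesis using \<open>x > 0\<close> by (simp add: algebra_simps)
  qed (use that in \<open>simp add: algebra_simps\<close>)
  show ?thesis
  \<comment> \<open>The slope \<open>1 + ln x\<close> equals \<open>- q\<close> exactly at
    \<open>exp (- 1 - q)\<close>. To the right of this point the tangent at \<open>b\<close> has
    slope at least \<open>- q\<close>. To the left, the tangent at the point itself, which is
    \<open>- q * x - exp (- 1 - q)\<close>, bounds the term with \<open>a\<close>.\<close>
  proof (cases "b < exp (- 1 - q)")
    case True
    have "b * ln b \<le> b * (- 1 - q)"
    proof (cases "b = 0")
      case False
      then have "b > 0" using assms by simp
      then have "ln b \<le> - 1 - q" using True by (metis exp_less_cancel_iff exp_ln less_imp_le)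
      then show ?thesis using \<open>b > 0\<close> by (intro mult_left_mono) auto
    qed simp
    moreover have "a * ln a \<ge> - q * a - exp (- 1 - q)"
      using tangent[of a "exp (- 1 - q)"] assms by (simp add: algebra_simps)
    ultimately show ?thesis using assms by (simp add: algebra_simps)
  next
    case False
    then have b: "b > 0" using exp_gt_zero[of "- 1 - q"] by linarith
    then have "ln b \<ge> - 1 - q" using False by (metis exp_le_cancel_iff exp_ln not_less)
    then have "(1 + ln b) * (a - b) \<ge> - q * (a - b)" using assms by (intro mult_right_mono) auto
    then show ?thesis using tangent[of a b] assms b exp_gt_zero[of "- 1 - q"] by linarith
  qed
qed

text \<open>The derivative \<open>1 + ln x\<close> is unbounded only downwards as \<open>x\<close>
  tends to \<open>0\<close>; from above it is controlled by its value at \<open>M\<close>.\<close>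

lemma xlnx_minus_le:
  fixes a b M :: real
  assumes "0 \<le> b" "b \<le> a" "a \<le> M" "1 \<le> M"
  shows "a * ln a - b * ln b \<le> (1 + ln M) * (a - b)"
proof (cases "b = 0")
  case True
  show ?thesis
  proof (cases "a = 0")
    case False
    then have "ln a \<le> ln M" using assms by (intro ln_mono) auto
    then have "ln a \<le> 1 + ln M" by simp
    then show ?thesis using True assms mult_left_mono[of "ln a" "1 + ln M" a] by (simp add: mult.commute)
  qed (use True in simp)
next
  case False
  then have pos: "b > 0" "a > 0" using assms by auto
  have "ln (a / b) \<le> a / b - 1" using pos by (intro ln_le_minus_one) simp
  then have "b * (ln a - ln b) \<le> b * (a / b - 1)"
    using pos by (intro mult_left_mono) (auto simp: ln_div)
  then have 1: "b * (ln a - ln b) \<le> a - b" using pos by (simp add: algebra_simps)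
  have "ln a \<le> ln M" using pos assms by simp
  then have "(a - b) * ln a \<le> (a - b) * ln M" using assms by (intro mult_left_mono) auto
  then show ?thesis using 1 by (simp add: algebra_simps)
qed

section \<open>One-sided bounds for the nonlinearity at arguments of either sign\<close>

lemma log_nonlinearity_minus [simp]: "log_nonlinearity (- z) = - log_nonlinearity z"
  by (simp add: log_nonlinearity_def)

lemma log_nonlinearity_nonneg_arg: "0 \<le> z \<Longrightarrow> log_nonlinearity z = 2 * (z * ln z)"
  by (simp add: log_nonlinearity_def ln_realpow)

text \<open>The logarithm turns a scaling into a linear term. This yields both the scaling symmetry
  of the equation and the time-dependent barrier.\<close>

lemma log_nonlinearity_mult_exp: "log_nonlinearity (exp r * z) = exp r * log_nonlinearity z + 2 * r * (exp r * z)"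
proof (cases "z = 0")
  case False
  then have "ln ((exp r * z)\<^sup>2) = 2 * r + ln (z\<^sup>2)"
    by (simp add: power_mult_distrib ln_mult ln_realpow)
  then show ?thesis using False by (simp add: log_nonlinearity_def algebra_simps)
qed (simp add: log_nonlinearity_def)

text \<open>The Lipschitz bound from above that feeds the comparison arguments. Oddness reduces
  equal signs to nonnegative arguments; opposite signs are split at \<open>0\<close>.\<close>

lemma log_nonlinearity_minus_le:
  fixes a b M :: real
  assumes "b \<le> a" "\<bar>a\<bar> \<le> M" "\<bar>b\<bar> \<le> M" "1 \<le> M"
  shows "log_nonlinearity a - log_nonlinearity b \<le> 2 * (1 + ln M) * (a - b)"
proof -
  have pos: "log_nonlinearity a - log_nonlinearity b \<le> 2 * (1 + ln M) * (a - b)"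
    if "0 \<le> b" "b \<le> a" "a \<le> M" for a b
    using xlnx_minus_le[of b a M] that assms unfolding mult.assoc
    by (simp add: log_nonlinearity_nonneg_arg)
  consider "0 \<le> b" | "a \<le> 0" | "b < 0" "0 < a" by linarith
  then show ?thesis
  proof cases
    case 2 then show ?thesis using pos[of "-a" "-b"] assms by simp
  next
    case 3 then show ?thesis using pos[of 0 a] pos[of 0 "-b"] assms
      by (simp add: log_nonlinearity_def algebra_simps)
  qed (use pos assms in auto)
qed

text \<open>No Lipschitz bound from below holds near \<open>0\<close>; instead, a slope of size
  \<open>q\<close> leaves an additive error that is exponentially small in \<open>q\<close>. The
  error is \<open>4 * exp (- 1 - q)\<close> rather than \<open>2 * exp (- 1 - q)\<close> because an
  interval around \<open>0\<close> is split there and both halves pay.\<close>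

lemma log_nonlinearity_minus_ge:
  fixes a b q :: real
  assumes "b \<le> a"
  shows "log_nonlinearity a - log_nonlinearity b \<ge> - 2 * q * (a - b) - 4 * exp (- 1 - q)"
proof -
  have pos: "log_nonlinearity a - log_nonlinearity b \<ge> - 2 * q * (a - b) - 2 * exp (- 1 - q)"
    if "0 \<le> b" "b \<le> a" for a b
    using xlnx_minus_ge[of b a q] that by (simp add: log_nonlinearity_nonneg_arg)
  consider "0 \<le> b" | "a \<le> 0" | "b < 0" "0 < a" by linarith
  then show ?thesis
  proof cases
    case 1 then show ?thesis using pos[of b a] assms exp_gt_zero[of "- 1 - q"] by linarith
  next
    case 2 then show ?thesis using pos[of "-a" "-b"] assms exp_gt_zero[of "- 1 - q"]
      unfolding log_nonlinearity_minus by argo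
  next
    case 3 then show ?thesis using pos[of 0 a] pos[of 0 "-b"] assms
      by (simp add: log_nonlinearity_def algebra_simps)
  qed
qed

text \<open>Freezing makes the nonlinearity bounded, so that all iterates are controlled without an
  a priori bound. The solution is shown afterwards to lie in \<open>[0, 1]\<close>, where both
  nonlinearities agree.\<close>

definition truncated_nonlinearity :: "real \<Rightarrow> real" where
  "truncated_nonlinearity z = log_nonlinearity (max (- 1) (min 1 z))"

text \<open>The free parameter \<open>q\<close> encodes the modulus \<open>r * \<bar>ln r\<bar>\<close>: choose \<open>q\<close> near \<open>- ln \<bar>a - b\<bar>\<close>.\<close>

lemma truncated_nonlinearity_log_Lipschitz:
  fixes a b q :: real
  assumes "0 \<le> q"
  shows "\<bar>truncated_nonlinearity a - truncated_nonlinearity b\<bar> \<le> 2 * (q + 1) * \<bar>a - b\<bar> + 2 * exp (- q)"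
proof -
  have *: "\<bar>truncated_nonlinearity a - truncated_nonlinearity b\<bar> \<le> 2 * (q + 1) * \<bar>a - b\<bar> + 2 * exp (- q)"
    if "b \<le> a" for a b
  proof -
    define a' b' where "a' = max (- 1) (min 1 a)" and "b' = max (- 1) (min 1 b)"
    have ab: "b' \<le> a'" "a' - b' \<le> a - b" "\<bar>a'\<bar> \<le> 1" "\<bar>b'\<bar> \<le> 1"
      using that by (auto simp: a'_def b'_def)
    have "exp (1::real) \<ge> 2" using exp_ge_add_one_self[of 1] by simp
    then have "4 * exp (- 1 - q) \<le> 2 * exp (- q)"
      by (simp add: exp_diff exp_minus field_simps)
    moreover have "2 * q * (a' - b') \<le> 2 * q * (a - b)" using ab assms by (intro mult_left_mono) auto
    moreover have "log_nonlinearity a' - log_nonlinearity b' \<le> 2 * (a' - b')"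
      using log_nonlinearity_minus_le[of b' a' 1] ab by simp
    moreover have "0 \<le> q * (a - b)" using that assms by simp
    ultimately have "\<bar>log_nonlinearity a' - log_nonlinearity b'\<bar> \<le> 2 * (q * (a - b)) + 2 * (a - b) + 2 * exp (- q)"
      using log_nonlinearity_minus_ge[of b' a' q] ab that exp_gt_zero[of "- q"]
      unfolding abs_le_iff mult.assoc by argo
    then show ?thesis using that
      by (simp add: truncated_nonlinearity_def algebra_simps flip: a'_def b'_def)
  qed
  show ?thesis using *[of b a] *[of a b] by (cases "b \<le> a") (auto simp: abs_minus_commute)
qed

lemma truncated_nonlinearity_Hoelder:
  "\<bar>truncated_nonlinearity a - truncated_nonlinearity b\<bar> \<le> 6 * sqrt \<bar>a - b\<bar>"
proof -
  show ?thesis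
  proof (cases "a = b")
    case False
    define d where "d = \<bar>a - b\<bar>"
    have d: "d > 0" using False by (simp add: d_def)
    show ?thesis
    proof (cases "d \<le> 1")
      case True
      \<comment> \<open>With this choice \<open>(q + 1) * d = sqrt d\<close>, while
        \<open>exp q \<ge> q + 1\<close> gives \<open>exp (- q) \<le> sqrt d\<close>; both terms of
        the modulus become multiples of \<open>sqrt d\<close>.\<close>
      define q where "q = 1 / sqrt d - 1"
      have s: "sqrt d \<le> 1" "sqrt d > 0" using True d by auto
      have q: "q \<ge> 0" using s by (simp add: q_def field_simps)
      have "exp q \<ge> 1 / sqrt d" using exp_ge_add_one_self[of q] by (simp add: q_def)
      then have e: "exp (- q) \<le> sqrt d" using s by (simp add: exp_minus field_simps)
      have "2 * (q + 1) * d = 2 * sqrt d" using s d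
        by (simp add: q_def) (metis less_imp_le real_div_sqrt times_divide_eq_right)
      then show ?thesis using truncated_nonlinearity_log_Lipschitz[OF q, of a b] e s
        by (simp flip: d_def)
    next
      case False
      have b2: "\<bar>truncated_nonlinearity z\<bar> \<le> 2" for z
      proof -
        define c where "c = \<bar>max (- 1) (min 1 z)\<bar>"
        have c: "0 \<le> c" "c \<le> 1" by (auto simp: c_def)
        have "\<bar>truncated_nonlinearity z\<bar> = \<bar>log_nonlinearity c\<bar>"
          unfolding truncated_nonlinearity_def c_def by (simp add: abs_if)
        moreover have "\<bar>log_nonlinearity c\<bar> \<le> 2"
      proof -
        have "c * ln c \<ge> - exp (- 1)" "c * ln c \<le> c"
          using xlnx_minus_ge[of 0 c 0] xlnx_minus_le[of 0 c 1] c by auto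
        moreover have "exp (- 1 :: real) \<le> 1" by simp
        ultimately show ?thesis using c
          unfolding abs_le_iff log_nonlinearity_nonneg_arg[OF c(1)] by linarith
      qed
        ultimately show ?thesis by simp
      qed
      have "sqrt d \<ge> 1" using False by simp
      then show ?thesis using b2[of a] b2[of b] unfolding d_def abs_le_iff by linarith
    qed
  qed simp
qed

lemma truncated_nonlinearity_0 [simp]: "truncated_nonlinearity 0 = 0"
  by (simp add: truncated_nonlinearity_def log_nonlinearity_def)

lemma truncated_nonlinearity_minus [simp]: "truncated_nonlinearity (- z) = - truncated_nonlinearity z"
proof -
  have "max (- 1) (min 1 (- z)) = - max (- 1) (min 1 z)" by (auto simp: max_def min_def)
  then show ?thesis by (simp add: truncated_nonlinearity_def)
qed

lemma truncated_nonlinearity_eq: "\<bar>z\<bar> \<le> 1 \<Longrightarrow> truncated_nonlinearity z = log_nonlinearity z"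
  by (simp add: truncated_nonlinearity_def abs_le_iff)

text \<open>This sign makes the constant \<open>1\<close> an upper barrier and, by oddness, the
  constant \<open>0\<close> a lower one.\<close>

lemma truncated_nonlinearity_nonpos:
  assumes "0 \<le> z" shows "truncated_nonlinearity z \<le> 0"
proof -
  have "min 1 z * ln (min 1 z) \<le> 0"
    using assms by (intro mult_nonneg_nonpos) (use ln_mono[of z 1] in \<open>cases "z = 0"; auto simp: min_def\<close>)+
  moreover have "max (- 1) (min 1 z) = min 1 z" using assms by simp
  ultimately show ?thesis using assms
    by (simp add: truncated_nonlinearity_def log_nonlinearity_nonneg_arg)
qed

lemma abs_truncated_nonlinearity_le: "\<bar>truncated_nonlinearity z\<bar> \<le> 6"
proof -
  have "truncated_nonlinearity z = truncated_nonlinearity (max (- 1) (min 1 z))"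
    by (simp add: truncated_nonlinearity_def)
  moreover have "sqrt \<bar>max (- 1) (min 1 z)\<bar> \<le> 1" by auto
  ultimately show ?thesis
    using truncated_nonlinearity_Hoelder[of "max (- 1) (min 1 z)" 0]
    by (metis abs_ge_zero diff_zero mult_left_mono mult.right_neutral order_trans truncated_nonlinearity_0 zero_le_numeral)
qed

lemma continuous_truncated_nonlinearity: "continuous_on UNIV truncated_nonlinearity"
proof -
  have "(truncated_nonlinearity \<longlongrightarrow> truncated_nonlinearity x) (at x)" for x
  proof -
    have "((\<lambda>y. 6 * sqrt \<bar>y - x\<bar>) \<longlongrightarrow> 6 * sqrt \<bar>x - x\<bar>) (at x)" by (intro tendsto_intros)
    then have "((\<lambda>y. 6 * sqrt \<bar>y - x\<bar>) \<longlongrightarrow> 0) (at x)" by simp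
    then have "((\<lambda>y. truncated_nonlinearity y - truncated_nonlinearity x) \<longlongrightarrow> 0) (at x)"
      by (rule Lim_null_comparison[rotated]) (auto simp: truncated_nonlinearity_Hoelder)
    then show ?thesis by (simp add: LIM_zero_iff)
  qed
  then show ?thesis by (simp add: continuous_on)
qed

section \<open>The parabolic maximum principle\<close>

text \<open>The second derivative is assumed at the single point \<open>x\<close>, so no Taylor
  expansion is used: \<open>f' x = 0\<close> and \<open>D > 0\<close> would make \<open>f'\<close>
  positive just to the right of \<open>x\<close>, and \<open>f\<close> would exceed its maximum
  there.\<close>

lemma second_derivative_nonpos_at_max:
  fixes f :: "real \<Rightarrow> real"
  assumes ab: "a < x" "x < b"
    and f': "\<And>y. a < y \<Longrightarrow> y < b \<Longrightarrow> (f has_real_derivative f' y) (at y)"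
    and f'': "(f' has_real_derivative D) (at x)"
    and max: "\<And>y. a < y \<Longrightarrow> y < b \<Longrightarrow> f y \<le> f x"
  shows "D \<le> 0"
proof (rule ccontr)
  assume "\<not> D \<le> 0"
  then have "D > 0" by simp
  have "f' x = 0"
    using DERIV_local_max[OF f'[OF ab], of "min (x - a) (b - x)"] ab max by (auto simp: abs_if split: if_splits)
  obtain d where d: "d > 0" "\<And>h. 0 < h \<Longrightarrow> h < d \<Longrightarrow> f' x < f' (x + h)"
    using DERIV_pos_inc_right[OF f'' \<open>D > 0\<close>] by blast
  define e where "e = min (d / 2) ((b - x) / 2)"
  have e: "e > 0" "e < d" "x + e < b" using ab d(1) by (auto simp: e_def min_def field_simps)
  obtain z where z: "x < z" "z < x + e" "f (x + e) - f x = (x + e - x) * f' z"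
    using MVT2[of x "x + e" f f'] e ab f' by fastforce
  have "f' z > 0" using d(2)[of "z - x"] z e \<open>f' x = 0\<close> by simp
  then have "f (x + e) > f x" using z e by (smt (verit) mult_pos_pos)
  then show False using max[of "x + e"] e ab by simp
qed

text \<open>The weight \<open>exp (- (L + 1) * t)\<close> beats the zeroth order term: at a positive
  maximum of the weighted function, time monotonicity gives \<open>dt \<ge> (L + 1) * d\<close>,
  whereas \<open>dxx \<le> 0\<close> gives \<open>dt \<le> L * d\<close>. Space regularity and the
  inequality are demanded only where \<open>d > 0\<close>; this admits a barrier whose second
  derivative jumps at points where it lies below the solution.\<close>

lemma parabolic_maximum_principle:
  fixes d :: "real \<Rightarrow> real \<Rightarrow> real"
  assumes cont: "continuous_on ({0..T} \<times> {a..b}) (\<lambda>(t, x). d t x)"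
    and dt: "\<And>t x. 0 < t \<Longrightarrow> t \<le> T \<Longrightarrow> a < x \<Longrightarrow> x < b \<Longrightarrow> ((\<lambda>s. d s x) has_real_derivative dt t x) (at t)"
    and dx: "\<And>t x. 0 < t \<Longrightarrow> t \<le> T \<Longrightarrow> a < x \<Longrightarrow> x < b \<Longrightarrow> 0 < d t x \<Longrightarrow>
      \<exists>d'. (\<forall>\<^sub>F y in nhds x. ((\<lambda>y. d t y) has_real_derivative d' y) (at y)) \<and>
        (d' has_real_derivative dxx t x) (at x)"
    and ineq: "\<And>t x. 0 < t \<Longrightarrow> t \<le> T \<Longrightarrow> a < x \<Longrightarrow> x < b \<Longrightarrow> 0 < d t x \<Longrightarrow> dt t x \<le> dxx t x + L * d t x"
    and init: "\<And>x. a \<le> x \<Longrightarrow> x \<le> b \<Longrightarrow> d 0 x \<le> 0"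
    and bdry: "\<And>t. 0 < t \<Longrightarrow> t \<le> T \<Longrightarrow> d t a \<le> 0 \<and> d t b \<le> 0"
    and tx: "0 \<le> t" "t \<le> T" "a \<le> x" "x \<le> b"
  shows "d t x \<le> 0"
proof (rule ccontr)
  assume neg: "\<not> d t x \<le> 0"
  define e where "e = (\<lambda>(t, x). exp (- (L + 1) * t) * d t x)"
  have "continuous_on ({0..T} \<times> {a..b}) (\<lambda>p. exp (- (L + 1) * fst p) * (case p of (t, x) \<Rightarrow> d t x))"
    by (intro continuous_intros cont)
  moreover have "(\<lambda>p. exp (- (L + 1) * fst p) * (case p of (t, x) \<Rightarrow> d t x)) = e"
    by (auto simp: e_def)
  ultimately have "continuous_on ({0..T} \<times> {a..b}) e" by metis
  moreover have "compact ({0..T} \<times> {a..b})" by (intro compact_Times) auto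
  moreover have "{0..T} \<times> {a..b} \<noteq> {}" using tx by auto
  ultimately obtain p where p: "p \<in> {0..T} \<times> {a..b}" and pmax: "\<And>q. q \<in> {0..T} \<times> {a..b} \<Longrightarrow> e q \<le> e p"
    using continuous_attains_sup by metis
  obtain s y where sy: "p = (s, y)" by (cases p)
  have emax: "e (t', x') \<le> e (s, y)" if "0 \<le> t'" "t' \<le> T" "a \<le> x'" "x' \<le> b" for t' x'
    using pmax[of "(t', x')"] that sy by simp
  have s: "0 \<le> s" "s \<le> T" "a \<le> y" "y \<le> b" using p sy by auto
  have "e (t, x) > 0" using neg by (simp add: e_def)
  then have "e (s, y) > 0" using emax[of t x] tx by linarith
  then have dpos: "d s y > 0" by (simp add: e_def zero_less_mult_iff)
  have s0: "0 < s" using init[of y] s dpos by (cases "s = 0") auto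
  have y: "a < y" "y < b" using bdry[of s] s0 s dpos by (auto simp: less_le)
  define E where "E = exp (- (L + 1) * s)"
  have E: "E > 0" by (simp add: E_def)
  have "((\<lambda>r. e (r, y)) has_real_derivative
      (exp (- (L + 1) * s) * (- (L + 1))) * d s y + exp (- (L + 1) * s) * dt s y) (at s)"
    unfolding e_def split by (auto intro!: derivative_eq_intros dt s0 s y)
  then have der_t: "((\<lambda>r. e (r, y)) has_real_derivative E * (dt s y - (L + 1) * d s y)) (at s)"
    by (simp add: E_def algebra_simps)
  \<comment> \<open>The maximum may sit at the final time, so only earlier times
    \<open>s - h\<close> are compared; this yields a sign of the time derivative instead of its
    vanishing.\<close>
  have "E * (dt s y - (L + 1) * d s y) \<ge> 0"
  proof (rule ccontr)
    assume "\<not> ?thesis"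
    then obtain \<epsilon> where \<epsilon>: "\<epsilon> > 0" "\<And>h. 0 < h \<Longrightarrow> h < \<epsilon> \<Longrightarrow> e (s, y) < e (s - h, y)"
      using DERIV_neg_dec_left[OF der_t] by auto
    define h where "h = min (\<epsilon> / 2) s"
    have "0 < h" "h < \<epsilon>" "h \<le> s" using \<epsilon> s0 by (auto simp: h_def)
    then show False using \<epsilon>(2)[of h] emax[of "s - h" y] s by simp
  qed
  then have dt_ge: "dt s y \<ge> (L + 1) * d s y" using E by (simp add: zero_le_mult_iff)
  obtain d' where d': "\<forall>\<^sub>F y in nhds y. ((\<lambda>y. d s y) has_real_derivative d' y) (at y)"
    "(d' has_real_derivative dxx s y) (at y)" using dx[OF s0 s(2) y dpos] by blast
  obtain \<delta> where \<delta>: "\<delta> > 0" "\<And>z. dist z y < \<delta> \<Longrightarrow> ((\<lambda>y. d s y) has_real_derivative d' z) (at z)"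
    using d'(1) unfolding eventually_nhds_metric by blast
  have "dxx s y \<le> 0"
  proof (rule second_derivative_nonpos_at_max[of "max a (y - \<delta>)" y "min b (y + \<delta>)" "d s" d'])
    fix z assume z: "max a (y - \<delta>) < z" "z < min b (y + \<delta>)"
    show "((\<lambda>y. d s y) has_real_derivative d' z) (at z)" using z by (intro \<delta>) (auto simp: dist_real_def)
    have "E * d s z \<le> E * d s y" using emax[of s z] s z by (simp add: e_def E_def)
    then show "d s z \<le> d s y" using E by simp
  qed (use y \<delta> d' in auto)
  then show False using ineq[OF s0 s(2) y dpos] dt_ge dpos by (simp add: algebra_simps)
qed

section \<open>Integrals with parameters and the Gaussian measure\<close>

text \<open>Continuity in the parameter is required only for almost every \<open>w\<close>, because
  the Duhamel integrand has an indicator that jumps when its integration variable equals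
  \<open>t\<close>.\<close>

lemma isCont_integral_dominated:
  fixes f :: "'a::metric_space \<Rightarrow> 'b \<Rightarrow> real"
  assumes U: "open U" "x0 \<in> U"
    and meas: "\<And>x. f x \<in> borel_measurable M"
    and bound: "\<And>x. x \<in> U \<Longrightarrow> AE w in M. \<bar>f x w\<bar> \<le> g w"
    and g: "integrable M g"
    and cont: "AE w in M. isCont (\<lambda>x. f x w) x0"
  shows "isCont (\<lambda>x. \<integral>w. f x w \<partial>M) x0"
  unfolding continuous_at_sequentially
proof (intro allI impI)
  fix X :: "nat \<Rightarrow> 'a" assume X: "X \<longlonglongrightarrow> x0"
  then have "\<forall>\<^sub>F n in sequentially. X n \<in> U" using U by (simp add: topological_tendstoD)
  then obtain N where N: "\<And>n. n \<ge> N \<Longrightarrow> X n \<in> U" by (auto simp: eventually_sequentially)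
  have XN: "(\<lambda>n. X (n + N)) \<longlonglongrightarrow> x0" using X by (rule LIMSEQ_ignore_initial_segment)
  have "(\<lambda>n. \<integral>w. f (X (n + N)) w \<partial>M) \<longlonglongrightarrow> (\<integral>w. f x0 w \<partial>M)"
  proof (rule integral_dominated_convergence[where w = g])
    show "AE w in M. (\<lambda>n. f (X (n + N)) w) \<longlonglongrightarrow> f x0 w"
      using cont by (rule AE_mp) (auto intro!: AE_I2 isCont_tendsto_compose[OF _ XN])
    show "AE w in M. norm (f (X (n + N)) w) \<le> g w" for n using bound[OF N[of "n + N"]] by simp
  qed (use meas g in auto)
  then show "((\<lambda>x. \<integral>w. f x w \<partial>M) \<circ> X) \<longlonglongrightarrow> (\<integral>w. f x0 w \<partial>M)"
    unfolding comp_def by (rule LIMSEQ_offset)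
qed

lemma has_derivative_integral_dominated:
  fixes f :: "real \<Rightarrow> 'b \<Rightarrow> real"
  assumes x0: "a < x0" "x0 < b"
    and int: "\<And>x. a < x \<Longrightarrow> x < b \<Longrightarrow> integrable M (f x)"
    and meas: "f' x0 \<in> borel_measurable M"
    and der: "AE w in M. \<forall>x. a < x \<longrightarrow> x < b \<longrightarrow>
        ((\<lambda>x. f x w) has_real_derivative f' x w) (at x) \<and> \<bar>f' x w\<bar> \<le> g w"
    and g: "integrable M g"
  shows "((\<lambda>x. \<integral>w. f x w \<partial>M) has_real_derivative (\<integral>w. f' x0 w \<partial>M)) (at x0)"
proof -
  have "((\<lambda>y. ((\<integral>w. f y w \<partial>M) - (\<integral>w. f x0 w \<partial>M)) / (y - x0)) \<longlongrightarrow> (\<integral>w. f' x0 w \<partial>M)) (at x0 within {a<..<b})"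
    unfolding tendsto_at_iff_sequentially comp_def
  proof (intro allI impI)
    fix X :: "nat \<Rightarrow> real" assume XI: "\<forall>i. X i \<in> {a<..<b} - {x0}" and X: "X \<longlonglongrightarrow> x0"
    have XI': "a < X i" "X i < b" "X i \<noteq> x0" for i using XI by auto
    have "(\<lambda>n. \<integral>w. (f (X n) w - f x0 w) / (X n - x0) \<partial>M) \<longlonglongrightarrow> (\<integral>w. f' x0 w \<partial>M)"
    proof (rule integral_dominated_convergence[where w = g])
      have fm: "f x \<in> borel_measurable M" if "a < x" "x < b" for x using int[OF that] by simp
      show "(\<lambda>w. (f (X n) w - f x0 w) / (X n - x0)) \<in> borel_measurable M" for n
        using fm XI' x0 by (intro borel_measurable_divide borel_measurable_diff) auto
      show "AE w in M. (\<lambda>n. (f (X n) w - f x0 w) / (X n - x0)) \<longlonglongrightarrow> f' x0 w"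
        using der
      proof (rule AE_mp, intro AE_I2 impI)
        fix w assume "\<forall>x. a < x \<longrightarrow> x < b \<longrightarrow> ((\<lambda>x. f x w) has_real_derivative f' x w) (at x) \<and> \<bar>f' x w\<bar> \<le> g w"
        then have "((\<lambda>x. f x w) has_real_derivative f' x0 w) (at x0)" using x0 by simp
        then have "((\<lambda>y. (f y w - f x0 w) / (y - x0)) \<longlongrightarrow> f' x0 w) (at x0)"
          by (simp add: has_field_derivative_iff)
        then show "(\<lambda>n. (f (X n) w - f x0 w) / (X n - x0)) \<longlonglongrightarrow> f' x0 w"
          using X XI'(3) unfolding tendsto_at_iff_sequentially comp_def by auto
      qed
      show "AE w in M. norm ((f (X n) w - f x0 w) / (X n - x0)) \<le> g w" for n
        using der
      proof (rule AE_mp, intro AE_I2 impI)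
        fix w assume d: "\<forall>x. a < x \<longrightarrow> x < b \<longrightarrow> ((\<lambda>x. f x w) has_real_derivative f' x w) (at x) \<and> \<bar>f' x w\<bar> \<le> g w"
        have "norm (f (X n) w - f x0 w) \<le> g w * norm (X n - x0)"
        proof (rule field_differentiable_bound[of "{a<..<b}" "\<lambda>x. f x w" "\<lambda>x. f' x w"])
          show "((\<lambda>x. f x w) has_real_derivative f' z w) (at z within {a<..<b})" if "z \<in> {a<..<b}" for z
            using d that by (auto intro: has_field_derivative_at_within)
        qed (use d XI'[of n] x0 in auto)
        then show "norm ((f (X n) w - f x0 w) / (X n - x0)) \<le> g w"
          using XI'(3)[of n] by (simp add: field_simps)
      qed
    qed (use meas g in auto)
    moreover have "(\<lambda>n. \<integral>w. (f (X n) w - f x0 w) / (X n - x0) \<partial>M) =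
        (\<lambda>n. ((\<integral>w. f (X n) w \<partial>M) - (\<integral>w. f x0 w \<partial>M)) / (X n - x0))"
      using Bochner_Integration.integral_diff[OF int int, of _ x0] XI' x0 by (intro ext) simp
    ultimately show "(\<lambda>n. ((\<integral>w. f (X n) w \<partial>M) - (\<integral>w. f x0 w \<partial>M)) / (X n - x0)) \<longlonglongrightarrow> (\<integral>w. f' x0 w \<partial>M)"
      by simp
  qed
  then have "((\<lambda>x. \<integral>w. f x w \<partial>M) has_real_derivative (\<integral>w. f' x0 w \<partial>M)) (at x0 within {a<..<b})"
    by (simp add: has_field_derivative_iff)
  then show ?thesis using x0 by (simp add: at_within_open[of x0 "{a<..<b}"])
qed

text \<open>The heat kernel at time \<open>h\<close> is the law of \<open>sqrt (2 * h) * z\<close>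
  under this measure. Keeping the measure fixed moves both \<open>h\<close> and \<open>x\<close>
  into the argument of the function that is averaged.\<close>

definition gauss :: "real measure" where
  "gauss = density lborel (\<lambda>x. ennreal (std_normal_density x))"

lemma prob_space_gauss: "prob_space gauss"
  unfolding gauss_def by (intro prob_space_normal_density) simp

lemma sets_gauss [simp, measurable_cong]: "sets gauss = sets borel"
  by (simp add: gauss_def)

lemma space_gauss [simp]: "space gauss = UNIV"
  by (simp add: gauss_def)

lemma integral_gauss:
  fixes f :: "real \<Rightarrow> real"
  assumes "f \<in> borel_measurable borel"
  shows "integral\<^sup>L gauss f = (\<integral>z. std_normal_density z * f z \<partial>lborel)"
  unfolding gauss_def using assms by (subst integral_density) auto

lemma integrable_gauss_iff:
  fixes f :: "real \<Rightarrow> real"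
  assumes "f \<in> borel_measurable borel"
  shows "integrable gauss f \<longleftrightarrow> integrable lborel (\<lambda>z. std_normal_density z * f z)"
  unfolding gauss_def using assms by (subst integrable_density) auto

lemma integrable_gauss_power: "integrable gauss (\<lambda>z. z ^ k)"
  by (subst integrable_gauss_iff) (auto intro: integrable_std_normal_moment)

text \<open>Growth is measured throughout against \<open>1 + z ^ 4\<close>, whose Gaussian integral
  is \<open>4\<close>. Up to a constant it dominates the weights \<open>1\<close>, \<open>z\<close>
  and \<open>z^2 - 1\<close> even with a further factor \<open>1 + \<bar>z\<bar>\<close>, which is
  the growth of an antiderivative of a bounded function.\<close>

lemma gauss_integrableI:
  fixes f :: "real \<Rightarrow> real"
  assumes "f \<in> borel_measurable borel" "\<And>z. \<bar>f z\<bar> \<le> C * (1 + z ^ 4)"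
  shows "integrable gauss f"
proof (rule Bochner_Integration.integrable_bound)
  show "integrable gauss (\<lambda>z. C * (1 + z ^ 4))"
    using integrable_gauss_power[of 0] integrable_gauss_power[of 4] by simp
  show "AE z in gauss. norm (f z) \<le> norm (C * (1 + z ^ 4))"
    using assms(2) by (auto intro!: AE_I2 order_trans[OF assms(2)])
qed (use assms in simp)

lemma integral_gauss_weight: "(\<integral>z. 1 + z ^ 4 \<partial>gauss) = 4"
proof -
  interpret prob_space gauss by (rule prob_space_gauss)
  have "(\<integral>z. z ^ 4 \<partial>gauss) = (\<integral>z. std_normal_density z * z ^ (2 * 2) \<partial>lborel)"
    by (subst integral_gauss) auto
  also have "\<dots> = 3" by (subst integral_std_normal_moment_even) (simp add: fact_numeral)
  finally show ?thesis using integrable_gauss_power[of 4] using prob_space by simp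
qed

lemma gauss_integral_bound:
  fixes f :: "real \<Rightarrow> real"
  assumes "f \<in> borel_measurable borel" "\<And>z. \<bar>f z\<bar> \<le> C * (1 + z ^ 4)"
  shows "\<bar>\<integral>z. f z \<partial>gauss\<bar> \<le> 4 * C"
proof -
  have "\<bar>\<integral>z. f z \<partial>gauss\<bar> \<le> (\<integral>z. \<bar>f z\<bar> \<partial>gauss)" by (rule integral_abs_bound)
  also have "\<dots> \<le> (\<integral>z. C * (1 + z ^ 4) \<partial>gauss)"
    using integrable_gauss_power[of 0] integrable_gauss_power[of 4] assms
    by (intro integral_mono integrable_abs gauss_integrableI[of f C]) auto
  also have "\<dots> = 4 * C" using integral_gauss_weight by (simp only: integral_mult_right_zero)
  finally show ?thesis .
qed

lemma integral_gauss_reflect: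
  fixes f :: "real \<Rightarrow> real"
  assumes [measurable]: "f \<in> borel_measurable borel"
  shows "(\<integral>z. f (- z) \<partial>gauss) = (\<integral>z. f z \<partial>gauss)"
  using lborel_integral_real_affine[of "-1" "\<lambda>z. std_normal_density z * f z" 0]
  by (simp add: integral_gauss std_normal_density_def)

lemma gauss_weights:
  fixes z :: real
  shows "1 \<le> 1 + z ^ 4" "\<bar>z\<bar> \<le> 1 + z ^ 4" "z\<^sup>2 \<le> 1 + z ^ 4" "\<bar>z\<bar> ^ 3 \<le> 1 + z ^ 4" "\<bar>z\<^sup>2 - 1\<bar> \<le> 1 + z ^ 4"
proof -
  define y where "y = \<bar>z\<bar>"
  have y: "0 \<le> y" "z ^ 4 = y ^ 4" "z\<^sup>2 = y\<^sup>2" by (auto simp: y_def power_even_abs)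
  have p: "y \<le> 1 + y ^ 4 \<and> y\<^sup>2 \<le> 1 + y ^ 4 \<and> y ^ 3 \<le> 1 + y ^ 4"
  proof (cases "y \<le> 1")
    case True
    then have "y\<^sup>2 \<le> 1" "y ^ 3 \<le> 1" "0 \<le> y ^ 4" using y by (auto intro: power_le_one)
    then show ?thesis using True by linarith
  next
    case False
    then have "y ^ 1 \<le> y ^ 4" "y\<^sup>2 \<le> y ^ 4" "y ^ 3 \<le> y ^ 4" by (intro power_increasing; simp)+
    then show ?thesis by simp
  qed
  then show "\<bar>z\<bar> \<le> 1 + z ^ 4" "\<bar>z\<bar> ^ 3 \<le> 1 + z ^ 4" and z2: "z\<^sup>2 \<le> 1 + z ^ 4"
    unfolding y(2,3) by (auto simp: y_def)
  have "0 \<le> z ^ 4" "0 \<le> z\<^sup>2" by auto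
  then show "\<bar>z\<^sup>2 - 1\<bar> \<le> 1 + z ^ 4" using z2 unfolding abs_le_iff by linarith
qed auto

text \<open>Integration by parts: the density satisfies \<open>\<phi>' = - z * \<phi>\<close>, so
  the derivative of \<open>H * \<phi>\<close> is the difference of the two integrands, and
  \<open>H * \<phi>\<close> vanishes at both infinities because \<open>H\<close> grows at most
  polynomially.\<close>

lemma gauss_Stein:
  fixes H H' :: "real \<Rightarrow> real"
  assumes der: "\<And>z. (H has_real_derivative H' z) (at z)"
    and cont: "continuous_on UNIV H'"
    and H: "\<And>z. \<bar>z * H z\<bar> \<le> C * (1 + z ^ 4)" and H': "\<And>z. \<bar>H' z\<bar> \<le> C * (1 + z ^ 4)"
  shows "(\<integral>z. z * H z \<partial>gauss) = (\<integral>z. H' z \<partial>gauss)"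
proof -
  define \<phi> where "\<phi> = std_normal_density"
  have Hc: "continuous_on UNIV H" using der by (auto intro!: DERIV_continuous_on)
  have [measurable]: "H \<in> borel_measurable borel" "H' \<in> borel_measurable borel"
    using Hc cont by (auto intro: borel_measurable_continuous_onI)
  have \<phi>': "(\<phi> has_real_derivative - z * \<phi> z) (at z)" for z
    unfolding \<phi>_def std_normal_density_def by (auto intro!: derivative_eq_intros simp: field_simps)
  have \<phi>c: "isCont \<phi> z" for z using \<phi>' DERIV_isCont by blast
  define A' where "A' z = H' z * \<phi> z - z * H z * \<phi> z" for z
  have A: "((\<lambda>z. H z * \<phi> z) has_real_derivative A' z) (at z)" for z
    unfolding A'_def by (auto intro!: derivative_eq_intros der \<phi>')
  have I1: "integrable gauss (\<lambda>z. z * H z)" using H by (intro gauss_integrableI[where C = C]) auto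
  have I2: "integrable gauss H'" using H' by (intro gauss_integrableI[where C = C]) auto
  have J1: "integrable lborel (\<lambda>z. \<phi> z * (z * H z))" using I1 by (subst (asm) integrable_gauss_iff) (auto simp: \<phi>_def)
  have J2: "integrable lborel (\<lambda>z. \<phi> z * H' z)" using I2 by (subst (asm) integrable_gauss_iff) (auto simp: \<phi>_def)
  have intA: "integrable lborel A'" using Bochner_Integration.integrable_diff[OF J2 J1] by (simp add: A'_def[abs_def] mult_ac)
  have lim: "((\<lambda>z. C * (1 + z ^ 4) * \<phi> z) \<longlongrightarrow> 0) at_top" "((\<lambda>z. C * (1 + z ^ 4) * \<phi> z) \<longlongrightarrow> 0) at_bot"
    unfolding \<phi>_def std_normal_density_def by real_asymp+
  \<comment> \<open>The hypothesis controls \<open>z * H z\<close>; away from \<open>0\<close> this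
    also controls \<open>H z\<close>, which is enough for the limits at infinity.\<close>
  have dom: "norm (H z * \<phi> z) \<le> C * (1 + z ^ 4) * \<phi> z" if "\<bar>z\<bar> \<ge> 1" for z
  proof -
    have "\<bar>H z\<bar> \<le> \<bar>z\<bar> * \<bar>H z\<bar>" using that mult_right_mono[of 1 "\<bar>z\<bar>" "\<bar>H z\<bar>"] by simp
    then have "\<bar>H z\<bar> \<le> C * (1 + z ^ 4)" using H[of z] by (simp add: abs_mult)
    then show ?thesis by (simp add: abs_mult \<phi>_def mult_right_mono)
  qed
  have top: "((\<lambda>z. H z * \<phi> z) \<longlongrightarrow> 0) at_top"
    by (rule Lim_null_comparison[OF _ lim(1)]) (rule eventually_mono[OF eventually_ge_at_top[of 1]], rule dom, simp)
  have bot: "((\<lambda>z. H z * \<phi> z) \<longlongrightarrow> 0) at_bot"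
    by (rule Lim_null_comparison[OF _ lim(2)]) (rule eventually_mono[OF eventually_le_at_bot[of "-1"]], rule dom, simp)
  have "(LBINT z=-\<infinity>..\<infinity>. A' z) = 0 - 0"
  proof (rule interval_integral_FTC_integrable[where F = "\<lambda>z. H z * \<phi> z"])
    show "((\<lambda>z. H z * \<phi> z) has_vector_derivative A' z) (at z)" for z
      using A by (simp add: has_real_derivative_iff_has_vector_derivative)
    show "isCont A' z" for z
      using Hc cont \<phi>c unfolding A'_def by (auto intro!: continuous_intros simp: continuous_on_eq_continuous_at)
    show "set_integrable lborel (einterval (- \<infinity>) \<infinity>) A'"
      using intA by (simp add: set_integrable_def einterval_iff einterval_def)
  qed (use top bot in \<open>auto simp: ereal_tendsto_simps\<close>)
  then have "(\<integral>z. A' z \<partial>lborel) = 0"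
    by (simp add: interval_lebesgue_integral_def set_lebesgue_integral_def einterval_def)
  moreover have "(\<integral>z. A' z \<partial>lborel) = (\<integral>z. \<phi> z * H' z \<partial>lborel) - (\<integral>z. \<phi> z * (z * H z) \<partial>lborel)"
    using Bochner_Integration.integral_diff[OF J2 J1] by (simp add: A'_def[abs_def] mult_ac)
  ultimately show ?thesis by (simp add: integral_gauss \<phi>_def)
qed

section \<open>The heat semigroup\<close>

lemma antiderivative_UNIV:
  fixes g :: "real \<Rightarrow> real"
  assumes "continuous_on UNIV g"
  obtains G where "\<And>x. (G has_real_derivative g x) (at x)"
proof -
  have "\<exists>F. \<forall>x::real. - \<infinity> < ereal x \<longrightarrow> ereal x < \<infinity> \<longrightarrow> (F has_vector_derivative g x) (at x)"
    using assms by (intro einterval_antiderivative) (auto simp: continuous_on_eq_continuous_at)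
  then show thesis using that by (auto simp: has_real_derivative_iff_has_vector_derivative)
qed

lemma antiderivative_growth:
  fixes G g :: "real \<Rightarrow> real"
  assumes "\<And>x. (G has_real_derivative g x) (at x)" "\<And>x. \<bar>g x\<bar> \<le> M"
  shows "\<bar>G x\<bar> \<le> \<bar>G 0\<bar> + M * \<bar>x\<bar>"
proof -
  have "norm (G x - G 0) \<le> M * norm (x - 0)"
    by (rule field_differentiable_bound[of UNIV G g]) (use assms in auto)
  then show ?thesis by simp
qed

lemma gauss_weighted_bound:
  fixes G g :: "real \<Rightarrow> real"
  assumes G: "\<And>x. (G has_real_derivative g x) (at x)" and M: "\<And>x. \<bar>g x\<bar> \<le> M"
    and p: "\<bar>p\<bar> * (1 + \<bar>z\<bar>) \<le> 2 * (1 + z ^ 4)"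
  shows "\<bar>p * G (x + k * z)\<bar> \<le> 2 * (\<bar>G 0\<bar> + M * \<bar>x\<bar> + M * \<bar>k\<bar>) * (1 + z ^ 4)"
proof -
  have M0: "0 \<le> M" using M[of 0] by linarith
  define B where "B = \<bar>G 0\<bar> + M * \<bar>x\<bar> + M * \<bar>k\<bar>"
  have B: "0 \<le> B" using M0 by (simp add: B_def)
  have "\<bar>G (x + k * z)\<bar> \<le> \<bar>G 0\<bar> + M * \<bar>x + k * z\<bar>" by (rule antiderivative_growth[OF G M])
  also have "\<dots> \<le> \<bar>G 0\<bar> + M * (\<bar>x\<bar> + \<bar>k\<bar> * \<bar>z\<bar>)"
    using M0 by (intro add_left_mono mult_left_mono) (auto simp flip: abs_mult)
  also have "\<dots> \<le> B * (1 + \<bar>z\<bar>)"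
    using M0 by (simp add: B_def algebra_simps)
  finally have "\<bar>p\<bar> * \<bar>G (x + k * z)\<bar> \<le> \<bar>p\<bar> * (B * (1 + \<bar>z\<bar>))" by (intro mult_left_mono) auto
  also have "\<dots> = B * (\<bar>p\<bar> * (1 + \<bar>z\<bar>))" by simp
  also have "\<dots> \<le> B * (2 * (1 + z ^ 4))" using B p by (intro mult_left_mono)
  finally show ?thesis by (simp add: abs_mult B_def algebra_simps)
qed

lemma gauss_weights_linear:
  fixes z :: real
  shows "\<bar>1::real\<bar> * (1 + \<bar>z\<bar>) \<le> 2 * (1 + z ^ 4)" "\<bar>z\<bar> * (1 + \<bar>z\<bar>) \<le> 2 * (1 + z ^ 4)"
    "\<bar>z\<^sup>2 - 1\<bar> * (1 + \<bar>z\<bar>) \<le> 4 * (1 + z ^ 4)" "\<bar>z\<^sup>2\<bar> * (1 + \<bar>z\<bar>) \<le> 2 * (1 + z ^ 4)"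
proof -
  have "\<bar>z\<^sup>2 - 1\<bar> * (1 + \<bar>z\<bar>) \<le> (z\<^sup>2 + 1) * (1 + \<bar>z\<bar>)" by (intro mult_right_mono) (auto simp: abs_le_iff)
  also have "\<dots> = z\<^sup>2 + 1 + \<bar>z\<bar> ^ 3 + \<bar>z\<bar>" by (simp add: algebra_simps power2_eq_square power3_eq_cube)
  also have "\<dots> \<le> 4 * (1 + z ^ 4)"
    using add_mono[OF add_mono[OF add_mono[OF gauss_weights(3,1)] gauss_weights(4)] gauss_weights(2), of z z z z] by simp
  finally show "\<bar>z\<^sup>2 - 1\<bar> * (1 + \<bar>z\<bar>) \<le> 4 * (1 + z ^ 4)" .
  show "\<bar>1::real\<bar> * (1 + \<bar>z\<bar>) \<le> 2 * (1 + z ^ 4)"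
    using add_mono[OF gauss_weights(1,2), of z z] by simp
qed (use gauss_weights[of z] in \<open>auto simp: algebra_simps power2_eq_square power3_eq_cube\<close>)

text \<open>Stein's identity moves the derivative from the antiderivative \<open>G\<close> to the weight, so that
  convolutions of a merely continuous \<open>g\<close> can be differentiated under the integral.\<close>

lemma gauss_conv_parts:
  fixes G g :: "real \<Rightarrow> real"
  assumes G: "\<And>x. (G has_real_derivative g x) (at x)" and M: "\<And>x. \<bar>g x\<bar> \<le> M"
    and g: "continuous_on UNIV g"
  shows "(\<integral>z. z * G (x + k * z) \<partial>gauss) = k * (\<integral>z. g (x + k * z) \<partial>gauss)"
    and "(\<integral>z. (z\<^sup>2 - 1) * G (x + k * z) \<partial>gauss) = k * (\<integral>z. z * g (x + k * z) \<partial>gauss)"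
proof -
  have M0: "0 \<le> M" using M[of 0] by linarith
  have Gc: "continuous_on UNIV G" using G by (auto intro!: DERIV_continuous_on)
  have cG: "continuous_on UNIV (\<lambda>z. G (x + k * z))" and cg: "continuous_on UNIV (\<lambda>z. g (x + k * z))"
    by (auto intro!: continuous_on_compose2[OF Gc] continuous_on_compose2[OF g] continuous_intros)
  have [measurable]: "(\<lambda>z. G (x + k * z)) \<in> borel_measurable borel" "(\<lambda>z. g (x + k * z)) \<in> borel_measurable borel"
    using cG cg by (auto intro: borel_measurable_continuous_onI)
  define C where "C = 2 * (\<bar>G 0\<bar> + M * \<bar>x\<bar> + M * \<bar>k\<bar>) + \<bar>k\<bar> * M"
  have wb: "\<bar>p * G (x + k * z)\<bar> + \<bar>k * (q * g (x + k * z))\<bar> \<le> C * (1 + z ^ 4)"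
    if "\<bar>p\<bar> * (1 + \<bar>z\<bar>) \<le> 2 * (1 + z ^ 4)" "\<bar>q\<bar> \<le> 1 + z ^ 4" for p q z
  proof -
    have "\<bar>k * (q * g (x + k * z))\<bar> \<le> \<bar>k\<bar> * ((1 + z ^ 4) * M)"
      unfolding abs_mult using that M M0 by (intro mult_left_mono mult_mono) auto
    then show ?thesis using gauss_weighted_bound[OF G M that(1), of x k] by (simp add: C_def algebra_simps)
  qed
  have wb': "\<bar>p * G (x + k * z)\<bar> \<le> C * (1 + z ^ 4)" if "\<bar>p\<bar> * (1 + \<bar>z\<bar>) \<le> 2 * (1 + z ^ 4)" for p z
    using wb[OF that, of 0] by simp
  have dG: "((\<lambda>z. G (x + k * z)) has_real_derivative k * g (x + k * z)) (at z)" for z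
    by (rule DERIV_cong[OF DERIV_chain2[OF G]]) (auto intro!: derivative_eq_intros)
  have "(\<integral>z. z * G (x + k * z) \<partial>gauss) = (\<integral>z. k * g (x + k * z) \<partial>gauss)"
    using dG
  proof (rule gauss_Stein[where C = C])
    show "continuous_on UNIV (\<lambda>z. k * g (x + k * z))" by (intro continuous_intros cg)
    show "\<bar>k * g (x + k * z)\<bar> \<le> C * (1 + z ^ 4)" for z using wb[of 0 z 1] by simp
  qed (auto intro!: wb' gauss_weights_linear)
  then show "(\<integral>z. z * G (x + k * z) \<partial>gauss) = k * (\<integral>z. g (x + k * z) \<partial>gauss)" by simp
  have I: "integrable gauss (\<lambda>z. G (x + k * z))" "integrable gauss (\<lambda>z. k * (z * g (x + k * z)))"
    "integrable gauss (\<lambda>z. z\<^sup>2 * G (x + k * z))"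
  proof -
    have "\<bar>G (x + k * z)\<bar> \<le> C * (1 + z ^ 4)" "\<bar>k * (z * g (x + k * z))\<bar> \<le> C * (1 + z ^ 4)"
      "\<bar>z\<^sup>2 * G (x + k * z)\<bar> \<le> C * (1 + z ^ 4)" for z
      using wb'[OF gauss_weights_linear(1), of z] wb'[OF gauss_weights_linear(4), of z]
        wb[of 0 z z] gauss_weights(2)[of z] by auto
    then show "integrable gauss (\<lambda>z. G (x + k * z))" "integrable gauss (\<lambda>z. k * (z * g (x + k * z)))"
      "integrable gauss (\<lambda>z. z\<^sup>2 * G (x + k * z))"
      by (intro gauss_integrableI[where C = C]; simp)+
  qed
  have "(\<integral>z. z * (z * G (x + k * z)) \<partial>gauss) = (\<integral>z. G (x + k * z) + k * (z * g (x + k * z)) \<partial>gauss)"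
  proof (rule gauss_Stein[where C = C])
    show "((\<lambda>z. z * G (x + k * z)) has_real_derivative G (x + k * z) + k * (z * g (x + k * z))) (at z)" for z
      by (auto intro!: derivative_eq_intros dG)
    show "continuous_on UNIV (\<lambda>z. G (x + k * z) + k * (z * g (x + k * z)))" by (intro continuous_intros cg cG)
    show "\<bar>z * (z * G (x + k * z))\<bar> \<le> C * (1 + z ^ 4)" for z
      using wb'[OF gauss_weights_linear(4), of z] by (simp add: power2_eq_square mult.assoc)
    show "\<bar>G (x + k * z) + k * (z * g (x + k * z))\<bar> \<le> C * (1 + z ^ 4)" for z
      using wb[OF gauss_weights_linear(1) gauss_weights(2), of z] by simp
  qed
  also have "\<dots> = (\<integral>z. G (x + k * z) \<partial>gauss) + k * (\<integral>z. z * g (x + k * z) \<partial>gauss)"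
    using I by simp
  finally have "(\<integral>z. z\<^sup>2 * G (x + k * z) \<partial>gauss) = (\<integral>z. G (x + k * z) \<partial>gauss) + k * (\<integral>z. z * g (x + k * z) \<partial>gauss)"
    by (simp add: power2_eq_square mult.assoc)
  then show "(\<integral>z. (z\<^sup>2 - 1) * G (x + k * z) \<partial>gauss) = k * (\<integral>z. z * g (x + k * z) \<partial>gauss)"
    using I by (simp add: left_diff_distrib)
qed

lemma has_derivative_gauss_conv:
  fixes G g p :: "real \<Rightarrow> real"
  assumes G: "\<And>x. (G has_real_derivative g x) (at x)" and M: "\<And>x. \<bar>g x\<bar> \<le> M"
    and g: "continuous_on UNIV g"
    and pm [measurable]: "p \<in> borel_measurable borel"
    and p: "\<And>z. \<bar>p z\<bar> * (1 + \<bar>z\<bar>) \<le> C * (1 + z ^ 4)"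
  shows "((\<lambda>x. \<integral>z. p z * G (x + k * z) \<partial>gauss) has_real_derivative (\<integral>z. p z * g (x + k * z) \<partial>gauss)) (at x)"
    and "((\<lambda>k. \<integral>z. p z * G (x + k * z) \<partial>gauss) has_real_derivative (\<integral>z. p z * (z * g (x + k * z)) \<partial>gauss)) (at k)"
proof -
  have M0: "0 \<le> M" using M[of 0] by linarith
  have Gc: "continuous_on UNIV G" using G by (auto intro!: DERIV_continuous_on)
  have [measurable]: "G \<in> borel_measurable borel" "g \<in> borel_measurable borel"
    using Gc g by (auto intro: borel_measurable_continuous_onI)
  have C: "0 \<le> C" using p[of 0] abs_ge_zero[of "p 0"] by simp
  have p1: "\<bar>p z\<bar> \<le> C * (1 + z ^ 4)" and p2: "\<bar>p z * z\<bar> \<le> C * (1 + z ^ 4)" for z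
    using p[of z] mult_nonneg_nonneg[of "\<bar>p z\<bar>" "\<bar>z\<bar>"] unfolding abs_mult distrib_left by linarith+
  have int: "integrable gauss (\<lambda>z. p z * G (x + k * z))" for x k
  proof (rule gauss_integrableI)
    fix z
    \<comment> \<open>The rescaling normalises \<open>p\<close> to the form required by
      \<open>gauss_weighted_bound\<close>; \<open>C + 1\<close> replaces \<open>C\<close> to avoid a
      division by zero.\<close>
    have "\<bar>2 * p z / (C + 1)\<bar> * (1 + \<bar>z\<bar>) \<le> 2 * (1 + z ^ 4)"
    proof -
      have "\<bar>p z\<bar> * (1 + \<bar>z\<bar>) \<le> (C + 1) * (1 + z ^ 4)" using p[of z] gauss_weights(1)[of z] by (simp only: distrib_right mult_1)
      then show ?thesis using C by (simp add: abs_mult field_simps)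
    qed
    then have "\<bar>2 * p z / (C + 1) * G (x + k * z)\<bar> \<le> 2 * (\<bar>G 0\<bar> + M * \<bar>x\<bar> + M * \<bar>k\<bar>) * (1 + z ^ 4)"
      by (rule gauss_weighted_bound[OF G M])
    then show "\<bar>p z * G (x + k * z)\<bar> \<le> ((\<bar>G 0\<bar> + M * \<bar>x\<bar> + M * \<bar>k\<bar>) * (C + 1)) * (1 + z ^ 4)"
      using C by (simp add: abs_mult field_simps)
  qed simp
  have dom: "integrable gauss (\<lambda>z. (M * C) * (1 + z ^ 4))"
    using integrable_gauss_power[of 0] integrable_gauss_power[of 4] by simp
  show "((\<lambda>x. \<integral>z. p z * G (x + k * z) \<partial>gauss) has_real_derivative (\<integral>z. p z * g (x + k * z) \<partial>gauss)) (at x)"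
  proof (rule has_derivative_integral_dominated[where a = "x - 1" and b = "x + 1"])
    show "AE z in gauss. \<forall>y. x - 1 < y \<longrightarrow> y < x + 1 \<longrightarrow>
        ((\<lambda>y. p z * G (y + k * z)) has_real_derivative p z * g (y + k * z)) (at y) \<and>
        \<bar>p z * g (y + k * z)\<bar> \<le> (M * C) * (1 + z ^ 4)"
    proof (intro AE_I2 allI impI conjI)
      fix z y
      show "((\<lambda>y. p z * G (y + k * z)) has_real_derivative p z * g (y + k * z)) (at y)"
        by (rule DERIV_cong[OF DERIV_cmult[OF DERIV_chain2[OF G]]]) (auto intro!: derivative_eq_intros)
      show "\<bar>p z * g (y + k * z)\<bar> \<le> (M * C) * (1 + z ^ 4)"
        using mult_mono[OF p1[of z] M[of "y + k * z"]] C M0 by (simp add: abs_mult mult_ac)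
    qed
  qed (use int dom in auto)
  show "((\<lambda>k. \<integral>z. p z * G (x + k * z) \<partial>gauss) has_real_derivative (\<integral>z. p z * (z * g (x + k * z)) \<partial>gauss)) (at k)"
  proof (rule has_derivative_integral_dominated[where a = "k - 1" and b = "k + 1"])
    show "AE z in gauss. \<forall>k'. k - 1 < k' \<longrightarrow> k' < k + 1 \<longrightarrow>
        ((\<lambda>k. p z * G (x + k * z)) has_real_derivative p z * (z * g (x + k' * z))) (at k') \<and>
        \<bar>p z * (z * g (x + k' * z))\<bar> \<le> (M * C) * (1 + z ^ 4)"
    proof (intro AE_I2 allI impI conjI)
      fix z y
      show "((\<lambda>k. p z * G (x + k * z)) has_real_derivative p z * (z * g (x + y * z))) (at y)"
        by (rule DERIV_cong[OF DERIV_cmult[OF DERIV_chain2[OF G]]]) (auto intro!: derivative_eq_intros)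
      show "\<bar>p z * (z * g (x + y * z))\<bar> \<le> (M * C) * (1 + z ^ 4)"
        using mult_mono[OF p2[of z] M[of "x + y * z"]] C M0 by (simp add: abs_mult mult_ac)
    qed
  qed (use int dom in auto)
qed

text \<open>\<open>heat0\<close> is the heat semigroup and \<open>heat1\<close>, \<open>heat2\<close> are its space derivatives for \<open>h > 0\<close>.
  For \<open>h < 0\<close> we have \<open>sqrt (2 * h) = - sqrt \<bar>2 * h\<bar>\<close>, so \<open>heat0 g h = heat0 g \<bar>h\<bar>\<close> and \<open>heat0\<close>
  is continuous in all real \<open>h\<close>.\<close>

definition heat0 :: "(real \<Rightarrow> real) \<Rightarrow> real \<Rightarrow> real \<Rightarrow> real" where
  "heat0 g h x = (\<integral>z. g (x + sqrt (2 * h) * z) \<partial>gauss)"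

definition heat1 :: "(real \<Rightarrow> real) \<Rightarrow> real \<Rightarrow> real \<Rightarrow> real" where
  "heat1 g h x = (\<integral>z. z * g (x + sqrt (2 * h) * z) \<partial>gauss) / sqrt (2 * h)"

definition heat2 :: "(real \<Rightarrow> real) \<Rightarrow> real \<Rightarrow> real \<Rightarrow> real" where
  "heat2 g h x = (\<integral>z. (z\<^sup>2 - 1) * g (x + sqrt (2 * h) * z) \<partial>gauss) / (2 * h)"

text \<open>With \<open>k = sqrt (2 * h)\<close> and an antiderivative \<open>G\<close> of
  \<open>g\<close>, Stein's identity turns \<open>heat0\<close> into an average of
  \<open>z * G (x + k * z)\<close> divided by \<open>k\<close>, and \<open>heat1\<close> into one of
  \<open>(z^2 - 1) * G (x + k * z)\<close> divided by \<open>k * k\<close>. Differentiation then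
  falls on \<open>G\<close>. The time derivative is taken in \<open>k\<close> first, and
  \<open>dk/dh = 1 / k\<close> leads to the same \<open>heat2\<close>, which is the heat
  equation.\<close>

lemma heat_derivatives:
  fixes g :: "real \<Rightarrow> real"
  assumes g: "continuous_on UNIV g" and M: "\<And>x. \<bar>g x\<bar> \<le> M" and h: "h > 0"
  shows "(heat0 g h has_real_derivative heat1 g h x) (at x)"
    and "(heat1 g h has_real_derivative heat2 g h x) (at x)"
    and "((\<lambda>h. heat0 g h x) has_real_derivative heat2 g h x) (at h)"
proof -
  obtain G where G: "\<And>x. (G has_real_derivative g x) (at x)" using antiderivative_UNIV[OF g] by blast
  note parts = gauss_conv_parts[OF G M g]
  define k where "k = sqrt (2 * h)"
  have k: "k > 0" "k * k = 2 * h" using h by (auto simp: k_def)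
  have gb: "continuous_on UNIV (\<lambda>z. g (x + k * z))" for k
    by (auto intro!: continuous_on_compose2[OF g] continuous_intros)
  have [measurable]: "(\<lambda>z. g (x + k * z)) \<in> borel_measurable borel" for k
    using gb by (auto intro: borel_measurable_continuous_onI)
  have M0: "0 \<le> M" using M[of 0] by linarith
  have I: "integrable gauss (\<lambda>z. g (x + k * z))" "integrable gauss (\<lambda>z. z\<^sup>2 * g (x + k * z))" for k
  proof -
    show "integrable gauss (\<lambda>z. g (x + k * z))"
      using M mult_left_mono[OF gauss_weights(1) M0] by (intro gauss_integrableI[where C = M]) (auto intro: order_trans)
    have "\<bar>z\<^sup>2 * g (x + k * z)\<bar> \<le> M * (1 + z ^ 4)" for z
      using mult_mono[OF gauss_weights(3)[of z] M[of "x + k * z"]] by (simp add: abs_mult mult_ac)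
    then show "integrable gauss (\<lambda>z. z\<^sup>2 * g (x + k * z))" by (intro gauss_integrableI[where C = M]) auto
  qed
  have e0: "heat0 g h = (\<lambda>x. (\<integral>z. z * G (x + k * z) \<partial>gauss) / k)"
    using k by (simp add: heat0_def parts(1) k_def fun_eq_iff)
  show "(heat0 g h has_real_derivative heat1 g h x) (at x)"
    unfolding e0 heat1_def
    by (rule DERIV_cong[OF DERIV_cdivide[OF has_derivative_gauss_conv(1)[OF G M g, where C = 2]]])
       (use gauss_weights_linear in \<open>auto simp: k_def\<close>)
  have e1: "heat1 g h = (\<lambda>x. (\<integral>z. (z\<^sup>2 - 1) * G (x + k * z) \<partial>gauss) / (2 * h))"
    unfolding parts(2) heat1_def k_def[symmetric]
    unfolding k(2)[symmetric] using k(1) by auto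
  show "(heat1 g h has_real_derivative heat2 g h x) (at x)"
    unfolding e1 heat2_def
    by (rule DERIV_cong[OF DERIV_cdivide[OF has_derivative_gauss_conv(1)[OF G M g, where C = 4]]])
       (use gauss_weights_linear in \<open>auto simp: k_def\<close>)
  have "((\<lambda>k. (\<integral>z. z * G (x + k * z) \<partial>gauss) / k) has_real_derivative
      ((\<integral>z. z * (z * g (x + k * z)) \<partial>gauss) * k - (\<integral>z. z * G (x + k * z) \<partial>gauss) * 1) / (k * k)) (at k)"
    by (intro DERIV_divide has_derivative_gauss_conv(2)[OF G M g, where C = 2] DERIV_ident)
       (use gauss_weights_linear k in auto)
  \<comment> \<open>By Stein's identity the second term of the quotient rule is the plain average of
    \<open>g\<close> divided by \<open>k\<close>; it supplies the \<open>- 1\<close> in the weight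
    \<open>z^2 - 1\<close>.\<close>
  moreover have "((\<integral>z. z * (z * g (x + k * z)) \<partial>gauss) * k - (\<integral>z. z * G (x + k * z) \<partial>gauss) * 1) / (k * k)
      = (\<integral>z. (z\<^sup>2 - 1) * g (x + k * z) \<partial>gauss) / k"
  proof -
    have "(\<integral>z. (z\<^sup>2 - 1) * g (x + k * z) \<partial>gauss) = (\<integral>z. z\<^sup>2 * g (x + k * z) \<partial>gauss) - (\<integral>z. g (x + k * z) \<partial>gauss)"
      using I[of k] by (simp add: left_diff_distrib)
    moreover have "(\<integral>z. z * (z * g (x + k * z)) \<partial>gauss) = (\<integral>z. z\<^sup>2 * g (x + k * z) \<partial>gauss)"
      by (simp add: power2_eq_square mult.assoc)
    ultimately show ?thesis
      unfolding parts(1) using k(1) by (simp add: diff_divide_distrib)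
  qed
  ultimately have dk: "((\<lambda>k. (\<integral>z. z * G (x + k * z) \<partial>gauss) / k) has_real_derivative
      (\<integral>z. (z\<^sup>2 - 1) * g (x + k * z) \<partial>gauss) / k) (at (sqrt (2 * h)))" by (simp add: k_def)
  have "((\<lambda>h. sqrt (2 * h)) has_real_derivative 1 / k) (at h)"
    using h by (auto intro!: derivative_eq_intros simp: k_def field_simps)
  note DERIV_chain2[OF dk this]
  then have "((\<lambda>h. (\<integral>z. z * G (x + sqrt (2 * h) * z) \<partial>gauss) / sqrt (2 * h)) has_real_derivative heat2 g h x) (at h)"
    by (rule DERIV_cong) (unfold heat2_def k_def[symmetric], unfold k(2)[symmetric], use k(1) in simp)
  then show "((\<lambda>h. heat0 g h x) has_real_derivative heat2 g h x) (at h)"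
    by (rule has_field_derivative_transform_within_open[where S = "{0<..}"])
       (use h in \<open>auto simp: heat0_def parts(1)\<close>)
qed

lemma continuous_gauss_conv:
  fixes f :: "real \<Rightarrow> real \<Rightarrow> real"
  assumes f: "continuous_on UNIV (\<lambda>(s, x). f s x)" and M: "\<And>s x. \<bar>f s x\<bar> \<le> M"
    and p: "continuous_on UNIV p" "\<And>z. \<bar>p z\<bar> \<le> 1 + z ^ 4"
  shows "continuous_on UNIV (\<lambda>(s, h, x). \<integral>z. p z * f s (x + sqrt (2 * h) * z) \<partial>gauss)"
  unfolding continuous_on_eq_continuous_at[OF open_UNIV]
proof
  fix q :: "real \<times> real \<times> real"
  have M0: "0 \<le> M" using M[of 0 0] by linarith
  have fc: "continuous_on UNIV (\<lambda>q. f (fst q) (snd (snd q) + sqrt (2 * fst (snd q)) * z))" for z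
    by (rule continuous_on_compose2[OF f, of UNIV "\<lambda>q. (fst q, snd (snd q) + sqrt (2 * fst (snd q)) * z)", simplified])
       (intro continuous_intros)
  have fz: "continuous_on UNIV (\<lambda>z. f s (x + sqrt (2 * h) * z))" for s h x
    by (rule continuous_on_compose2[OF f, of UNIV "\<lambda>z. (s, x + sqrt (2 * h) * z)", simplified])
       (intro continuous_intros)
  have fc': "isCont (\<lambda>q. f (fst q) (snd (snd q) + sqrt (2 * fst (snd q)) * z)) q" for z
    using fc[of z] continuous_on_eq_continuous_at[OF open_UNIV] by blast
  have "isCont (\<lambda>q. \<integral>z. p z * f (fst q) (snd (snd q) + sqrt (2 * fst (snd q)) * z) \<partial>gauss) q"
  proof (rule isCont_integral_dominated[where U = UNIV and g = "\<lambda>z. M * (1 + z ^ 4)"])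
    show "(\<lambda>z. p z * f (fst q) (snd (snd q) + sqrt (2 * fst (snd q)) * z)) \<in> borel_measurable gauss" for q
      using borel_measurable_continuous_onI[OF fz[of "fst q" "snd (snd q)" "fst (snd q)"]]
        borel_measurable_continuous_onI[OF p(1)] by simp
    show "integrable gauss (\<lambda>z. M * (1 + z ^ 4))"
      using integrable_gauss_power[of 0] integrable_gauss_power[of 4] by simp
    show "AE z in gauss. \<bar>p z * f (fst q) (snd (snd q) + sqrt (2 * fst (snd q)) * z)\<bar> \<le> M * (1 + z ^ 4)" for q
      using mult_mono[OF p(2) M] by (auto intro!: AE_I2 simp: abs_mult mult.commute[of M])
    show "AE z in gauss. isCont (\<lambda>q. p z * f (fst q) (snd (snd q) + sqrt (2 * fst (snd q)) * z)) q"
      by (intro AE_I2 continuous_intros fc')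
  qed auto
  then show "isCont (\<lambda>(s, h, x). \<integral>z. p z * f s (x + sqrt (2 * h) * z) \<partial>gauss) q"
    by (simp add: case_prod_unfold)
qed

lemma abs_heat0_le:
  fixes g :: "real \<Rightarrow> real"
  assumes "\<And>x. \<bar>g x\<bar> \<le> M"
  shows "\<bar>heat0 g h x\<bar> \<le> M"
proof -
  interpret prob_space gauss by (rule prob_space_gauss)
  show ?thesis
  proof (cases "integrable gauss (\<lambda>z. g (x + sqrt (2 * h) * z))")
    case True
    have "\<bar>heat0 g h x\<bar> \<le> (\<integral>z. \<bar>g (x + sqrt (2 * h) * z)\<bar> \<partial>gauss)" unfolding heat0_def by (rule integral_abs_bound)
    also have "\<dots> \<le> (\<integral>z. M \<partial>gauss)" using True assms by (intro integral_mono integrable_abs) auto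
    finally show ?thesis using prob_space by simp
  next
    \<comment> \<open>A non-integrable function has integral \<open>0\<close> by convention, and
      \<open>0 \<le> \<bar>g 0\<bar> \<le> M\<close>.\<close>
    case False
    then show ?thesis using assms[of 0] by (simp add: heat0_def not_integrable_integral_eq)
  qed
qed

lemma heat0_diff:
  fixes f g :: "real \<Rightarrow> real"
  assumes f: "continuous_on UNIV f" "\<And>x. \<bar>f x\<bar> \<le> M" and g: "continuous_on UNIV g" "\<And>x. \<bar>g x\<bar> \<le> M"
  shows "heat0 f h x - heat0 g h x = heat0 (\<lambda>x. f x - g x) h x"
proof -
  have M0: "0 \<le> M" using f(2)[of 0] by linarith
  have "integrable gauss (\<lambda>z. f (x + k * z))" if f: "continuous_on UNIV f" "\<And>x. \<bar>f x\<bar> \<le> M" for f :: "real \<Rightarrow> real" and k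
  proof (rule gauss_integrableI[where C = M])
    have "continuous_on UNIV (\<lambda>z. f (x + k * z))" by (auto intro!: continuous_on_compose2[OF f(1)] continuous_intros)
    then show "(\<lambda>z. f (x + k * z)) \<in> borel_measurable borel" by (rule borel_measurable_continuous_onI)
    show "\<bar>f (x + k * z)\<bar> \<le> M * (1 + z ^ 4)" for z
      using mult_left_mono[OF gauss_weights(1)[of z] M0] f(2)[of "x + k * z"] by simp
  qed
  from this[OF f] this[OF g] show ?thesis by (simp add: heat0_def)
qed

lemma heat0_shift: "heat0 (\<lambda>x. g (x + c)) h x = heat0 g h (x + c)"
  by (simp add: heat0_def add_ac)

text \<open>The semigroup commutes with translations, so the difference of two values is the
  semigroup applied to \<open>g\<close> minus its translate, and averaging does not increase the
  supremum.\<close>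

lemma heat0_Lipschitz:
  fixes g :: "real \<Rightarrow> real"
  assumes g: "continuous_on UNIV g" "\<And>x. \<bar>g x\<bar> \<le> M" and L: "\<And>x y. \<bar>g x - g y\<bar> \<le> L * \<bar>x - y\<bar>"
  shows "\<bar>heat0 g h x - heat0 g h y\<bar> \<le> L * \<bar>x - y\<bar>"
proof -
  have "heat0 (\<lambda>w. g (w + (x - y))) h y - heat0 g h y = heat0 (\<lambda>w. g (w + (x - y)) - g w) h y"
    by (rule heat0_diff[where M = M]) (use g in \<open>auto intro!: continuous_on_compose2[OF g(1)] continuous_intros\<close>)
  moreover have "\<bar>heat0 (\<lambda>w. g (w + (x - y)) - g w) h y\<bar> \<le> L * \<bar>x - y\<bar>"
    using L by (intro abs_heat0_le) (metis add_diff_cancel_left')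
  ultimately show ?thesis by (simp add: heat0_shift)
qed

text \<open>The Gaussian measure is symmetric. This is what carries the Dirichlet condition: a
  function that is odd about \<open>c\<close> vanishes at \<open>c\<close>.\<close>

lemma heat0_reflect:
  fixes g :: "real \<Rightarrow> real"
  assumes g: "continuous_on UNIV g" and odd: "\<And>x. g (2 * c - x) = - g x"
  shows "heat0 g h (2 * c - x) = - heat0 g h x"
proof -
  define k where "k = sqrt (2 * h)"
  have "continuous_on UNIV (\<lambda>z. g (x + k * z))" by (auto intro!: continuous_on_compose2[OF g] continuous_intros)
  then have "(\<lambda>z. g (x + k * z)) \<in> borel_measurable borel" by (rule borel_measurable_continuous_onI)
  from integral_gauss_reflect[OF this] have "(\<integral>z. g (x - k * z) \<partial>gauss) = (\<integral>z. g (x + k * z) \<partial>gauss)" by simp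
  moreover have "g (2 * c - x + k * z) = - g (x - k * z)" for z
    using odd[of "x - k * z"] by (simp add: algebra_simps)
  ultimately show ?thesis by (simp add: heat0_def k_def)
qed

lemma abs_heat1_le:
  fixes g :: "real \<Rightarrow> real"
  assumes g: "continuous_on UNIV g" and M: "\<And>x. \<bar>g x\<bar> \<le> M" and h: "h > 0"
  shows "\<bar>heat1 g h x\<bar> \<le> 4 * M / sqrt (2 * h)"
proof -
  have c: "continuous_on UNIV (\<lambda>z. z * g (x + sqrt (2 * h) * z))"
    by (auto intro!: continuous_intros continuous_on_compose2[OF g])
  have "\<bar>\<integral>z. z * g (x + sqrt (2 * h) * z) \<partial>gauss\<bar> \<le> 4 * M"
    using mult_mono[OF gauss_weights(2) M]
    by (intro gauss_integral_bound borel_measurable_continuous_onI c) (auto simp: abs_mult mult_ac)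
  then show ?thesis using h by (simp add: heat1_def abs_mult divide_right_mono)
qed

text \<open>The weight \<open>z^2 - 1\<close> has mean zero, so the constant \<open>g x\<close> may
  be subtracted from \<open>g\<close>. Hoelder continuity then gains a factor \<open>sqrt k\<close>,
  and \<open>sqrt k / (2 * h)\<close> has order \<open>h powr (- 3/4)\<close> instead of the
  non-integrable \<open>1 / h\<close>.\<close>

lemma abs_heat2_le:
  fixes g :: "real \<Rightarrow> real"
  assumes g: "continuous_on UNIV g" and M: "\<And>x. \<bar>g x\<bar> \<le> M" and h: "h > 0"
    and H: "\<And>x y. \<bar>g x - g y\<bar> \<le> c * sqrt \<bar>x - y\<bar>"
  shows "\<bar>heat2 g h x\<bar> \<le> 16 * c * h powr (- 3/4)"
proof -
  define k where "k = sqrt (2 * h)"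
  have k: "k > 0" "k * k = 2 * h" using h by (auto simp: k_def)
  have c0: "0 \<le> c" using H[of 1 0] by simp
  have cg: "continuous_on UNIV (\<lambda>z. g (x + k * z))"
    by (auto intro!: continuous_intros continuous_on_compose2[OF g])
  have bg: "(\<lambda>z. g (x + k * z)) \<in> borel_measurable borel" using cg by (rule borel_measurable_continuous_onI)
  have I: "integrable gauss (\<lambda>z. (z\<^sup>2 - 1) * g (x + k * z))"
    using mult_mono[OF gauss_weights(5) M] bg
    by (intro gauss_integrableI[where C = M]) (auto simp: abs_mult mult_ac)
  have I': "integrable gauss (\<lambda>z. z\<^sup>2 - 1 :: real)"
    using integrable_gauss_power[of 0] integrable_gauss_power[of 2] by simp
  \<comment> \<open>The variance is \<open>1\<close>, by Stein's identity for the identity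
    function.\<close>
  have "(\<integral>z. z * z \<partial>gauss) = (\<integral>z. 1 \<partial>gauss)"
    by (rule gauss_Stein[where C = 1]) (use gauss_weights in \<open>auto intro!: derivative_eq_intros simp: power2_eq_square\<close>)
  then have z0: "(\<integral>z. z\<^sup>2 - 1 \<partial>gauss) = 0"
    using integrable_gauss_power[of 0] integrable_gauss_power[of 2] by (simp add: power2_eq_square)
  have "(\<integral>z. (z\<^sup>2 - 1) * g (x + k * z) \<partial>gauss) = (\<integral>z. (z\<^sup>2 - 1) * g (x + k * z) - (z\<^sup>2 - 1) * g x \<partial>gauss)"
    using I I' z0 by simp
  also have "\<bar>\<dots>\<bar> \<le> 4 * (4 * c * sqrt k)"
  proof (rule gauss_integral_bound)
    show "(\<lambda>z. (z\<^sup>2 - 1) * g (x + k * z) - (z\<^sup>2 - 1) * g x) \<in> borel_measurable borel" using bg by simp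
    fix z :: real
    have "sqrt \<bar>z\<bar> \<le> 1 + \<bar>z\<bar>" by (rule real_le_lsqrt) (auto simp: power2_eq_square algebra_simps)
    then have "c * (sqrt k * sqrt \<bar>z\<bar>) \<le> c * (sqrt k * (1 + \<bar>z\<bar>))"
      using c0 k by (intro mult_left_mono) auto
    moreover have "\<bar>g (x + k * z) - g x\<bar> \<le> c * (sqrt k * sqrt \<bar>z\<bar>)"
      using H[of "x + k * z" x] k by (simp add: abs_mult real_sqrt_mult)
    ultimately have "\<bar>z\<^sup>2 - 1\<bar> * \<bar>g (x + k * z) - g x\<bar> \<le> \<bar>z\<^sup>2 - 1\<bar> * (c * (sqrt k * (1 + \<bar>z\<bar>)))"
      by (intro mult_left_mono) auto
    also have "\<dots> = c * sqrt k * (\<bar>z\<^sup>2 - 1\<bar> * (1 + \<bar>z\<bar>))" by simp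
    also have "\<dots> \<le> c * sqrt k * (4 * (1 + z ^ 4))"
      using c0 k by (intro mult_left_mono gauss_weights_linear) auto
    finally show "\<bar>(z\<^sup>2 - 1) * g (x + k * z) - (z\<^sup>2 - 1) * g x\<bar> \<le> 4 * c * sqrt k * (1 + z ^ 4)"
      unfolding right_diff_distrib[symmetric] abs_mult by (simp add: mult_ac)
  qed
  finally have "\<bar>heat2 g h x\<bar> \<le> 16 * c * (sqrt k / (2 * h))"
    using h by (simp add: heat2_def k_def abs_mult field_simps)
  also have "sqrt k / (2 * h) = (2 * h) powr (- 3/4)"
  proof -
    have "sqrt k = (2 * h) powr (1/4)" using h by (simp add: k_def powr_half_sqrt[symmetric] powr_powr)
    then have "sqrt k / (2 * h) = (2 * h) powr (1/4) / (2 * h) powr 1" using h by simp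
    also have "\<dots> = (2 * h) powr (- 3/4)" by (simp only: powr_diff[symmetric]) simp
    finally show ?thesis .
  qed
  also have "16 * c * (2 * h) powr (- 3/4) \<le> 16 * c * h powr (- 3/4)"
    using c0 h by (intro mult_left_mono powr_mono2') auto
  finally show ?thesis .
qed

section \<open>Duhamel's formula\<close>

lemma continuous_heat:
  fixes f :: "real \<Rightarrow> real \<Rightarrow> real"
  assumes f: "continuous_on UNIV (\<lambda>(s, x). f s x)" and M: "\<And>s x. \<bar>f s x\<bar> \<le> M"
  shows "continuous_on UNIV (\<lambda>(s, h, x). heat0 (f s) h x)"
    and "continuous_on (UNIV \<times> {0<..} \<times> UNIV) (\<lambda>(s, h, x). heat1 (f s) h x)"
    and "continuous_on (UNIV \<times> {0<..} \<times> UNIV) (\<lambda>(s, h, x). heat2 (f s) h x)"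
proof -
  note conv = continuous_gauss_conv[OF f M]
  show "continuous_on UNIV (\<lambda>(s, h, x). heat0 (f s) h x)"
    using conv[of "\<lambda>_. 1"] by (simp add: heat0_def)
  have "continuous_on (UNIV \<times> {0<..} \<times> UNIV)
      (\<lambda>q. (case q of (s, h, x) \<Rightarrow> \<integral>z. z * f s (x + sqrt (2 * h) * z) \<partial>gauss) / sqrt (2 * fst (snd q)))"
    by (intro continuous_intros continuous_on_subset[OF conv[of "\<lambda>z. z"]]) (auto simp: gauss_weights)
  then show "continuous_on (UNIV \<times> {0<..} \<times> UNIV) (\<lambda>(s, h, x). heat1 (f s) h x)"
    by (simp add: heat1_def case_prod_unfold)
  have "continuous_on (UNIV \<times> {0<..} \<times> UNIV)
      (\<lambda>q. (case q of (s, h, x) \<Rightarrow> \<integral>z. (z\<^sup>2 - 1) * f s (x + sqrt (2 * h) * z) \<partial>gauss) / (2 * fst (snd q)))"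
    by (intro continuous_intros continuous_on_subset[OF conv[of "\<lambda>z. z\<^sup>2 - 1"]]) (auto simp: gauss_weights)
  then show "continuous_on (UNIV \<times> {0<..} \<times> UNIV) (\<lambda>(s, h, x). heat2 (f s) h x)"
    by (simp add: heat2_def case_prod_unfold)
qed

text \<open>The integrable singularity \<open>h powr (- 3/4)\<close> is the size of the second derivative of the heat
  semigroup on Hoelder functions of exponent \<open>1/2\<close>; see \<open>abs_heat2_le\<close>.\<close>

definition singular_kernel ::
  "((real \<Rightarrow> real) \<Rightarrow> real \<Rightarrow> real \<Rightarrow> real) \<Rightarrow> (real \<Rightarrow> real \<Rightarrow> real) \<Rightarrow> bool" where
  "singular_kernel W f \<longleftrightarrow>
     continuous_on (UNIV \<times> {0<..} \<times> UNIV) (\<lambda>(s, h, x). W (f s) h x) \<and>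
     (\<forall>T. \<exists>C\<ge>0. \<forall>s\<le>T. \<forall>h>0. \<forall>x. \<bar>W (f s) h x\<bar> \<le> C * (1 + h powr (- 3/4)))"

definition spatially_Hoelder :: "(real \<Rightarrow> real \<Rightarrow> real) \<Rightarrow> bool" where
  "spatially_Hoelder f \<longleftrightarrow> (\<forall>T. \<exists>c. \<forall>s\<le>T. \<forall>x y. \<bar>f s x - f s y\<bar> \<le> c * sqrt \<bar>x - y\<bar>)"

text \<open>The kernel \<open>heat0\<close> is bounded and \<open>heat1\<close> has order
  \<open>h powr (- 1/2)\<close>; both satisfy the worse bound of \<open>heat2\<close>, so that a
  single theory of Duhamel integrals serves \<open>u\<close> and its space derivatives.\<close>

lemma singular_kernel_heat:
  fixes f :: "real \<Rightarrow> real \<Rightarrow> real"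
  assumes f: "continuous_on UNIV (\<lambda>(s, x). f s x)" and M: "\<And>s x. \<bar>f s x\<bar> \<le> M"
  shows "singular_kernel heat0 f" "singular_kernel heat1 f" "spatially_Hoelder f \<Longrightarrow> singular_kernel heat2 f"
proof -
  have M0: "0 \<le> M" using M[of 0 0] by linarith
  have fc: "continuous_on UNIV (f s)" for s
    by (rule continuous_on_compose2[OF f, of UNIV "\<lambda>x. (s, x)", simplified]) (intro continuous_intros)
  show "singular_kernel heat0 f"
    unfolding singular_kernel_def
  proof (intro conjI allI exI[of _ M] impI)
    show "continuous_on (UNIV \<times> {0<..} \<times> UNIV) (\<lambda>(s, h, x). heat0 (f s) h x)"
      using continuous_heat(1)[OF f M] by (rule continuous_on_subset) auto
    fix s h x :: real
    have "M * 1 \<le> M * (1 + h powr (- 3/4))" using M0 by (intro mult_left_mono) auto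
    then show "\<bar>heat0 (f s) h x\<bar> \<le> M * (1 + h powr (- 3/4))" using abs_heat0_le[of "f s" M h x] M by simp
  qed (rule M0)
  show "singular_kernel heat1 f"
    unfolding singular_kernel_def
  proof (intro conjI allI exI[of _ "4 * M"] impI)
    show "continuous_on (UNIV \<times> {0<..} \<times> UNIV) (\<lambda>(s, h, x). heat1 (f s) h x)"
      by (rule continuous_heat(2)[OF f M])
    fix s h x :: real assume h: "h > 0"
    have "1 / sqrt (2 * h) \<le> 1 + h powr (- 3/4)"
    proof (cases "h \<le> 1")
      case True
      have "1 / sqrt (2 * h) \<le> 1 / sqrt h" using h by (intro divide_left_mono) auto
      also have "\<dots> = h powr (- (1/2))" using h by (simp only: powr_minus_divide powr_half_sqrt less_imp_le)
      also have "\<dots> \<le> h powr (- 3/4)" using h True by (intro powr_mono') auto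
      finally show ?thesis by simp
    next
      case False
      then have "1 \<le> sqrt (2 * h)" by simp
      then have "1 / sqrt (2 * h) \<le> 1" using h by simp
      then show ?thesis by (simp add: add_increasing2)
    qed
    then have "4 * M * (1 / sqrt (2 * h)) \<le> 4 * M * (1 + h powr (- 3/4))" using M0 by (intro mult_left_mono) auto
    then show "\<bar>heat1 (f s) h x\<bar> \<le> 4 * M * (1 + h powr (- 3/4))"
      using abs_heat1_le[OF fc M h, of s x] by simp
  qed (use M0 in simp)
  show "singular_kernel heat2 f" if H: "spatially_Hoelder f"
    unfolding singular_kernel_def
  proof (intro conjI allI)
    show "continuous_on (UNIV \<times> {0<..} \<times> UNIV) (\<lambda>(s, h, x). heat2 (f s) h x)"
      by (rule continuous_heat(3)[OF f M])
    fix T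
    obtain c where c: "\<And>s x y. s \<le> T \<Longrightarrow> \<bar>f s x - f s y\<bar> \<le> c * sqrt \<bar>x - y\<bar>"
      using H unfolding spatially_Hoelder_def by blast
    have c0: "c \<ge> 0" using c[of T 1 0] by simp
    have "\<bar>heat2 (f s) h x\<bar> \<le> 16 * c * (1 + h powr (- 3/4))" if "s \<le> T" "h > 0" for s h x
    proof -
      have "16 * c * h powr (- 3/4) \<le> 16 * c * (1 + h powr (- 3/4))" using c0 by (intro mult_left_mono) auto
      then show ?thesis using abs_heat2_le[OF fc M \<open>h > 0\<close> c[OF \<open>s \<le> T\<close>], of x] by simp
    qed
    then show "\<exists>C\<ge>0. \<forall>s\<le>T. \<forall>h>0. \<forall>x. \<bar>heat2 (f s) h x\<bar> \<le> C * (1 + h powr (- 3/4))"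
      using c0 by (intro exI[of _ "16 * c"]) auto
  qed
qed

lemma singular_kernelD:
  assumes "singular_kernel W f"
  obtains C where "C \<ge> 0" "\<And>s h x. s \<le> T \<Longrightarrow> 0 < h \<Longrightarrow> \<bar>W (f s) h x\<bar> \<le> C * (1 + h powr (- 3/4))"
  using assms unfolding singular_kernel_def by meson

lemma singular_kernel_continuous_on:
  fixes S :: "'a::topological_space set"
  assumes W: "singular_kernel W f" and c: "continuous_on S a" "continuous_on S b" "continuous_on S c"
    and pos: "\<And>p. p \<in> S \<Longrightarrow> 0 < b p"
  shows "continuous_on S (\<lambda>p. W (f (a p)) (b p) (c p))"
proof -
  have "continuous_on (UNIV \<times> {0<..} \<times> UNIV) (\<lambda>(s, h, x). W (f s) h x)"
    using W by (simp add: singular_kernel_def)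
  then have "continuous_on S (\<lambda>p. case (a p, b p, c p) of (s, h, x) \<Rightarrow> W (f s) h x)"
    by (rule continuous_on_compose2) (auto intro!: continuous_on_Pair c pos)
  then show ?thesis by simp
qed

section \<open>Duhamel integrals with a singular kernel\<close>

lemma integrable_singular_weight:
  "integrable lborel (\<lambda>h::real. indicator {0<..<T} h * (1 + h powr (- 3/4)))"
proof (cases "0 < T")
  case True
  have "set_integrable lborel (einterval (ereal 0) (ereal T)) (\<lambda>h. 1 + h powr (- 3/4))"
  proof (rule interval_integral_FTC_nonneg(1)[where F = "\<lambda>h. h + 4 * h powr (1/4)" and A = 0 and B = "T + 4 * T powr (1/4)"])
    show "((\<lambda>h. h + 4 * h powr (1/4)) has_real_derivative 1 + h powr (- 3/4)) (at h)"
      if "ereal 0 < ereal h" "ereal h < ereal T" for h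
      using that by (auto intro!: derivative_eq_intros)
    have "((\<lambda>h::real. h + 4 * h powr (1/4)) \<longlongrightarrow> 0 + 4 * 0) (at_right 0)"
      by real_asymp
    then show "(((\<lambda>h. h + 4 * h powr (1/4)) \<circ> real_of_ereal) \<longlongrightarrow> 0) (at_right (ereal 0))"
      by (simp add: ereal_tendsto_simps)
    have "((\<lambda>h::real. h + 4 * h powr (1/4)) \<longlongrightarrow> T + 4 * T powr (1/4)) (at_left T)"
      using True by (intro tendsto_intros) auto
    then show "(((\<lambda>h. h + 4 * h powr (1/4)) \<circ> real_of_ereal) \<longlongrightarrow> T + 4 * T powr (1/4)) (at_left (ereal T))"
      by (simp add: ereal_tendsto_simps)
  qed (use True in \<open>auto intro!: continuous_intros AE_I2\<close>)
  then show ?thesis by (simp add: set_integrable_def)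
qed simp

text \<open>The integration variable is the elapsed time \<open>h\<close>, not the source time
  \<open>t - h\<close>: the singularity then stays at \<open>h = 0\<close> when \<open>t\<close>
  varies, and one majorant serves all \<open>t \<le> T\<close>.\<close>

definition duhamel ::
  "((real \<Rightarrow> real) \<Rightarrow> real \<Rightarrow> real \<Rightarrow> real) \<Rightarrow> (real \<Rightarrow> real \<Rightarrow> real) \<Rightarrow> real \<Rightarrow> real \<Rightarrow> real" where
  "duhamel W f t x = (\<integral>h. indicator {0<..<t} h * W (f (t - h)) h x \<partial>lborel)"

lemma duhamel_nonpos: "t \<le> 0 \<Longrightarrow> duhamel W f t x = 0"
  by (simp add: duhamel_def)

lemma measurable_duhamel_integrand:
  assumes "singular_kernel W f"
  shows "(\<lambda>h. indicator {0<..<t} h * W (f (t - h)) h x) \<in> borel_measurable borel"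
proof -
  have "continuous_on {0<..<t} (\<lambda>h. W (f (t - h)) h x)"
    by (intro singular_kernel_continuous_on[OF assms] continuous_intros) auto
  from borel_measurable_continuous_on_indicator[OF _ this] show ?thesis by simp
qed

lemma duhamel_integrand_bound:
  fixes W :: "(real \<Rightarrow> real) \<Rightarrow> real \<Rightarrow> real \<Rightarrow> real" and f :: "real \<Rightarrow> real \<Rightarrow> real"
  assumes C: "0 \<le> C" "\<And>s h x. s \<le> T \<Longrightarrow> 0 < h \<Longrightarrow> \<bar>W (f s) h x\<bar> \<le> C * (1 + h powr (- 3/4))" and t: "t \<le> T"
  shows "\<bar>indicator {0<..<t} h * W (f (t - h)) h x\<bar> \<le> C * (indicator {0<..<T} h * (1 + h powr (- 3/4)))"
proof (cases "h \<in> {0<..<t}")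
  case True
  then show ?thesis using C(2)[of "t - h" h x] t by auto
next
  case False
  then show ?thesis using C(1) by (auto intro!: mult_nonneg_nonneg)
qed

lemma integrable_duhamel_integrand:
  assumes "singular_kernel W f"
  shows "integrable lborel (\<lambda>h. indicator {0<..<t} h * W (f (t - h)) h x)"
proof -
  obtain C where C: "0 \<le> C" "\<And>s h x. s \<le> t \<Longrightarrow> 0 < h \<Longrightarrow> \<bar>W (f s) h x\<bar> \<le> C * (1 + h powr (- 3/4))"
    using singular_kernelD[OF assms] by metis
  have "integrable lborel (\<lambda>h. C * (indicator {0<..<t} h * (1 + h powr (- 3/4))))"
    using integrable_singular_weight[of t] by simp
  then show ?thesis
    by (rule Bochner_Integration.integrable_bound)
       (use measurable_duhamel_integrand[OF assms] in
         \<open>auto intro!: AE_I2 order_trans[OF duhamel_integrand_bound[where W = W and f = f, OF C order_refl]]\<close>)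
qed

lemma duhamel_bounded:
  assumes "singular_kernel W f"
  shows "\<exists>B. \<forall>t\<le>T. \<forall>x. \<bar>duhamel W f t x\<bar> \<le> B"
proof -
  obtain C where C: "0 \<le> C" "\<And>s h x. s \<le> T \<Longrightarrow> 0 < h \<Longrightarrow> \<bar>W (f s) h x\<bar> \<le> C * (1 + h powr (- 3/4))"
    using singular_kernelD[OF assms] by metis
  have "\<bar>duhamel W f t x\<bar> \<le> (\<integral>h. C * (indicator {0<..<T} h * (1 + h powr (- 3/4))) \<partial>lborel)" if "t \<le> T" for t x
  proof -
    have "\<bar>duhamel W f t x\<bar> \<le> (\<integral>h. \<bar>indicator {0<..<t} h * W (f (t - h)) h x\<bar> \<partial>lborel)"
      unfolding duhamel_def by (rule integral_abs_bound)
    also have "\<dots> \<le> (\<integral>h. C * (indicator {0<..<T} h * (1 + h powr (- 3/4))) \<partial>lborel)"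
      using integrable_singular_weight[of T] integrable_duhamel_integrand[OF assms]
      by (intro integral_mono duhamel_integrand_bound[where W = W and f = f, OF C that] integrable_abs) auto
    finally show ?thesis .
  qed
  then show ?thesis by blast
qed

lemma continuous_duhamel:
  assumes W: "singular_kernel W f"
  shows "continuous_on UNIV (\<lambda>(t, x). duhamel W f t x)"
  unfolding continuous_on_eq_continuous_at[OF open_UNIV]
proof
  fix q :: "real \<times> real"
  define T where "T = fst q + 1"
  obtain C where C: "0 \<le> C" "\<And>s h x. s \<le> T \<Longrightarrow> 0 < h \<Longrightarrow> \<bar>W (f s) h x\<bar> \<le> C * (1 + h powr (- 3/4))"
    using singular_kernelD[OF W] by metis
  have "isCont (\<lambda>q. \<integral>h. indicator {0<..<fst q} h * W (f (fst q - h)) h (snd q) \<partial>lborel) q"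
  proof (rule isCont_integral_dominated[where U = "{..<T} \<times> UNIV" and g = "\<lambda>h. C * (indicator {0<..<T} h * (1 + h powr (- 3/4)))"])
    show "open ({..<T} \<times> (UNIV :: real set))" by (intro open_Times) auto
    show "q \<in> {..<T} \<times> UNIV" by (cases q) (auto simp: T_def)
    show "(\<lambda>h. indicator {0<..<fst q} h * W (f (fst q - h)) h (snd q)) \<in> borel_measurable lborel" for q
      using measurable_duhamel_integrand[OF W] by simp
    show "AE h in lborel. \<bar>indicator {0<..<fst q} h * W (f (fst q - h)) h (snd q)\<bar>
        \<le> C * (indicator {0<..<T} h * (1 + h powr (- 3/4)))" if "q \<in> {..<T} \<times> UNIV" for q
      using that by (intro AE_I2 duhamel_integrand_bound[where W = W and f = f, OF C]) auto
    show "integrable lborel (\<lambda>h. C * (indicator {0<..<T} h * (1 + h powr (- 3/4))))"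
      using integrable_singular_weight[of T] by simp
    \<comment> \<open>In its dependence on time the indicator jumps only when \<open>h\<close>
      equals that time, so one value of \<open>h\<close> is discarded; for every other
      \<open>h\<close> the indicator is locally constant.\<close>
    show "AE h in lborel. isCont (\<lambda>q. indicator {0<..<fst q} h * W (f (fst q - h)) h (snd q)) q"
      using AE_lborel_singleton[of "fst q"]
    proof (rule AE_mp, intro AE_I2 impI)
      fix h assume ne: "h \<noteq> fst q"
      consider "h \<le> 0" | "0 < h" "h < fst q" | "0 < h" "fst q < h" using ne by linarith
      then show "isCont (\<lambda>q. indicator {0<..<fst q} h * W (f (fst q - h)) h (snd q)) q"
      proof cases
        case 1 then show ?thesis by simp
      next
        case 2
        have "continuous_on UNIV (\<lambda>q. W (f (fst q - h)) h (snd q))"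
          using 2 by (intro singular_kernel_continuous_on[OF W] continuous_intros) auto
        then have c: "isCont (\<lambda>q. W (f (fst q - h)) h (snd q)) q"
          using continuous_on_eq_continuous_at[OF open_UNIV] by blast
        have "\<forall>\<^sub>F p in nhds q. p \<in> {h<..} \<times> UNIV"
          using 2 by (intro eventually_nhds_in_open open_Times) (auto simp: mem_Times_iff)
        then have "\<forall>\<^sub>F p in nhds q. indicator {0<..<fst p} h * W (f (fst p - h)) h (snd p) = W (f (fst p - h)) h (snd p)"
          by eventually_elim (use 2 in auto)
        from isCont_cong[OF this] show ?thesis using c by simp
      next
        case 3
        have "\<forall>\<^sub>F p in nhds q. p \<in> {..<h} \<times> UNIV"
          using 3 by (intro eventually_nhds_in_open open_Times) (auto simp: mem_Times_iff)
        then have "\<forall>\<^sub>F p in nhds q. indicator {0<..<fst p} h * W (f (fst p - h)) h (snd p) = 0"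
          by eventually_elim (use 3 in auto)
        from isCont_cong[OF this] show ?thesis by simp
      qed
    qed
  qed
  then show "isCont (\<lambda>(t, x). duhamel W f t x) q"
    by (simp add: duhamel_def case_prod_unfold)
qed

lemma has_derivative_duhamel:
  assumes W: "singular_kernel W f" and W': "singular_kernel W' f"
    and der: "\<And>s h x. 0 < h \<Longrightarrow> (W (f s) h has_real_derivative W' (f s) h x) (at x)"
  shows "(duhamel W f t has_real_derivative duhamel W' f t x) (at x)"
  unfolding duhamel_def[abs_def]
proof -
  obtain C where C: "0 \<le> C" "\<And>s h x. s \<le> t \<Longrightarrow> 0 < h \<Longrightarrow> \<bar>W' (f s) h x\<bar> \<le> C * (1 + h powr (- 3/4))"
    using singular_kernelD[OF W'] by metis
  show "((\<lambda>x. \<integral>h. indicator {0<..<t} h * W (f (t - h)) h x \<partial>lborel) has_real_derivative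
      (\<integral>h. indicator {0<..<t} h * W' (f (t - h)) h x \<partial>lborel)) (at x)"
  proof (rule has_derivative_integral_dominated[where a = "x - 1" and b = "x + 1"
        and g = "\<lambda>h. C * (indicator {0<..<t} h * (1 + h powr (- 3/4)))"])
    show "integrable lborel (\<lambda>h. C * (indicator {0<..<t} h * (1 + h powr (- 3/4))))"
      using integrable_singular_weight[of t] by simp
    show "AE h in lborel. \<forall>y. x - 1 < y \<longrightarrow> y < x + 1 \<longrightarrow>
        ((\<lambda>y. indicator {0<..<t} h * W (f (t - h)) h y) has_real_derivative
          indicator {0<..<t} h * W' (f (t - h)) h y) (at y) \<and>
        \<bar>indicator {0<..<t} h * W' (f (t - h)) h y\<bar> \<le> C * (indicator {0<..<t} h * (1 + h powr (- 3/4)))"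
    proof (intro AE_I2 allI impI conjI)
      fix h y
      show "((\<lambda>y. indicator {0<..<t} h * W (f (t - h)) h y) has_real_derivative
          indicator {0<..<t} h * W' (f (t - h)) h y) (at y)"
        by (cases "h \<in> {0<..<t}") (auto intro!: DERIV_cmult der)
    qed (rule duhamel_integrand_bound[where W = W' and f = f, OF C order_refl])
  qed (use integrable_duhamel_integrand[OF W] measurable_duhamel_integrand[OF W'] in auto)
qed

lemma duhamel_reverse:
  "(\<integral>s. indicator {0<..<t} s * W (f s) (t - s) x \<partial>lborel) = duhamel W f t x"
proof -
  have "(\<integral>s. indicator {0<..<t} s * W (f s) (t - s) x \<partial>lborel) =
      (\<integral>h. indicator {0<..<t} (t - h) * W (f (t - h)) h x \<partial>lborel)"
    using lborel_integral_real_affine[of "-1" "\<lambda>s. indicator {0<..<t} s * W (f s) (t - s) x" t] by simp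
  also have "(\<lambda>h. indicator {0<..<t} (t - h) :: real) = indicator {0<..<t}"
    by (auto simp: indicator_def fun_eq_iff)
  finally show ?thesis by (simp add: duhamel_def fun_eq_iff)
qed

text \<open>The semigroup is a contraction in the supremum norm, so at elapsed time \<open>h\<close>
  the difference is at most \<open>b (t - h)\<close>. The majorant is given together with its
  antiderivative \<open>B\<close>, which lets the iteration estimate be verified by
  differentiation.\<close>

lemma abs_duhamel_diff_le:
  fixes f g :: "real \<Rightarrow> real \<Rightarrow> real"
  assumes f: "continuous_on UNIV (\<lambda>(s, x). f s x)" "\<And>s x. \<bar>f s x\<bar> \<le> M"
    and g: "continuous_on UNIV (\<lambda>(s, x). g s x)" "\<And>s x. \<bar>g s x\<bar> \<le> M"
    and le: "\<And>s y. 0 \<le> s \<Longrightarrow> s \<le> t \<Longrightarrow> \<bar>f s y - g s y\<bar> \<le> b s"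
    and B: "\<And>s. (B has_real_derivative b s) (at s)" "continuous_on UNIV b"
    and t: "0 \<le> t"
  shows "\<bar>duhamel heat0 f t x - duhamel heat0 g t x\<bar> \<le> B t - B 0"
proof -
  have fc: "continuous_on UNIV (f s)" for s
    by (rule continuous_on_compose2[OF f(1), of UNIV "\<lambda>x. (s, x)", simplified]) (intro continuous_intros)
  have gc: "continuous_on UNIV (g s)" for s
    by (rule continuous_on_compose2[OF g(1), of UNIV "\<lambda>x. (s, x)", simplified]) (intro continuous_intros)
  have If: "integrable lborel (\<lambda>h. indicator {0<..<t} h * heat0 (f (t - h)) h x)"
    and Ig: "integrable lborel (\<lambda>h. indicator {0<..<t} h * heat0 (g (t - h)) h x)"
    by (rule integrable_duhamel_integrand[where W = heat0 and f = f, OF singular_kernel_heat(1)[OF f]],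
        rule integrable_duhamel_integrand[where W = heat0 and f = g, OF singular_kernel_heat(1)[OF g]])
  have bc: "continuous_on S (\<lambda>h. b (t - h))" for S
    by (rule continuous_on_compose2[OF B(2)]) (auto intro!: continuous_intros)
  have "set_integrable lborel {0..t} (\<lambda>h. b (t - h))"
    using bc by (intro borel_integrable_atLeastAtMost') auto
  then have "set_integrable lborel {0<..<t} (\<lambda>h. b (t - h))" by (rule set_integrable_subset) auto
  then have Ib: "integrable lborel (\<lambda>h. indicator {0<..<t} h * b (t - h))" by (simp add: set_integrable_def)
  have "(LBINT h=ereal 0..ereal t. b (t - h)) = - B (t - t) - (- B (t - 0))"
  proof (rule interval_integral_FTC_finite)
    fix h and S :: "real set"
    have "((\<lambda>h. t - h) has_real_derivative - 1) (at h)" by (auto intro!: derivative_eq_intros)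
    from DERIV_minus[OF DERIV_chain2[OF B(1) this]]
    have "((\<lambda>h. - B (t - h)) has_real_derivative b (t - h)) (at h)" by simp
    then show "((\<lambda>h. - B (t - h)) has_vector_derivative b (t - h)) (at h within S)"
      unfolding has_real_derivative_iff_has_vector_derivative[symmetric]
      by (rule has_field_derivative_at_within)
  qed (rule bc)
  then have eq: "(\<integral>h. indicator {0<..<t} h * b (t - h) \<partial>lborel) = B t - B 0"
    using t by (simp add: interval_lebesgue_integral_def set_lebesgue_integral_def einterval_eq)
  have "\<bar>duhamel heat0 f t x - duhamel heat0 g t x\<bar> =
      \<bar>\<integral>h. indicator {0<..<t} h * heat0 (f (t - h)) h x - indicator {0<..<t} h * heat0 (g (t - h)) h x \<partial>lborel\<bar>"
    unfolding duhamel_def using If Ig by simp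
  also have "\<dots> \<le> (\<integral>h. \<bar>indicator {0<..<t} h * heat0 (f (t - h)) h x - indicator {0<..<t} h * heat0 (g (t - h)) h x\<bar> \<partial>lborel)"
    by (rule integral_abs_bound)
  also have "\<dots> \<le> (\<integral>h. indicator {0<..<t} h * b (t - h) \<partial>lborel)"
  proof (rule integral_mono[OF integrable_abs[OF Bochner_Integration.integrable_diff[OF If Ig]] Ib])
    fix h
    show "\<bar>indicator {0<..<t} h * heat0 (f (t - h)) h x - indicator {0<..<t} h * heat0 (g (t - h)) h x\<bar>
        \<le> indicator {0<..<t} h * b (t - h)"
    proof (cases "h \<in> {0<..<t}")
      case True
      have "heat0 (f (t - h)) h x - heat0 (g (t - h)) h x = heat0 (\<lambda>x. f (t - h) x - g (t - h) x) h x"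
        by (rule heat0_diff[OF fc f(2) gc g(2)])
      moreover have "\<bar>heat0 (\<lambda>x. f (t - h) x - g (t - h) x) h x\<bar> \<le> b (t - h)"
        using True by (intro abs_heat0_le le) auto
      ultimately show ?thesis using True by simp
    qed simp
  qed
  finally show ?thesis using eq by simp
qed

lemma duhamel_reflect:
  fixes f :: "real \<Rightarrow> real \<Rightarrow> real"
  assumes f: "\<And>s. continuous_on UNIV (f s)" and odd: "\<And>s x. f s (2 * c - x) = - f s x"
  shows "duhamel heat0 f t (2 * c - x) = - duhamel heat0 f t x"
  unfolding duhamel_def heat0_reflect[OF f odd] by simp

text \<open>Write \<open>heat0 (f s) (t - s) x = f s x + (\<integral>r\<in>{s<..<t}. heat2 (f s) (r - s) x)\<close> and exchange the
  integrals over \<open>s\<close> and \<open>r\<close>.\<close>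

lemma duhamel_time_integral:
  fixes f :: "real \<Rightarrow> real \<Rightarrow> real"
  assumes f: "continuous_on UNIV (\<lambda>(s, x). f s x)" "\<And>s x. \<bar>f s x\<bar> \<le> M" and H: "spatially_Hoelder f"
  shows "duhamel heat0 f t x = (\<integral>r. indicator {0<..<t} r * (f r x + duhamel heat2 f r x) \<partial>lborel)"
proof -
  note W0 = singular_kernel_heat(1)[OF f] and W2 = singular_kernel_heat(3)[OF f H]
  have fc: "continuous_on UNIV (f s)" for s
    by (rule continuous_on_compose2[OF f(1), of UNIV "\<lambda>x. (s, x)", simplified]) (intro continuous_intros)
  have ft: "continuous_on UNIV (\<lambda>s. f s x)"
    by (rule continuous_on_compose2[OF f(1), of UNIV "\<lambda>s. (s, x)", simplified]) (intro continuous_intros)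
  define S where "S = {(s, r). 0 < s \<and> s < r \<and> r < t}"
  define a where "a s r = indicator S (s, r) * heat2 (f s) (r - s) x" for s r
  obtain C where C: "0 \<le> C" "\<And>s h x. s \<le> t \<Longrightarrow> 0 < h \<Longrightarrow> \<bar>heat2 (f s) h x\<bar> \<le> C * (1 + h powr (- 3/4))"
    using singular_kernelD[OF W2] by metis
  have "S = {p. 0 < fst p} \<inter> {p. fst p < snd p} \<inter> {p. snd p < t}" by (auto simp: S_def)
  moreover have "open ({p. 0 < fst p} \<inter> {p. fst p < snd p} \<inter> {p::real \<times> real. snd p < t})"
    by (intro open_Int open_Collect_less continuous_intros)
  ultimately have "S \<in> sets borel" by auto
  moreover have "continuous_on S (\<lambda>p. heat2 (f (fst p)) (snd p - fst p) x)"
    by (intro singular_kernel_continuous_on[OF W2] continuous_intros) (auto simp: S_def)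
  ultimately have "(\<lambda>p. indicator S p *\<^sub>R heat2 (f (fst p)) (snd p - fst p) x) \<in> borel_measurable borel"
    by (rule borel_measurable_continuous_on_indicator)
  then have am: "case_prod a \<in> borel_measurable (lborel \<Otimes>\<^sub>M lborel)"
    by (simp add: a_def case_prod_unfold lborel_prod)
  define w where "w h = indicator {0<..<t} h * (1 + h powr (- 3/4))" for h :: real
  have w: "integrable lborel w" unfolding w_def by (rule integrable_singular_weight)
  have ws: "integrable lborel (\<lambda>r. w (r - s))" for s
    using lborel_integrable_real_affine[OF w, of 1 "- s"] by simp
  have wi: "(\<integral>r. w (r - s) \<partial>lborel) = (\<integral>r. w r \<partial>lborel)" for s
    using lborel_integral_real_affine[of 1 w "- s"] by simp
  have w0: "0 \<le> w h" for h by (simp add: w_def)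
  \<comment> \<open>On the triangle \<open>S\<close> the kernel is singular along the diagonal only.
    The majorant depends on \<open>r\<close> through \<open>r - s\<close>, and its integral over
    \<open>r\<close> is therefore the same for every \<open>s\<close> in \<open>{0<..<t}\<close>;
    this gives the integrability needed for Fubini.\<close>
  have ab: "\<bar>a s r\<bar> \<le> C * (indicator {0<..<t} s * w (r - s))" for s r
    using C(2)[of s "r - s" x] C(1) w0[of "r - s"]
    by (cases "(s, r) \<in> S") (auto simp: a_def w_def S_def indicator_def)
  have as: "integrable lborel (a s)" for s
  proof (rule Bochner_Integration.integrable_bound)
    show "integrable lborel (\<lambda>r. C * (indicator {0<..<t} s * w (r - s)))" using ws by simp
    show "a s \<in> borel_measurable lborel" using measurable_compose[OF measurable_Pair1' am, of s] by simp
  qed (auto intro!: AE_I2 order_trans[OF ab])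
  have ind: "integrable lborel (\<lambda>r. indicator {0<..<t} r * F r)" if "continuous_on UNIV F" for F :: "real \<Rightarrow> real"
  proof -
    have "set_integrable lborel {0..t} F"
      using that by (intro borel_integrable_atLeastAtMost') (auto intro: continuous_on_subset)
    then have "set_integrable lborel {0<..<t} F" by (rule set_integrable_subset) auto
    then show ?thesis by (simp add: set_integrable_def)
  qed
  have int: "integrable (lborel \<Otimes>\<^sub>M lborel) (case_prod a)"
  proof (rule lborel_pair.Fubini_integrable[OF am])
    show "integrable lborel (\<lambda>s. \<integral>r. norm (case (s, r) of (s, r) \<Rightarrow> a s r) \<partial>lborel)"
    proof (rule Bochner_Integration.integrable_bound)
      show "integrable lborel (\<lambda>s. C * (indicator {0<..<t} s * (\<integral>r. w r \<partial>lborel)))"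
        using ind[of "\<lambda>_. \<integral>r. w r \<partial>lborel"] by simp
      show "(\<lambda>s. \<integral>r. norm (case (s, r) of (s, r) \<Rightarrow> a s r) \<partial>lborel) \<in> borel_measurable lborel"
        using am by (intro lborel.borel_measurable_lebesgue_integral) (simp add: case_prod_unfold)
      have "norm (\<integral>r. norm (a s r) \<partial>lborel) \<le> norm (C * (indicator {0<..<t} s * (\<integral>r. w r \<partial>lborel)))" for s
      proof -
        have "(\<integral>r. norm (a s r) \<partial>lborel) \<le> (\<integral>r. C * (indicator {0<..<t} s * w (r - s)) \<partial>lborel)"
          using ab ws as by (intro integral_mono integrable_norm) auto
        also have "\<dots> = C * (indicator {0<..<t} s * (\<integral>r. w r \<partial>lborel))" by (simp add: wi)
        finally show ?thesis by simp
      qed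
      then show "AE s in lborel. norm (\<integral>r. norm (case (s, r) of (s, r) \<Rightarrow> a s r) \<partial>lborel)
          \<le> norm (C * (indicator {0<..<t} s * (\<integral>r. w r \<partial>lborel)))" by simp
    qed
  qed (use as in simp)
  have inner_r: "(\<integral>r. a s r \<partial>lborel) = indicator {0<..<t} s * heat0 (f s) (t - s) x - indicator {0<..<t} s * f s x" for s
  proof (cases "s \<in> {0<..<t}")
    case True
    have a_eq: "a s r = indicator {s<..<t} r * heat2 (f s) (r - s) x" for r
      using True by (auto simp: a_def S_def indicator_def)
    have c0: "isCont (\<lambda>r. heat0 (f s) (r - s) x) r" for r
    proof -
      have "continuous_on UNIV (\<lambda>r. heat0 (f s) (r - s) x)"
        by (rule continuous_on_compose2[OF continuous_heat(1)[OF f], of UNIV "\<lambda>r. (s, r - s, x)", simplified])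
           (intro continuous_intros)
      then show ?thesis by (simp add: continuous_on_eq_continuous_at)
    qed
    \<comment> \<open>The integrand may blow up at \<open>r = s\<close>, but it is integrable and
      \<open>heat0 (f s)\<close> is continuous up to elapsed time \<open>0\<close>, so the
      fundamental theorem holds with the limit \<open>f s x\<close> at that end.\<close>
    have "(LBINT r=ereal s..ereal t. heat2 (f s) (r - s) x) = heat0 (f s) (t - s) x - heat0 (f s) (s - s) x"
    proof (rule interval_integral_FTC_integrable[where F = "\<lambda>r. heat0 (f s) (r - s) x"])
      show "ereal s < ereal t" using True by simp
      fix r assume r: "ereal s < ereal r" "ereal r < ereal t"
      show "((\<lambda>r. heat0 (f s) (r - s) x) has_vector_derivative heat2 (f s) (r - s) x) (at r)"
      proof -
        have "((\<lambda>h. heat0 (f s) h x) has_real_derivative heat2 (f s) (r - s) x) (at (r - s))"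
          using r by (intro heat_derivatives(3)[OF fc f(2)]) auto
        moreover have "((\<lambda>r. r - s) has_real_derivative 1) (at r)" by (auto intro!: derivative_eq_intros)
        ultimately show ?thesis
          unfolding has_real_derivative_iff_has_vector_derivative[symmetric]
          using DERIV_chain2 by fastforce
      qed
      have "continuous_on {s<..} (\<lambda>r. heat2 (f s) (r - s) x)"
        by (intro singular_kernel_continuous_on[OF W2] continuous_intros) auto
      then show "isCont (\<lambda>r. heat2 (f s) (r - s) x) r"
        using r by (simp add: continuous_on_eq_continuous_at)
    next
      show "set_integrable lborel (einterval (ereal s) (ereal t)) (\<lambda>r. heat2 (f s) (r - s) x)"
        using as[of s] by (simp add: set_integrable_def a_eq[abs_def])
      show "(((\<lambda>r. heat0 (f s) (r - s) x) \<circ> real_of_ereal) \<longlongrightarrow> heat0 (f s) (s - s) x) (at_right (ereal s))"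
        using c0[of s] by (simp add: ereal_tendsto_simps isCont_def filterlim_at_split)
      show "(((\<lambda>r. heat0 (f s) (r - s) x) \<circ> real_of_ereal) \<longlongrightarrow> heat0 (f s) (t - s) x) (at_left (ereal t))"
        using c0[of t] by (simp add: ereal_tendsto_simps isCont_def filterlim_at_split)
    qed
    moreover have "heat0 (f s) 0 x = f s x"
      using prob_space.prob_space[OF prob_space_gauss] by (simp add: heat0_def)
    ultimately show ?thesis using True
      by (simp add: a_eq[abs_def] interval_lebesgue_integral_def set_lebesgue_integral_def einterval_eq)
  next
    case False
    then have "a s = (\<lambda>r. 0)" by (auto simp: a_def S_def indicator_def)
    then show ?thesis using False by simp
  qed
  have inner_s: "(\<integral>s. a s r \<partial>lborel) = indicator {0<..<t} r * duhamel heat2 f r x" for r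
  proof (cases "r \<in> {0<..<t}")
    case True
    then have "a s r = indicator {0<..<r} s * heat2 (f s) (r - s) x" for s
      by (auto simp: a_def S_def indicator_def)
    then show ?thesis using True by (simp add: duhamel_reverse)
  next
    case False
    then have "a s r = 0" for s by (auto simp: a_def S_def indicator_def)
    then show ?thesis using False by simp
  qed
  have If: "integrable lborel (\<lambda>s. indicator {0<..<t} s * f s x)" by (rule ind[OF ft])
  have Id: "integrable lborel (\<lambda>r. indicator {0<..<t} r * duhamel heat2 f r x)"
    by (rule ind, rule continuous_on_compose2[OF continuous_duhamel[OF W2], of UNIV "\<lambda>r. (r, x)", simplified])
       (intro continuous_intros)
  have Ih: "integrable lborel (\<lambda>s. indicator {0<..<t} s * heat0 (f s) (t - s) x)"
  proof -
    have "continuous_on UNIV (\<lambda>s. heat0 (f s) (t - s) x)"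
      by (rule continuous_on_compose2[OF continuous_heat(1)[OF f], of UNIV "\<lambda>s. (s, t - s, x)", simplified])
         (intro continuous_intros)
    then show ?thesis by (rule ind)
  qed
  have "(\<integral>r. (\<integral>s. a s r \<partial>lborel) \<partial>lborel) = (\<integral>s. (\<integral>r. a s r \<partial>lborel) \<partial>lborel)"
    by (rule lborel_pair.Fubini_integral[OF int])
  also have "\<dots> = duhamel heat0 f t x - (\<integral>s. indicator {0<..<t} s * f s x \<partial>lborel)"
    unfolding inner_r using Ih If by (simp add: duhamel_reverse)
  finally show ?thesis
    unfolding inner_s using If Id by (simp add: distrib_left)
qed

text \<open>Written as a time integral of a continuous function, the Duhamel term is differentiated
  by the fundamental theorem. This avoids differentiating through the moving endpoint and the
  singularity; the Hoelder bound enters through the continuity of the \<open>heat2\<close>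
  term.\<close>

lemma has_time_derivative_duhamel:
  fixes f :: "real \<Rightarrow> real \<Rightarrow> real"
  assumes f: "continuous_on UNIV (\<lambda>(s, x). f s x)" "\<And>s x. \<bar>f s x\<bar> \<le> M" and H: "spatially_Hoelder f"
    and t: "0 < t"
  shows "((\<lambda>t. duhamel heat0 f t x) has_real_derivative f t x + duhamel heat2 f t x) (at t)"
proof -
  define \<Phi> where "\<Phi> r = f r x + duhamel heat2 f r x" for r
  have "continuous_on UNIV (\<lambda>s. f s x)"
    by (rule continuous_on_compose2[OF f(1), of UNIV "\<lambda>s. (s, x)", simplified]) (intro continuous_intros)
  moreover have "continuous_on UNIV (\<lambda>r. duhamel heat2 f r x)"
    by (rule continuous_on_compose2[OF continuous_duhamel[OF singular_kernel_heat(3)[OF f H]], of UNIV "\<lambda>r. (r, x)", simplified])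
       (intro continuous_intros)
  ultimately have \<Phi>: "continuous_on UNIV \<Phi>" unfolding \<Phi>_def by (intro continuous_intros)
  have "((\<lambda>u. LBINT y=ereal 0..ereal u. \<Phi> y) has_vector_derivative \<Phi> t) (at t within {0..t + 1})"
    using t by (intro interval_integral_FTC2) (auto intro: continuous_on_subset[OF \<Phi>])
  then have "((\<lambda>u. LBINT y=ereal 0..ereal u. \<Phi> y) has_real_derivative \<Phi> t) (at t)"
    using t at_within_interior[of t "{0..t + 1}"] by (simp add: has_real_derivative_iff_has_vector_derivative)
  then have "((\<lambda>t. duhamel heat0 f t x) has_real_derivative \<Phi> t) (at t)"
  proof (rule has_field_derivative_transform_within_open[where S = "{0<..}"])
    fix u :: real assume "u \<in> {0<..}"
    then show "(LBINT y=ereal 0..ereal u. \<Phi> y) = duhamel heat0 f u x"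
      unfolding duhamel_time_integral[OF f H]
      by (simp add: interval_lebesgue_integral_def set_lebesgue_integral_def einterval_eq \<Phi>_def)
  qed (use t in auto)
  then show ?thesis by (simp add: \<Phi>_def)
qed

section \<open>The truncated Cauchy problem\<close>

lemma continuous_truncated_compose:
  assumes "continuous_on UNIV (\<lambda>(t, x). v t x)"
  shows "continuous_on UNIV (\<lambda>(t, x). truncated_nonlinearity (v t x))"
  using continuous_on_compose2[OF continuous_truncated_nonlinearity assms] by (simp add: case_prod_unfold)

lemma continuous_heat0_initial:
  fixes g :: "real \<Rightarrow> real"
  assumes "continuous_on UNIV g" "\<And>x. \<bar>g x\<bar> \<le> M"
  shows "continuous_on UNIV (\<lambda>(t, x). heat0 g t x)"
proof -
  have "continuous_on UNIV (\<lambda>(s::real, x). g x)"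
    unfolding case_prod_unfold by (rule continuous_on_compose2[OF assms(1)]) (auto intro!: continuous_intros)
  from continuous_heat(1)[OF this assms(2)] have c: "continuous_on UNIV (\<lambda>(s::real, h, x). heat0 g h x)" .
  have "continuous_on UNIV (\<lambda>p. case (0::real, fst p, snd p) of (s, h, x) \<Rightarrow> heat0 g h x)"
    by (rule continuous_on_compose2[OF c]) (auto intro!: continuous_intros)
  then show ?thesis by (simp add: case_prod_unfold)
qed

text \<open>At negative times every iterate equals \<open>heat0 g t\<close>, so the iterates are
  continuous on the whole plane and no time domain has to be carried along.\<close>

primrec picard :: "(real \<Rightarrow> real) \<Rightarrow> nat \<Rightarrow> real \<Rightarrow> real \<Rightarrow> real" where
  "picard g 0 = (\<lambda>t x. heat0 g t x)"
| "picard g (Suc n) = (\<lambda>t x. heat0 g t x + duhamel heat0 (\<lambda>s y. truncated_nonlinearity (picard g n s y)) t x)"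

lemma continuous_mild:
  fixes g :: "real \<Rightarrow> real"
  assumes g: "continuous_on UNIV g" "\<And>x. \<bar>g x\<bar> \<le> M" and v: "continuous_on UNIV (\<lambda>(t, x). v t x)"
  shows "continuous_on UNIV (\<lambda>(t, x). heat0 g t x + duhamel heat0 (\<lambda>s y. truncated_nonlinearity (v s y)) t x)"
proof -
  have "continuous_on UNIV (\<lambda>(t, x). duhamel heat0 (\<lambda>s y. truncated_nonlinearity (v s y)) t x)"
    by (intro continuous_duhamel singular_kernel_heat(1)[OF continuous_truncated_compose[OF v] abs_truncated_nonlinearity_le])
  from continuous_on_add[OF continuous_heat0_initial[OF g] this] show ?thesis
    by (simp add: case_prod_unfold)
qed

lemma continuous_picard:
  fixes g :: "real \<Rightarrow> real"
  assumes g: "continuous_on UNIV g" "\<And>x. \<bar>g x\<bar> \<le> M"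
  shows "continuous_on UNIV (\<lambda>(t, x). picard g n t x)"
  by (induction n) (auto intro: continuous_heat0_initial[OF g] continuous_mild[OF g])

text \<open>The function \<open>q\<close> solves \<open>q' = - 2 * (q + 2)\<close>; hence \<open>exp (- q t)\<close> absorbs the non-Lipschitz part
  of the modulus of continuity, and its initial value \<open>exp (- N)\<close> is as small as we like.\<close>

lemma picard_Osgood_estimate:
  fixes g :: "real \<Rightarrow> real" and N T :: real
  defines "q \<equiv> \<lambda>t. (N + 2) * exp (- 2 * t) - 2"
  assumes g: "continuous_on UNIV g" "\<And>x. \<bar>g x\<bar> \<le> M"
    and N: "0 \<le> N" and qT: "0 \<le> q T" and t: "0 \<le> t" "t \<le> T"
  shows "\<bar>picard g (n + j) t x - picard g n t x\<bar> \<le> exp (- q t) + 6 * T * ((2 * (N + 1) * t) ^ n / fact n)"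
  using t
proof (induction n arbitrary: t x)
  case 0
  note cz = continuous_truncated_compose[OF continuous_picard[OF g]]
  have "\<bar>picard g j t x - picard g 0 t x\<bar> \<le> 6 * T"
  proof (cases j)
    case (Suc m)
    have "\<bar>duhamel heat0 (\<lambda>s y. truncated_nonlinearity (picard g m s y)) t x - duhamel heat0 (\<lambda>s y. 0) t x\<bar>
        \<le> 6 * t - 6 * 0"
      by (rule abs_duhamel_diff_le[OF cz[of m] abs_truncated_nonlinearity_le, where b = "\<lambda>_. 6"])
         (use 0 in \<open>auto intro!: derivative_eq_intros simp: abs_truncated_nonlinearity_le\<close>)
    then show ?thesis using Suc 0 by (simp add: duhamel_def heat0_def)
  qed (use 0 in simp)
  then have "\<bar>picard g j t x - picard g 0 t x\<bar> \<le> exp (- q t) + 6 * T"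
    using exp_gt_zero[of "- q t"] by linarith
  then show ?case by simp
next
  case (Suc n)
  define K where "K = 2 * (N + 1)"
  define b where "b s = 2 * (q s + 2) * exp (- q s) + K * (6 * T * ((K * s) ^ n / fact n))" for s
  define B where "B s = exp (- q s) + 6 * T * ((K * s) ^ Suc n / fact (Suc n))" for s
  note cz = continuous_truncated_compose[OF continuous_picard[OF g]]
  have T: "0 \<le> T" using Suc by simp
  have K: "0 \<le> K" using N by (simp add: K_def)
  have q': "(q has_real_derivative - 2 * (q s + 2)) (at s)" for s
    unfolding q_def by (auto intro!: derivative_eq_intros)
  have pow': "((\<lambda>s. (K * s) ^ Suc n / fact (Suc n)) has_real_derivative K * ((K * s) ^ n / fact n)) (at s)" for s
  proof -
    have "((\<lambda>s. K * s) has_real_derivative K) (at s)" by (auto intro!: derivative_eq_intros)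
    from DERIV_cdivide[OF DERIV_power[OF this, of "Suc n"], of "fact (Suc n)"]
    show ?thesis by (rule DERIV_cong) (simp add: fact_Suc del: of_nat_Suc)
  qed
  have "\<bar>duhamel heat0 (\<lambda>s y. truncated_nonlinearity (picard g (n + j) s y)) t x
      - duhamel heat0 (\<lambda>s y. truncated_nonlinearity (picard g n s y)) t x\<bar> \<le> B t - B 0"
  proof (rule abs_duhamel_diff_le[OF cz abs_truncated_nonlinearity_le cz abs_truncated_nonlinearity_le])
    fix s y assume s: "0 \<le> s" "s \<le> t"
    have "exp (- 2 * T) \<le> exp (- 2 * s)" using s Suc by simp
    then have "(N + 2) * exp (- 2 * T) \<le> (N + 2) * exp (- 2 * s)" using N by (intro mult_left_mono) auto
    then have q0: "0 \<le> q s" using qT by (simp add: q_def)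
    have "exp (- 2 * s) \<le> 1" using s by simp
    then have "(N + 2) * exp (- 2 * s) \<le> (N + 2) * 1" using N by (intro mult_left_mono) auto
    then have qN: "q s \<le> N" by (simp add: q_def)
    define P where "P = 6 * T * ((K * s) ^ n / fact n)"
    have P: "0 \<le> P" using T K s by (simp add: P_def)
    have "\<bar>truncated_nonlinearity (picard g (n + j) s y) - truncated_nonlinearity (picard g n s y)\<bar>
        \<le> 2 * (q s + 1) * \<bar>picard g (n + j) s y - picard g n s y\<bar> + 2 * exp (- q s)"
      by (rule truncated_nonlinearity_log_Lipschitz[OF q0])
    also have "\<dots> \<le> 2 * (q s + 1) * (exp (- q s) + P) + 2 * exp (- q s)"
      using Suc.IH[of s y] s Suc.prems q0 by (intro add_right_mono mult_left_mono) (auto simp: P_def K_def)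
    \<comment> \<open>The additive error of the modulus raises \<open>q + 1\<close> to
      \<open>q + 2\<close>, and \<open>2 * (q s + 2) * exp (- q s)\<close> is exactly the derivative
      of \<open>exp (- q s)\<close>. The rest is the usual Picard estimate with slope
      \<open>K\<close>.\<close>
    also have "\<dots> = 2 * (q s + 2) * exp (- q s) + 2 * (q s + 1) * P" by (simp add: algebra_simps)
    also have "2 * (q s + 1) * P \<le> K * P" using qN P by (intro mult_right_mono) (auto simp: K_def)
    finally show "\<bar>truncated_nonlinearity (picard g (n + j) s y) - truncated_nonlinearity (picard g n s y)\<bar> \<le> b s"
      by (simp add: b_def P_def)
  next
    show "(B has_real_derivative b s) (at s)" for s
    proof -
      have "((\<lambda>s. exp (- q s)) has_real_derivative exp (- q s) * - (- 2 * (q s + 2))) (at s)"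
        by (intro DERIV_fun_exp DERIV_minus q')
      from DERIV_add[OF this DERIV_cmult[OF pow', of "6 * T"]]
      show ?thesis unfolding B_def b_def by (rule DERIV_cong) (simp add: algebra_simps)
    qed
    show "continuous_on UNIV b" unfolding b_def q_def by (intro continuous_intros) auto
  qed (use Suc in simp)
  moreover have "B 0 \<ge> 0" by (simp add: B_def)
  ultimately have "\<bar>duhamel heat0 (\<lambda>s y. truncated_nonlinearity (picard g (n + j) s y)) t x
      - duhamel heat0 (\<lambda>s y. truncated_nonlinearity (picard g n s y)) t x\<bar> \<le> B t" by linarith
  then show ?case by (simp add: B_def K_def)
qed

lemma picard_uniformly_Cauchy:
  fixes g :: "real \<Rightarrow> real"
  assumes g: "continuous_on UNIV g" "\<And>x. \<bar>g x\<bar> \<le> M" and e: "0 < e"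
  obtains n0 where "\<And>n j t x. n0 \<le> n \<Longrightarrow> t \<le> T \<Longrightarrow> \<bar>picard g (n + j) t x - picard g n t x\<bar> \<le> e"
proof -
  define S where "S = max T 1"
  define R where "R = max 0 (- ln (e / 2))"
  \<comment> \<open>\<open>N\<close> is chosen so that \<open>q\<close>, which decreases from
    \<open>N\<close>, still equals \<open>R\<close> at time \<open>S\<close>; hence
    \<open>exp (- q t) \<le> exp (- R) \<le> e / 2\<close> on all of \<open>[0, S]\<close>. Only
    then is \<open>n\<close> taken large for the factorial term.\<close>
  define N where "N = (R + 2) * exp (2 * S) - 2"
  define K where "K = 2 * (N + 1)"
  have R: "0 \<le> R" "exp (- R) \<le> e / 2"
  proof -
    show "0 \<le> R" by (simp add: R_def)
    have "exp (- R) \<le> exp (ln (e / 2))" by (simp add: R_def)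
    then show "exp (- R) \<le> e / 2" using e by simp
  qed
  have S: "1 \<le> S" "T \<le> S" by (auto simp: S_def)
  have "1 \<le> exp (2 * S)" using S by simp
  then have "(R + 2) * 1 \<le> (R + 2) * exp (2 * S)" using R by (intro mult_left_mono) auto
  then have "2 \<le> (R + 2) * exp (2 * S)" by (rule order_trans[rotated]) (use R in simp)
  then have N: "0 \<le> N" by (simp add: N_def)
  have qS: "(N + 2) * exp (- 2 * S) - 2 = R" by (simp add: N_def exp_minus field_simps)
  have "(\<lambda>n. 6 * S * ((K * S) ^ n / fact n)) \<longlonglongrightarrow> 6 * S * 0"
    using summable_LIMSEQ_zero[OF summable_exp[of "K * S"]]
    by (intro tendsto_mult tendsto_const) (simp add: field_simps)
  then have "\<forall>\<^sub>F n in sequentially. 6 * S * ((K * S) ^ n / fact n) < e / 2"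
    using e by (intro order_tendstoD) auto
  then obtain n0 where n0: "\<And>n. n \<ge> n0 \<Longrightarrow> 6 * S * ((K * S) ^ n / fact n) < e / 2"
    by (auto simp: eventually_sequentially)
  show thesis
  proof (rule that[of n0])
    fix n j t x assume n: "n0 \<le> n" and tT: "t \<le> T"
    show "\<bar>picard g (n + j) t x - picard g n t x\<bar> \<le> e"
    proof (cases "0 \<le> t")
      case True
      then have t: "0 \<le> t" "t \<le> S" using tT S by auto
      have "\<bar>picard g (n + j) t x - picard g n t x\<bar> \<le>
          exp (- ((N + 2) * exp (- 2 * t) - 2)) + 6 * S * ((2 * (N + 1) * t) ^ n / fact n)"
        by (rule picard_Osgood_estimate[OF g N _ t]) (use qS R in auto)
      also have "exp (- ((N + 2) * exp (- 2 * t) - 2)) \<le> exp (- R)"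
        using N t unfolding qS[symmetric] by (simp add: mult_left_mono)
      also have "6 * S * ((2 * (N + 1) * t) ^ n / fact n) \<le> 6 * S * ((K * S) ^ n / fact n)"
        using N t S unfolding K_def by (intro mult_left_mono divide_right_mono power_mono) auto
      finally show ?thesis using R n0[OF n] by simp
    next
      case False
      have "picard g n t x = heat0 g t x" for n using False by (cases n) (auto simp: duhamel_nonpos)
      then show ?thesis using e by simp
    qed
  qed
qed

text \<open>The symmetry comes from the construction: each iterate is odd about every centre about
  which \<open>g\<close> is odd, and oddness survives the pointwise limit.\<close>

lemma mild_solution_exists:
  fixes g :: "real \<Rightarrow> real"
  assumes g: "continuous_on UNIV g" "\<And>x. \<bar>g x\<bar> \<le> M"
  obtains u where "continuous_on UNIV (\<lambda>(t, x). u t x)"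
    and "\<And>t x. u t x = heat0 g t x + duhamel heat0 (\<lambda>s y. truncated_nonlinearity (u s y)) t x"
    and "\<And>c t x. (\<And>x. g (2 * c - x) = - g x) \<Longrightarrow> u t (2 * c - x) = - u t x"
proof -
  define u where "u t x = lim (\<lambda>n. picard g n t x)" for t x
  have conv: "(\<lambda>n. picard g n t x) \<longlonglongrightarrow> u t x" for t x
  proof -
    have "Cauchy (\<lambda>n. picard g n t x)"
    proof (rule CauchyI')
      fix e :: real assume "0 < e"
      then obtain n0 where n0: "\<And>n j s x. n0 \<le> n \<Longrightarrow> s \<le> t \<Longrightarrow> \<bar>picard g (n + j) s x - picard g n s x\<bar> \<le> e / 2"
        using picard_uniformly_Cauchy[OF g, of "e / 2" t] by (metis half_gt_zero)
      have "dist (picard g m t x) (picard g n t x) < e" if "n0 \<le> m" "m < n" for m n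
        using n0[of m t "n - m" x] that \<open>0 < e\<close> by (simp add: dist_real_def abs_minus_commute)
      then show "\<exists>M. \<forall>m\<ge>M. \<forall>n>m. dist (picard g m t x) (picard g n t x) < e" by blast
    qed
    then show ?thesis by (simp add: u_def Cauchy_convergent_iff convergent_LIMSEQ_iff)
  qed
  have unif: "\<exists>n0. \<forall>n\<ge>n0. \<forall>t\<le>T. \<forall>x. \<bar>picard g n t x - u t x\<bar> \<le> e" if "0 < e" for T e
  proof -
    obtain n0 where n0: "\<And>n j t x. n0 \<le> n \<Longrightarrow> t \<le> T \<Longrightarrow> \<bar>picard g (n + j) t x - picard g n t x\<bar> \<le> e"
      using picard_uniformly_Cauchy[OF g \<open>0 < e\<close>, of T] by metis
    have "\<bar>picard g n t x - u t x\<bar> \<le> e" if "n0 \<le> n" "t \<le> T" for n t x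
    proof -
      have "(\<lambda>j. picard g (j + n) t x) \<longlonglongrightarrow> u t x" by (rule LIMSEQ_ignore_initial_segment[OF conv])
      then have "(\<lambda>j. \<bar>picard g (j + n) t x - picard g n t x\<bar>) \<longlonglongrightarrow> \<bar>u t x - picard g n t x\<bar>"
        by (intro tendsto_intros)
      then have "\<bar>u t x - picard g n t x\<bar> \<le> e"
        by (rule LIMSEQ_le_const2) (use n0[OF that] in \<open>auto simp: add.commute\<close>)
      then show ?thesis by (simp add: abs_minus_commute)
    qed
    then show ?thesis by blast
  qed
  have cont: "continuous_on UNIV (\<lambda>(t, x). u t x)"
    unfolding continuous_on_eq_continuous_at[OF open_UNIV]
  proof
    fix p :: "real \<times> real"
    define T where "T = fst p + 1"
    have "continuous_on ({..<T} \<times> UNIV) (\<lambda>(t, x). u t x)"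
    proof (rule uniform_limit_theorem[of _ "\<lambda>n (t, x). picard g n t x" sequentially])
      show "\<forall>\<^sub>F n in sequentially. continuous_on ({..<T} \<times> UNIV) (\<lambda>(t, x). picard g n t x)"
        using continuous_on_subset[OF continuous_picard[OF g]] by (intro always_eventually) auto
      show "uniform_limit ({..<T} \<times> UNIV) (\<lambda>n (t, x). picard g n t x) (\<lambda>(t, x). u t x) sequentially"
      proof (rule uniform_limitI)
        fix e :: real assume "0 < e"
        then obtain n0 where n0: "\<forall>n\<ge>n0. \<forall>t\<le>T. \<forall>x. \<bar>picard g n t x - u t x\<bar> \<le> e / 2" using unif[of "e / 2" T] by auto
        have "dist (case p of (t, x) \<Rightarrow> picard g n t x) (case p of (t, x) \<Rightarrow> u t x) < e"
          if "n \<ge> n0" "p \<in> {..<T} \<times> UNIV" for n p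
        proof -
          obtain s x where p: "p = (s, x)" by (cases p)
          then have "\<bar>picard g n s x - u s x\<bar> \<le> e / 2" using n0 that by simp
          then show ?thesis using \<open>0 < e\<close> by (simp add: p dist_real_def)
        qed
        then show "\<forall>\<^sub>F n in sequentially. \<forall>p\<in>{..<T} \<times> UNIV. dist (case p of (t, x) \<Rightarrow> picard g n t x) (case p of (t, x) \<Rightarrow> u t x) < e"
          unfolding eventually_sequentially by blast
      qed
    qed simp
    moreover have "open ({..<T} \<times> (UNIV :: real set))" by (intro open_Times) auto
    moreover have "p \<in> {..<T} \<times> UNIV" by (cases p) (auto simp: T_def)
    ultimately show "isCont (\<lambda>(t, x). u t x) p" using continuous_on_eq_continuous_at by blast
  qed
  have fixed: "u t x = heat0 g t x + duhamel heat0 (\<lambda>s y. truncated_nonlinearity (u s y)) t x" for t x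
  proof (cases "0 \<le> t")
    case True
    let ?D = "\<lambda>v. duhamel heat0 (\<lambda>s y. truncated_nonlinearity (v s y)) t x"
    have "(\<lambda>n. ?D (picard g n)) \<longlonglongrightarrow> ?D u"
    proof (rule LIMSEQ_I)
      fix r :: real assume r: "0 < r"
      \<comment> \<open>The Hoelder modulus suffices to pass to the limit in the Duhamel term; this
        \<open>e\<close> makes \<open>6 * sqrt e * t\<close> at most \<open>r / 2\<close>, and
        \<open>t + 1\<close> avoids a division by zero.\<close>
      define e where "e = (r / (12 * (t + 1)))\<^sup>2"
      have e: "0 < e" "sqrt e = r / (12 * (t + 1))" using r True by (auto simp: e_def)
      then obtain n0 where n0: "\<forall>n\<ge>n0. \<forall>s\<le>t. \<forall>x. \<bar>picard g n s x - u s x\<bar> \<le> e" using unif by meson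
      have "norm (?D (picard g n) - ?D u) < r" if "n \<ge> n0" for n
      proof -
        have "\<bar>?D (picard g n) - ?D u\<bar> \<le> 6 * sqrt e * t - 6 * sqrt e * 0"
        proof (rule abs_duhamel_diff_le[OF continuous_truncated_compose[OF continuous_picard[OF g]] abs_truncated_nonlinearity_le
              continuous_truncated_compose[OF cont] abs_truncated_nonlinearity_le, where b = "\<lambda>_. 6 * sqrt e"])
          fix s y assume "s \<le> t"
          then have "sqrt \<bar>picard g n s y - u s y\<bar> \<le> sqrt e" using n0 that by simp
          then show "\<bar>truncated_nonlinearity (picard g n s y) - truncated_nonlinearity (u s y)\<bar> \<le> 6 * sqrt e"
            using truncated_nonlinearity_Hoelder[of "picard g n s y" "u s y"] by linarith
        qed (use True in \<open>auto intro!: derivative_eq_intros\<close>)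
        also have "\<dots> = (r / 2) * (t / (t + 1))" using e(2) True by (simp add: field_simps)
        also have "\<dots> \<le> (r / 2) * 1" using r True by (intro mult_left_mono) auto
        finally show ?thesis using r by simp
      qed
      then show "\<exists>no. \<forall>n\<ge>no. norm (?D (picard g n) - ?D u) < r" by blast
    qed
    then have "(\<lambda>n. picard g (Suc n) t x) \<longlonglongrightarrow> heat0 g t x + ?D u" by (auto intro!: tendsto_intros)
    with LIMSEQ_Suc[OF conv[of t x]] show ?thesis by (rule LIMSEQ_unique)
  next
    case False
    then have "picard g n t x = heat0 g t x" for n by (cases n) (auto simp: duhamel_nonpos)
    then have "u t x = heat0 g t x" using conv[of t x] by (simp add: LIMSEQ_const_iff)
    then show ?thesis using False by (simp add: duhamel_nonpos)
  qed
  have odd: "u t (2 * c - x) = - u t x" if c: "\<And>x. g (2 * c - x) = - g x" for c t x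
  proof -
    have "picard g n t (2 * c - x) = - picard g n t x" for n t x
    proof (induction n arbitrary: t x)
      case 0 then show ?case by (simp add: heat0_reflect[OF g(1) c])
    next
      case (Suc n)
      have "continuous_on UNIV (\<lambda>y. truncated_nonlinearity (picard g n s y))" for s
        by (rule continuous_on_compose2[OF continuous_truncated_compose[OF continuous_picard[OF g]], of UNIV "\<lambda>y. (s, y)", simplified])
           (intro continuous_intros)
      from duhamel_reflect[OF this] Suc show ?case by (simp add: heat0_reflect[OF g(1) c])
    qed
    then have "(\<lambda>n. - picard g n t x) \<longlonglongrightarrow> u t (2 * c - x)" using conv[of t "2 * c - x"] by simp
    with tendsto_minus[OF conv[of t x]] show ?thesis using LIMSEQ_unique by blast
  qed
  show thesis by (rule that[OF cont fixed odd])
qed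

text \<open>A bootstrap: the integrable singularity of \<open>heat1\<close> makes the Duhamel term
  Lipschitz in space, so the square-root modulus makes \<open>f\<close> spatially Hoelder, and then
  the singularity of \<open>heat2\<close> is integrable as well. The Lipschitz bound on
  \<open>g\<close> keeps the constants uniform down to time \<open>0\<close>, where
  \<open>heat1 g\<close> may be unbounded.\<close>

lemma mild_solution_regular:
  fixes g :: "real \<Rightarrow> real" and u :: "real \<Rightarrow> real \<Rightarrow> real"
  assumes g: "continuous_on UNIV g" "\<And>x. \<bar>g x\<bar> \<le> M" and L: "\<And>x y. \<bar>g x - g y\<bar> \<le> L * \<bar>x - y\<bar>"
    and u: "continuous_on UNIV (\<lambda>(t, x). u t x)"
    and mild: "\<And>t x. u t x = heat0 g t x + duhamel heat0 (\<lambda>s y. truncated_nonlinearity (u s y)) t x"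
  obtains ut ux uxx where
    "continuous_on ({0<..} \<times> UNIV) (\<lambda>(t, x). ut t x)"
    "continuous_on ({0<..} \<times> UNIV) (\<lambda>(t, x). ux t x)"
    "continuous_on ({0<..} \<times> UNIV) (\<lambda>(t, x). uxx t x)"
    "\<And>t x. 0 < t \<Longrightarrow> ((\<lambda>s. u s x) has_real_derivative ut t x) (at t)"
    "\<And>t x. 0 < t \<Longrightarrow> ((\<lambda>y. u t y) has_real_derivative ux t x) (at x)"
    "\<And>t x. 0 < t \<Longrightarrow> ((\<lambda>y. ux t y) has_real_derivative uxx t x) (at x)"
    "\<And>t x. 0 < t \<Longrightarrow> ut t x = uxx t x + truncated_nonlinearity (u t x)"
proof -
  define f where "f s y = truncated_nonlinearity (u s y)" for s y
  have f: "continuous_on UNIV (\<lambda>(s, y). f s y)" "\<And>s y. \<bar>f s y\<bar> \<le> 6"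
    unfolding f_def by (intro continuous_truncated_compose[OF u] abs_truncated_nonlinearity_le)+
  have fc: "continuous_on UNIV (f s)" for s
    by (rule continuous_on_compose2[OF f(1), of UNIV "\<lambda>x. (s, x)", simplified]) (intro continuous_intros)
  have mild': "u t x = heat0 g t x + duhamel heat0 f t x" for t x
    using mild[of t x] by (simp add: f_def[abs_def])
  note W0 = singular_kernel_heat(1)[OF f] and W1 = singular_kernel_heat(2)[OF f]
  have D1: "(duhamel heat0 f t has_real_derivative duhamel heat1 f t x) (at x)" for t x
    by (rule has_derivative_duhamel[where W = heat0 and W' = heat1 and f = f, OF W0 W1])
       (rule heat_derivatives(1)[OF fc f(2)])
  have H: "spatially_Hoelder f"
    unfolding spatially_Hoelder_def
  proof
    fix T
    obtain B where B: "\<And>t x. t \<le> T \<Longrightarrow> \<bar>duhamel heat1 f t x\<bar> \<le> B" using duhamel_bounded[OF W1] by metis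
    have LB: "0 \<le> L + B" using L[of 1 0] B[of T 0] by simp
    have "\<bar>f s x - f s y\<bar> \<le> (6 * sqrt (L + B)) * sqrt \<bar>x - y\<bar>" if "s \<le> T" for s x y
    proof -
      have "norm (duhamel heat0 f s x - duhamel heat0 f s y) \<le> B * norm (x - y)"
        by (rule field_differentiable_bound[of UNIV _ "duhamel heat1 f s"]) (use D1 B[OF that] in auto)
      then have "\<bar>u s x - u s y\<bar> \<le> (L + B) * \<bar>x - y\<bar>"
        using heat0_Lipschitz[OF g L, of s x y] by (simp add: mild' algebra_simps)
      then have "sqrt \<bar>u s x - u s y\<bar> \<le> sqrt (L + B) * sqrt \<bar>x - y\<bar>"
        by (simp flip: real_sqrt_mult)
      then show ?thesis using truncated_nonlinearity_Hoelder[of "u s x" "u s y"] by (simp add: f_def)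
    qed
    then show "\<exists>c. \<forall>s\<le>T. \<forall>x y. \<bar>f s x - f s y\<bar> \<le> c * sqrt \<bar>x - y\<bar>" by blast
  qed
  note W2 = singular_kernel_heat(3)[OF f H]
  have D2: "(duhamel heat1 f t has_real_derivative duhamel heat2 f t x) (at x)" for t x
    by (rule has_derivative_duhamel[where W = heat1 and W' = heat2 and f = f, OF W1 W2])
       (rule heat_derivatives(2)[OF fc f(2)])
  define ux where "ux t x = heat1 g t x + duhamel heat1 f t x" for t x
  define uxx where "uxx t x = heat2 g t x + duhamel heat2 f t x" for t x
  define ut where "ut t x = uxx t x + f t x" for t x
  have gg: "continuous_on UNIV (\<lambda>(s::real, x). g x)"
    unfolding case_prod_unfold by (rule continuous_on_compose2[OF g(1)]) (auto intro!: continuous_intros)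
  have c1: "continuous_on ({0<..} \<times> UNIV) (\<lambda>p. heat1 g (fst p) (snd p))"
  proof -
    have "continuous_on ({0<..} \<times> UNIV) (\<lambda>p. case (0::real, fst p, snd p) of (s, h, x) \<Rightarrow> heat1 g h x)"
      by (rule continuous_on_compose2[OF continuous_heat(2)[OF gg g(2)]]) (auto intro!: continuous_intros)
    then show ?thesis by (simp add: case_prod_unfold)
  qed
  have c2: "continuous_on ({0<..} \<times> UNIV) (\<lambda>p. heat2 g (fst p) (snd p))"
  proof -
    have "continuous_on ({0<..} \<times> UNIV) (\<lambda>p. case (0::real, fst p, snd p) of (s, h, x) \<Rightarrow> heat2 g h x)"
      by (rule continuous_on_compose2[OF continuous_heat(3)[OF gg g(2)]]) (auto intro!: continuous_intros)
    then show ?thesis by (simp add: case_prod_unfold)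
  qed
  have cux: "continuous_on ({0<..} \<times> UNIV) (\<lambda>(t, x). ux t x)"
    using continuous_on_add[OF c1 continuous_on_subset[OF continuous_duhamel[OF W1] subset_UNIV]]
    by (simp add: ux_def case_prod_unfold)
  have cuxx: "continuous_on ({0<..} \<times> UNIV) (\<lambda>(t, x). uxx t x)"
    using continuous_on_add[OF c2 continuous_on_subset[OF continuous_duhamel[OF W2] subset_UNIV]]
    by (simp add: uxx_def case_prod_unfold)
  have cut: "continuous_on ({0<..} \<times> UNIV) (\<lambda>(t, x). ut t x)"
    using continuous_on_add[OF cuxx continuous_on_subset[OF f(1) subset_UNIV]]
    by (simp add: ut_def case_prod_unfold)
  have u_eq: "u t = (\<lambda>x. heat0 g t x + duhamel heat0 f t x)" for t by (simp add: mild' fun_eq_iff)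
  show thesis
  proof (rule that[OF cut cux cuxx])
    fix t x :: real assume t: "0 < t"
    show "((\<lambda>s. u s x) has_real_derivative ut t x) (at t)"
      unfolding mild' ut_def uxx_def
      by (rule DERIV_cong[OF DERIV_add[OF heat_derivatives(3)[OF g t] has_time_derivative_duhamel[OF f H t]]]) simp
    show "((\<lambda>y. u t y) has_real_derivative ux t x) (at x)"
      unfolding u_eq ux_def by (rule DERIV_add[OF heat_derivatives(1)[OF g t] D1])
    show "((\<lambda>y. ux t y) has_real_derivative uxx t x) (at x)"
      unfolding ux_def uxx_def by (rule DERIV_add[OF heat_derivatives(2)[OF g t] D2])
    show "ut t x = uxx t x + truncated_nonlinearity (u t x)" by (simp add: ut_def f_def)
  qed
qed

section \<open>Scaling, uniqueness and the initial datum\<close>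

lemma log_heat_solutionE:
  assumes sol: "log_heat_solution \<alpha> \<beta> u0 u" and T: "T > 0"
  obtains ut ux uxx where "continuous_on ({0..T} \<times> {\<alpha>..\<beta>}) (\<lambda>(t, x). u t x)"
    "continuous_on ({0<..T} \<times> {\<alpha><..<\<beta>}) (\<lambda>(t, x). ut t x)"
    "continuous_on ({0<..T} \<times> {\<alpha><..<\<beta>}) (\<lambda>(t, x). ux t x)"
    "continuous_on ({0<..T} \<times> {\<alpha><..<\<beta>}) (\<lambda>(t, x). uxx t x)"
    "\<And>t x. t \<in> {0<..T} \<Longrightarrow> x \<in> {\<alpha><..<\<beta>} \<Longrightarrow>
        ((\<lambda>s. u s x) has_real_derivative ut t x) (at t) \<and>
        ((\<lambda>y. u t y) has_real_derivative ux t x) (at x) \<and>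
        ((\<lambda>y. ux t y) has_real_derivative uxx t x) (at x) \<and>
        ut t x = uxx t x + log_nonlinearity (u t x)"
  using mp[OF spec[OF conjunct1[OF sol[unfolded log_heat_solution_def]], of T] T]
  by (elim conjE exE) (rule that; (assumption | (drule (1) bspec, drule (1) bspec, assumption)))

text \<open>With \<open>r = c * exp (2 * t)\<close> the factor \<open>exp r\<close> has time
  derivative \<open>2 * r * exp r\<close>, which matches the linear term that the scaling adds to
  the nonlinearity. The time-dependent factor leaves the space derivatives and the boundary
  condition intact.\<close>

lemma log_heat_solution_scale:
  assumes "log_heat_solution \<alpha> \<beta> u0 u"
  shows "log_heat_solution \<alpha> \<beta> (\<lambda>x. exp c * u0 x) (\<lambda>t x. exp (c * exp (2 * t)) * u t x)"
  unfolding log_heat_solution_def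
proof (intro conjI allI impI)
  fix T :: real assume T: "T > 0"
  define e where "e t = exp (c * exp (2 * t))" for t :: real
  have ec: "continuous_on S e" for S unfolding e_def by (intro continuous_intros)
  have e': "(e has_real_derivative 2 * (c * exp (2 * t)) * e t) (at t)" for t
    unfolding e_def by (auto intro!: derivative_eq_intros)
  have ec2: "continuous_on S (\<lambda>p. e (fst p))" for S :: "(real \<times> real) set"
    by (rule continuous_on_compose2[OF ec[of UNIV]]) (auto intro!: continuous_intros)
  obtain ut ux uxx where u: "continuous_on ({0..T} \<times> {\<alpha>..\<beta>}) (\<lambda>(t, x). u t x)"
    and c: "continuous_on ({0<..T} \<times> {\<alpha><..<\<beta>}) (\<lambda>(t, x). ut t x)"
      "continuous_on ({0<..T} \<times> {\<alpha><..<\<beta>}) (\<lambda>(t, x). ux t x)"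
      "continuous_on ({0<..T} \<times> {\<alpha><..<\<beta>}) (\<lambda>(t, x). uxx t x)"
    and der: "\<And>t x. t \<in> {0<..T} \<Longrightarrow> x \<in> {\<alpha><..<\<beta>} \<Longrightarrow>
        ((\<lambda>s. u s x) has_real_derivative ut t x) (at t) \<and>
        ((\<lambda>y. u t y) has_real_derivative ux t x) (at x) \<and>
        ((\<lambda>y. ux t y) has_real_derivative uxx t x) (at x) \<and>
        ut t x = uxx t x + log_nonlinearity (u t x)"
    using log_heat_solutionE[OF assms T] by blast
  have scale: "continuous_on S (\<lambda>(t, x). e t * v t x)" if "continuous_on S (\<lambda>(t, x). v t x)" for S and v :: "real \<Rightarrow> real \<Rightarrow> real"
    using continuous_on_mult[OF ec2 that] by (simp add: case_prod_unfold)
  show "continuous_on ({0..T} \<times> {\<alpha>..\<beta>}) (\<lambda>(t, x). exp (c * exp (2 * t)) * u t x)"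
    using scale[OF u] by (simp add: e_def)
  define vt where "vt t x = 2 * (c * exp (2 * t)) * e t * u t x + e t * ut t x" for t x
  have "continuous_on ({0<..T} \<times> {\<alpha><..<\<beta>}) (\<lambda>p. (2 * (c * exp (2 * fst p)) * e (fst p)) * (case p of (t, x) \<Rightarrow> u t x)
      + e (fst p) * (case p of (t, x) \<Rightarrow> ut t x))"
    by (intro continuous_intros c ec2 continuous_on_subset[OF u]) auto
  then have cvt: "continuous_on ({0<..T} \<times> {\<alpha><..<\<beta>}) (\<lambda>(t, x). vt t x)"
    by (simp add: vt_def case_prod_unfold)
  show "\<exists>ut ux uxx.
      continuous_on ({0<..T} \<times> {\<alpha><..<\<beta>}) (\<lambda>(t, x). ut t x) \<and>
      continuous_on ({0<..T} \<times> {\<alpha><..<\<beta>}) (\<lambda>(t, x). ux t x) \<and>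
      continuous_on ({0<..T} \<times> {\<alpha><..<\<beta>}) (\<lambda>(t, x). uxx t x) \<and>
      (\<forall>t\<in>{0<..T}. \<forall>x\<in>{\<alpha><..<\<beta>}.
         ((\<lambda>s. exp (c * exp (2 * s)) * u s x) has_real_derivative ut t x) (at t) \<and>
         ((\<lambda>y. exp (c * exp (2 * t)) * u t y) has_real_derivative ux t x) (at x) \<and>
         ((\<lambda>y. ux t y) has_real_derivative uxx t x) (at x) \<and>
         ut t x = uxx t x + log_nonlinearity (exp (c * exp (2 * t)) * u t x))"
  proof (rule exI[of _ vt], rule exI[of _ "\<lambda>t x. e t * ux t x"], rule exI[of _ "\<lambda>t x. e t * uxx t x"],
      intro conjI ballI cvt scale c)
    fix t x assume tx: "t \<in> {0<..T}" "x \<in> {\<alpha><..<\<beta>}"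
    note d = der[OF tx]
    from DERIV_mult'[OF e'[of t] conjunct1[OF d]]
    show "((\<lambda>s. exp (c * exp (2 * s)) * u s x) has_real_derivative vt t x) (at t)"
      by (simp add: e_def vt_def algebra_simps)
    show "((\<lambda>y. exp (c * exp (2 * t)) * u t y) has_real_derivative e t * ux t x) (at x)"
      unfolding e_def using d by (intro DERIV_cmult) auto
    show "((\<lambda>y. e t * ux t y) has_real_derivative e t * uxx t x) (at x)"
      using d by (intro DERIV_cmult) auto
    show "vt t x = e t * uxx t x + log_nonlinearity (exp (c * exp (2 * t)) * u t x)"
      unfolding log_nonlinearity_mult_exp using d by (simp add: vt_def e_def algebra_simps)
  qed
next
  fix t :: real assume "t > 0"
  then show "exp (c * exp (2 * t)) * u t \<alpha> = 0" "exp (c * exp (2 * t)) * u t \<beta> = 0"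
    using assms by (auto simp: log_heat_solution_def)
next
  show "\<forall>x\<in>{\<alpha>..\<beta>}. exp (c * exp (2 * 0)) * u 0 x = (if x \<in> {\<alpha><..<\<beta>} then exp c * u0 x else 0)"
    using assms by (simp add: log_heat_solution_def)
qed

text \<open>Where the difference is positive it satisfies a linear inequality, by the Lipschitz
  bound from above on the common range of \<open>u\<close> and \<open>v\<close>. Exchanging the two
  solutions gives uniqueness.\<close>

lemma log_heat_solution_le:
  assumes u: "log_heat_solution \<alpha> \<beta> u0 u" and v: "log_heat_solution \<alpha> \<beta> u0 v"
    and t: "0 \<le> t" and x: "\<alpha> \<le> x" "x \<le> \<beta>"
  shows "u t x \<le> v t x"
proof -
  \<comment> \<open>The extra \<open>1\<close> makes \<open>T\<close> positive also for
    \<open>t = 0\<close>.\<close>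
  define T where "T = t + 1"
  have T: "T > 0" "t \<le> T" using t by (auto simp: T_def)
  obtain ut ux uxx where uc: "continuous_on ({0..T} \<times> {\<alpha>..\<beta>}) (\<lambda>(t, x). u t x)"
    and du: "\<And>t x. t \<in> {0<..T} \<Longrightarrow> x \<in> {\<alpha><..<\<beta>} \<Longrightarrow>
        ((\<lambda>s. u s x) has_real_derivative ut t x) (at t) \<and>
        ((\<lambda>y. u t y) has_real_derivative ux t x) (at x) \<and>
        ((\<lambda>y. ux t y) has_real_derivative uxx t x) (at x) \<and>
        ut t x = uxx t x + log_nonlinearity (u t x)"
    using log_heat_solutionE[OF u T(1)] by metis
  obtain vt vx vxx where vc: "continuous_on ({0..T} \<times> {\<alpha>..\<beta>}) (\<lambda>(t, x). v t x)"
    and dv: "\<And>t x. t \<in> {0<..T} \<Longrightarrow> x \<in> {\<alpha><..<\<beta>} \<Longrightarrow>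
        ((\<lambda>s. v s x) has_real_derivative vt t x) (at t) \<and>
        ((\<lambda>y. v t y) has_real_derivative vx t x) (at x) \<and>
        ((\<lambda>y. vx t y) has_real_derivative vxx t x) (at x) \<and>
        vt t x = vxx t x + log_nonlinearity (v t x)"
    using log_heat_solutionE[OF v T(1)] by metis
  have cpt: "compact ({0..T} \<times> {\<alpha>..\<beta>})" by (intro compact_Times) auto
  obtain M1 where M1: "\<And>s y. 0 \<le> s \<Longrightarrow> s \<le> T \<Longrightarrow> \<alpha> \<le> y \<Longrightarrow> y \<le> \<beta> \<Longrightarrow> \<bar>u s y\<bar> \<le> M1"
    using compact_imp_bounded[OF compact_continuous_image[OF uc cpt]]
    unfolding bounded_iff by fastforce
  obtain M2 where M2: "\<And>s y. 0 \<le> s \<Longrightarrow> s \<le> T \<Longrightarrow> \<alpha> \<le> y \<Longrightarrow> y \<le> \<beta> \<Longrightarrow> \<bar>v s y\<bar> \<le> M2"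
    using compact_imp_bounded[OF compact_continuous_image[OF vc cpt]]
    unfolding bounded_iff by fastforce
  define M where "M = max 1 (max M1 M2)"
  have "u t x - v t x \<le> 0"
  proof (rule parabolic_maximum_principle[where d = "\<lambda>t x. u t x - v t x" and dt = "\<lambda>t x. ut t x - vt t x"
        and dxx = "\<lambda>t x. uxx t x - vxx t x" and L = "2 * (1 + ln M)"])
    show "continuous_on ({0..T} \<times> {\<alpha>..\<beta>}) (\<lambda>(t, x). u t x - v t x)"
      using continuous_on_diff[OF uc vc] by (simp add: case_prod_unfold)
  next
    fix s y assume sy: "0 < s" "s \<le> T" "\<alpha> < y" "y < \<beta>"
    show "((\<lambda>r. u r y - v r y) has_real_derivative ut s y - vt s y) (at s)"
      using du[of s y] dv[of s y] sy by (intro DERIV_diff) auto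
    show "\<exists>d'. (\<forall>\<^sub>F y in nhds y. ((\<lambda>y. u s y - v s y) has_real_derivative d' y) (at y)) \<and>
        (d' has_real_derivative uxx s y - vxx s y) (at y)"
    proof (intro exI[of _ "\<lambda>y. ux s y - vx s y"] conjI)
      have "\<forall>\<^sub>F z in nhds y. z \<in> {\<alpha><..<\<beta>}" using sy by (intro eventually_nhds_in_open) auto
      then show "\<forall>\<^sub>F z in nhds y. ((\<lambda>y. u s y - v s y) has_real_derivative ux s z - vx s z) (at z)"
        by eventually_elim (use du[of s] dv[of s] sy in \<open>auto intro!: DERIV_diff\<close>)
      show "((\<lambda>y. ux s y - vx s y) has_real_derivative uxx s y - vxx s y) (at y)"
        using du[of s y] dv[of s y] sy by (intro DERIV_diff) auto
    qed
    assume "0 < u s y - v s y"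
    then have "log_nonlinearity (u s y) - log_nonlinearity (v s y) \<le> 2 * (1 + ln M) * (u s y - v s y)"
      using M1[of s y] M2[of s y] sy by (intro log_nonlinearity_minus_le) (auto simp: M_def)
    then show "ut s y - vt s y \<le> uxx s y - vxx s y + 2 * (1 + ln M) * (u s y - v s y)"
      using du[of s y] dv[of s y] sy by auto
  qed (use u v t T x in \<open>auto simp: log_heat_solution_def\<close>)
  then show ?thesis by simp
qed

lemma log_heat_solution_unique:
  assumes "log_heat_solution \<alpha> \<beta> u0 u"
  shows "unique_log_heat_solution \<alpha> \<beta> u0 u"
  unfolding unique_log_heat_solution_def
proof (intro conjI allI impI ballI assms)
  fix v and t x :: real assume v: "log_heat_solution \<alpha> \<beta> u0 v" and "0 \<le> t" "x \<in> {\<alpha>..\<beta>}"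
  then show "v t x = u t x"
    using log_heat_solution_le[OF assms v, of t x] log_heat_solution_le[OF v assms, of t x] by simp
qed

text \<open>Oddness transfers the symmetries of the inner sine to the datum, the dead zone
  \<open>[- 1/2, 1/2]\<close> yields a compact support, and the square gives a \<open>C^1\<close>
  function with positive one-sided second derivative at \<open>1/2\<close>.\<close>

definition bump :: "real \<Rightarrow> real" where
  "bump y = (max 0 (y - 1/2))\<^sup>2 - (max 0 (- y - 1/2))\<^sup>2"

lemma bump_minus: "bump (- y) = - bump y"
  by (simp add: bump_def)

lemma bump_nonneg_arg: "0 \<le> y \<Longrightarrow> bump y = (max 0 (y - 1/2))\<^sup>2"
  by (simp add: bump_def)

lemma DERIV_max_square: "((\<lambda>y::real. (max 0 y)\<^sup>2) has_real_derivative 2 * max 0 y) (at y)"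
proof -
  consider "y < 0" | "y = 0" | "y > 0" by linarith
  then show ?thesis
  proof cases
    case 1
    have "((\<lambda>y::real. 0) has_real_derivative 0) (at y)" by simp
    then have "((\<lambda>y::real. (max 0 y)\<^sup>2) has_real_derivative 0) (at y)"
      by (rule has_field_derivative_transform_within_open[where S = "{..<0}"]) (use 1 in auto)
    then show ?thesis using 1 by simp
  next
    case 2
    have "((\<lambda>h::real. (max 0 h)\<^sup>2 / h) \<longlongrightarrow> 0) (at 0)"
    proof (rule Lim_null_comparison)
      show "\<forall>\<^sub>F h::real in at 0. norm ((max 0 h)\<^sup>2 / h) \<le> \<bar>h\<bar>"
        by (intro always_eventually) (auto simp: max_def power2_eq_square)
      show "((\<lambda>h::real. \<bar>h\<bar>) \<longlongrightarrow> 0) (at 0)" by (rule tendsto_rabs_zero) (rule tendsto_ident_at)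
    qed
    then show ?thesis using 2 by (simp add: has_field_derivative_iff)
  next
    case 3
    have "((\<lambda>y::real. y\<^sup>2) has_real_derivative 2 * y) (at y)" by (auto intro!: derivative_eq_intros)
    then have "((\<lambda>y::real. (max 0 y)\<^sup>2) has_real_derivative 2 * y) (at y)"
      by (rule has_field_derivative_transform_within_open[where S = "{0<..}"]) (use 3 in auto)
    then show ?thesis using 3 by simp
  qed
qed

definition bump' :: "real \<Rightarrow> real" where
  "bump' y = 2 * max 0 (y - 1/2) + 2 * max 0 (- y - 1/2)"

lemma DERIV_bump: "(bump has_real_derivative bump' y) (at y)"
proof -
  have 1: "((\<lambda>y::real. y - 1/2) has_real_derivative 1) (at y)" by (auto intro!: derivative_eq_intros)
  have 2: "((\<lambda>y::real. - y - 1/2) has_real_derivative - 1) (at y)" by (auto intro!: derivative_eq_intros)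
  from DERIV_diff[OF DERIV_chain2[OF DERIV_max_square 1] DERIV_chain2[OF DERIV_max_square 2]]
  show ?thesis unfolding bump_def[abs_def] by (rule DERIV_cong) (simp add: bump'_def)
qed

lemma abs_bump_le: "\<bar>y\<bar> \<le> 1 \<Longrightarrow> \<bar>bump y\<bar> \<le> 1"
proof -
  assume y: "\<bar>y\<bar> \<le> 1"
  have "(max 0 (y - 1/2))\<^sup>2 \<le> 1" "(max 0 (- y - 1/2))\<^sup>2 \<le> 1" using y by (auto intro!: power_le_one)
  moreover have "0 \<le> (max 0 (y - 1/2))\<^sup>2" "0 \<le> (max 0 (- y - 1/2))\<^sup>2" by auto
  ultimately show ?thesis unfolding bump_def abs_le_iff by linarith
qed

text \<open>The sine is odd about both \<alpha> and \<beta> and nonnegative between them, so one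
  formula gives the nonnegative datum on the interval together with its odd reflections on the whole
  line.\<close>

definition datum :: "real \<Rightarrow> real \<Rightarrow> real \<Rightarrow> real" where
  "datum \<alpha> \<beta> x = bump (sin (pi / (\<beta> - \<alpha>) * (x - \<alpha>)))"

section \<open>The datum on the interval, its barrier and its solution\<close>

context
  fixes \<alpha> \<beta> :: real
  assumes ab: "\<alpha> < \<beta>"
begin

definition "freq = pi / (\<beta> - \<alpha>)"

lemma freq_pos: "0 < freq"
  using ab by (simp add: freq_def)

lemma datum_eq: "datum \<alpha> \<beta> x = bump (sin (freq * (x - \<alpha>)))"
  by (simp add: datum_def freq_def)

lemma sin_freq_nonneg: "\<alpha> \<le> x \<Longrightarrow> x \<le> \<beta> \<Longrightarrow> 0 \<le> sin (freq * (x - \<alpha>))"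
  using ab by (intro sin_ge_zero) (auto simp: freq_def field_simps)

lemma datum_inside: "\<alpha> \<le> x \<Longrightarrow> x \<le> \<beta> \<Longrightarrow> datum \<alpha> \<beta> x = (max 0 (sin (freq * (x - \<alpha>)) - 1/2))\<^sup>2"
  by (simp add: datum_eq bump_nonneg_arg sin_freq_nonneg)

lemma DERIV_sin_freq: "((\<lambda>x. sin (freq * (x - \<alpha>))) has_real_derivative freq * cos (freq * (x - \<alpha>))) (at x)"
  by (auto intro!: derivative_eq_intros)

lemma DERIV_datum:
  "(datum \<alpha> \<beta> has_real_derivative bump' (sin (freq * (x - \<alpha>))) * (freq * cos (freq * (x - \<alpha>)))) (at x)"
  using DERIV_chain2[OF DERIV_bump DERIV_sin_freq] by (simp add: datum_eq[abs_def])

lemma continuous_datum: "continuous_on S (datum \<alpha> \<beta>)"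
  by (rule DERIV_continuous_on[OF has_field_derivative_at_within[OF DERIV_datum]])

lemma abs_datum_le: "\<bar>datum \<alpha> \<beta> x\<bar> \<le> 1"
  by (simp add: datum_eq abs_bump_le)

lemma datum_Lipschitz: "\<bar>datum \<alpha> \<beta> x - datum \<alpha> \<beta> y\<bar> \<le> freq * \<bar>x - y\<bar>"
proof -
  have "norm (datum \<alpha> \<beta> x - datum \<alpha> \<beta> y) \<le> freq * norm (x - y)"
  proof (rule field_differentiable_bound[of UNIV "datum \<alpha> \<beta>" "\<lambda>x. bump' (sin (freq * (x - \<alpha>))) * (freq * cos (freq * (x - \<alpha>)))"])
    fix z
    have "\<bar>bump' y\<bar> \<le> 1" if "\<bar>y\<bar> \<le> 1" for y using that by (auto simp: bump'_def max_def)
    then have "\<bar>bump' (sin (freq * (z - \<alpha>)))\<bar> * \<bar>cos (freq * (z - \<alpha>))\<bar> \<le> 1 * 1"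
      by (intro mult_mono) auto
    then have "freq * (\<bar>bump' (sin (freq * (z - \<alpha>)))\<bar> * \<bar>cos (freq * (z - \<alpha>))\<bar>) \<le> freq * 1"
      using freq_pos by (intro mult_left_mono) auto
    then show "norm (bump' (sin (freq * (z - \<alpha>))) * (freq * cos (freq * (z - \<alpha>)))) \<le> freq"
      using freq_pos by (simp add: abs_mult mult_ac)
  qed (simp_all add: DERIV_datum)
  then show ?thesis by simp
qed

lemma datum_reflect: "datum \<alpha> \<beta> (2 * \<alpha> - x) = - datum \<alpha> \<beta> x" "datum \<alpha> \<beta> (2 * \<beta> - x) = - datum \<alpha> \<beta> x"
proof -
  have "freq * (2 * \<alpha> - x - \<alpha>) = - (freq * (x - \<alpha>))" by (simp add: algebra_simps)
  then show "datum \<alpha> \<beta> (2 * \<alpha> - x) = - datum \<alpha> \<beta> x" by (simp add: datum_eq bump_minus)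
  have "freq * (2 * \<beta> - x - \<alpha>) = 2 * (freq * (\<beta> - \<alpha>)) - freq * (x - \<alpha>)" by (simp add: algebra_simps)
  also have "freq * (\<beta> - \<alpha>) = pi" using ab by (simp add: freq_def)
  finally have "sin (freq * (2 * \<beta> - x - \<alpha>)) = - sin (freq * (x - \<alpha>))" by (simp add: sin_diff)
  then show "datum \<alpha> \<beta> (2 * \<beta> - x) = - datum \<alpha> \<beta> x" by (simp add: datum_eq bump_minus)
qed

lemma datum_boundary: "datum \<alpha> \<beta> \<alpha> = 0" "datum \<alpha> \<beta> \<beta> = 0"
  using datum_reflect(1)[of \<alpha>] datum_reflect(2)[of \<beta>] by auto

lemma datum_C1_compact_support: "(\<lambda>x. c * datum \<alpha> \<beta> x) \<in> C1_compact_support {\<alpha><..<\<beta>}"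
proof -
  let ?D = "\<lambda>x. c * (bump' (sin (freq * (x - \<alpha>))) * (freq * cos (freq * (x - \<alpha>))))"
  have "((\<lambda>x. c * datum \<alpha> \<beta> x) has_vector_derivative ?D x) (at x)" for x
    using DERIV_cmult[OF DERIV_datum] by (simp add: has_real_derivative_iff_has_vector_derivative)
  moreover have "continuous_on {\<alpha><..<\<beta>} ?D" unfolding bump'_def by (intro continuous_intros)
  ultimately have C1: "(\<lambda>x. c * datum \<alpha> \<beta> x) C1_differentiable_on {\<alpha><..<\<beta>}"
    unfolding C1_differentiable_on_def by (intro exI[of _ ?D]) simp
  \<comment> \<open>This compact set contains the support and misses both endpoints, because the
    sine vanishes there.\<close>
  define F where "F = {\<alpha>..\<beta>} \<inter> {x. 1/2 \<le> sin (freq * (x - \<alpha>))}"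
  have "closed {x. 1/2 \<le> sin (freq * (x - \<alpha>))}" by (intro closed_Collect_le continuous_intros)
  then have F: "compact F" unfolding F_def by (intro compact_Int_closed) auto
  have "freq * (\<beta> - \<alpha>) = pi" using ab by (simp add: freq_def)
  then have "\<alpha> \<notin> F" "\<beta> \<notin> F" by (auto simp: F_def)
  then have FS: "F \<subseteq> {\<alpha><..<\<beta>}" by (auto simp: F_def less_le)
  have "support_on {\<alpha><..<\<beta>} (\<lambda>x. c * datum \<alpha> \<beta> x) \<subseteq> F"
    by (auto simp: support_on_def F_def datum_inside max_def split: if_splits)
  then have "closure (support_on {\<alpha><..<\<beta>} (\<lambda>x. c * datum \<alpha> \<beta> x)) \<subseteq> F"
    using F by (intro closure_minimal compact_imp_closed)
  then show ?thesis using C1 F FS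
    unfolding C1_compact_support_def
    by (auto simp: compact_eq_bounded_closed intro: bounded_subset)
qed

text \<open>Where \<open>datum\<close> is positive, \<open>exp K * datum\<close> is a stationary subsolution for large \<open>K\<close>:
  \<open>datum''\<close> dominates near the edge of the support, where \<open>datum * ln datum\<close> tends to \<open>0\<close>, and
  the factor \<open>exp K\<close> takes care of the rest.\<close>

lemma datum_subsolution:
  obtains K where "0 \<le> K"
    and "\<And>x. \<lbrakk>\<alpha> < x; x < \<beta>; 1/2 < sin (freq * (x - \<alpha>))\<rbrakk> \<Longrightarrow>
      - log_nonlinearity (exp K * datum \<alpha> \<beta> x) \<le>
        exp K * (2 * freq\<^sup>2 * (cos (freq * (x - \<alpha>)))\<^sup>2 - 2 * freq\<^sup>2 * (sin (freq * (x - \<alpha>)) - 1/2) * sin (freq * (x - \<alpha>)))"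
proof -
  \<comment> \<open>\<open>q\<close> makes \<open>2 * exp (- 1 - q)\<close> at most
    \<open>freq^2 / 2\<close>, the part of the second derivative that survives as \<open>r\<close>
    tends to \<open>0\<close>. In \<open>K\<close>, the summand \<open>q\<close> cancels the slope
    in the lower bound for \<open>r^2 * ln (r^2)\<close>, and \<open>4 * freq^2\<close> contributes
    \<open>8 * freq^2 * r^2\<close>, more than the required
    \<open>25/4 * freq^2 * r^2\<close>.\<close>
  define q where "q = max 0 (- ln (freq\<^sup>2 / 4))"
  define K where "K = q + 4 * freq\<^sup>2"
  have q: "0 \<le> q" by (simp add: q_def)
  have k: "0 < freq\<^sup>2" using freq_pos by simp
  have "exp (- q) \<le> exp (ln (freq\<^sup>2 / 4))" by (simp add: q_def)
  also have "\<dots> = freq\<^sup>2 / 4" using k by (intro exp_ln) simp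
  finally have "exp (- q) \<le> freq\<^sup>2 / 4" .
  moreover have "exp (- 1 - q) \<le> exp (- q)" by simp
  ultimately have e: "exp (- 1 - q) \<le> freq\<^sup>2 / 4" by linarith
  show thesis
  proof (rule that[of K])
    show "0 \<le> K" using q k by (simp add: K_def)
    fix x assume x: "\<alpha> < x" "x < \<beta>" and s: "1/2 < sin (freq * (x - \<alpha>))"
    define r where "r = sin (freq * (x - \<alpha>)) - 1/2"
    have r: "0 < r" using s by (simp add: r_def)
    have d: "datum \<alpha> \<beta> x = r\<^sup>2" using x s by (simp add: datum_inside r_def)
    have lg: "r\<^sup>2 * ln (r\<^sup>2) \<ge> - q * r\<^sup>2 - exp (- 1 - q)" using xlnx_minus_ge[of 0 "r\<^sup>2" q] by simp
    \<comment> \<open>This square is the difference between \<open>3/2 - 3 * r - 4 * r^2\<close>,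
      the factor in the second derivative of \<open>r^2\<close>, and
      \<open>1/2 - 25/4 * r^2\<close>; it removes the linear term in \<open>r\<close>.\<close>
    have sq: "0 \<le> (1 - 3/2 * r)\<^sup>2" by simp
    define X where "X = 2 * freq\<^sup>2 * (cos (freq * (x - \<alpha>)))\<^sup>2 - 2 * freq\<^sup>2 * r * (r + 1/2)"
    have c: "(cos (freq * (x - \<alpha>)))\<^sup>2 = 1 - (r + 1/2)\<^sup>2" by (simp add: r_def cos_squared_eq)
    have X: "X = freq\<^sup>2 * (3/2 - 3 * r - 4 * r\<^sup>2)"
      unfolding X_def c by (simp add: power2_eq_square algebra_simps)
    have "freq\<^sup>2 * (1/2 - 25/4 * r\<^sup>2) \<le> X"
      unfolding X using k sq by (intro mult_left_mono) (auto simp: power2_eq_square algebra_simps)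
    then have X_ge: "freq\<^sup>2 / 2 - 25/4 * (freq\<^sup>2 * r\<^sup>2) \<le> X" by (simp add: algebra_simps)
    have F: "log_nonlinearity (exp K * r\<^sup>2) = exp K * (2 * (r\<^sup>2 * ln (r\<^sup>2)) + 2 * (K * r\<^sup>2))"
      by (simp add: log_nonlinearity_mult_exp log_nonlinearity_nonneg_arg algebra_simps)
    have "- (2 * L + 2 * P) \<le> X" if "L \<ge> - Q - exp (- 1 - q)" "P = Q + 4 * R" "R \<ge> 0"
      "freq\<^sup>2 / 2 - 25/4 * R \<le> X" for L P Q R
      using that e by argo
    from this[of "q * r\<^sup>2" "r\<^sup>2 * ln (r\<^sup>2)" "K * r\<^sup>2" "freq\<^sup>2 * r\<^sup>2"]
    have "- (2 * (r\<^sup>2 * ln (r\<^sup>2)) + 2 * (K * r\<^sup>2)) \<le> X"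
      using lg X_ge by (simp add: K_def algebra_simps)
    moreover have XX: "2 * freq\<^sup>2 * (cos (freq * (x - \<alpha>)))\<^sup>2 - 2 * freq\<^sup>2 * (sin (freq * (x - \<alpha>)) - 1/2) * sin (freq * (x - \<alpha>)) = X"
      by (simp add: X_def r_def)
    ultimately have "exp K * - (2 * (r\<^sup>2 * ln (r\<^sup>2)) + 2 * (K * r\<^sup>2)) \<le> exp K * X"
      by (intro mult_left_mono) auto
    then show "- log_nonlinearity (exp K * datum \<alpha> \<beta> x) \<le>
        exp K * (2 * freq\<^sup>2 * (cos (freq * (x - \<alpha>)))\<^sup>2 - 2 * freq\<^sup>2 * (sin (freq * (x - \<alpha>)) - 1/2) * sin (freq * (x - \<alpha>)))"
      unfolding d F XX by (simp only: mult_minus_right)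
  qed
qed

text \<open>The lower barrier is the stationary subsolution \<open>exp K * datum\<close> under the
  scaling symmetry with \<open>c = - K\<close>, so it is again a subsolution where it is positive,
  and at \<open>t = 0\<close> it coincides with the datum.\<close>

lemma datum_solution:
  obtains u K where "log_heat_solution \<alpha> \<beta> (datum \<alpha> \<beta>) u" "0 \<le> K"
    "\<And>t x. 0 \<le> t \<Longrightarrow> x \<in> {\<alpha>..\<beta>} \<Longrightarrow> 0 \<le> u t x \<and> u t x \<le> 1"
    "\<And>t x. 0 \<le> t \<Longrightarrow> x \<in> {\<alpha>..\<beta>} \<Longrightarrow> exp (- K * exp (2 * t)) * (exp K * datum \<alpha> \<beta> x) \<le> u t x"
proof -
  let ?g = "datum \<alpha> \<beta>"
  note g = continuous_datum[of UNIV] abs_datum_le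
  obtain u where uc: "continuous_on UNIV (\<lambda>(t, x). u t x)"
    and mild: "\<And>t x. u t x = heat0 ?g t x + duhamel heat0 (\<lambda>s y. truncated_nonlinearity (u s y)) t x"
    and odd: "\<And>c t x. (\<And>x. ?g (2 * c - x) = - ?g x) \<Longrightarrow> u t (2 * c - x) = - u t x"
    using mild_solution_exists[OF g] by metis
  obtain ut ux uxx where c: "continuous_on ({0<..} \<times> UNIV) (\<lambda>(t, x). ut t x)"
    "continuous_on ({0<..} \<times> UNIV) (\<lambda>(t, x). ux t x)"
    "continuous_on ({0<..} \<times> UNIV) (\<lambda>(t, x). uxx t x)"
    and dt: "\<And>t x. 0 < t \<Longrightarrow> ((\<lambda>s. u s x) has_real_derivative ut t x) (at t)"
    and dx: "\<And>t x. 0 < t \<Longrightarrow> ((\<lambda>y. u t y) has_real_derivative ux t x) (at x)"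
    and dxx: "\<And>t x. 0 < t \<Longrightarrow> ((\<lambda>y. ux t y) has_real_derivative uxx t x) (at x)"
    and eq: "\<And>t x. 0 < t \<Longrightarrow> ut t x = uxx t x + truncated_nonlinearity (u t x)"
    using mild_solution_regular[OF g datum_Lipschitz uc mild] by metis
  have u0: "u 0 x = ?g x" for x
    using mild[of 0 x] prob_space.prob_space[OF prob_space_gauss] by (simp add: heat0_def duhamel_nonpos)
  \<comment> \<open>Oddness about an endpoint, evaluated at that endpoint, says that the value
    equals its own negative.\<close>
  have ub: "u t \<alpha> = 0" "u t \<beta> = 0" for t
    using odd[of \<alpha> t \<alpha>] odd[of \<beta> t \<beta>] datum_reflect by auto
  have cs: "continuous_on S (\<lambda>(t, x). u t x)" for S using uc by (rule continuous_on_subset) simp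
  have le1: "u t x \<le> 1" if "0 \<le> t" "x \<in> {\<alpha>..\<beta>}" for t x
  proof -
    have "u t x - 1 \<le> 0"
    proof (rule parabolic_maximum_principle[where d = "\<lambda>t x. u t x - 1" and T = t and a = \<alpha> and b = \<beta>
          and dt = ut and dxx = uxx and L = 0])
      show "continuous_on ({0..t} \<times> {\<alpha>..\<beta>}) (\<lambda>(t, x). u t x - 1)"
        using continuous_on_diff[OF cs continuous_on_const, of _ 1] by (simp add: case_prod_unfold)
    next
      fix s y :: real assume s: "0 < s"
      show "((\<lambda>s. u s y - 1) has_real_derivative ut s y) (at s)"
        using DERIV_diff[OF dt[OF s] DERIV_const[of 1]] by simp
      show "\<exists>d'. (\<forall>\<^sub>F y in nhds y. ((\<lambda>y. u s y - 1) has_real_derivative d' y) (at y)) \<and>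
          (d' has_real_derivative uxx s y) (at y)"
        using DERIV_diff[OF dx[OF s] DERIV_const[of 1]] dxx[OF s]
        by (intro exI[of _ "ux s"] conjI always_eventually) auto
      assume "0 < u s y - 1"
      then show "ut s y \<le> uxx s y + 0 * (u s y - 1)"
        using truncated_nonlinearity_nonpos[of "u s y"] eq[OF s, of y] by simp
    next
      show "u 0 y - 1 \<le> 0" for y using abs_datum_le[of y] by (simp add: u0 abs_le_iff)
    qed (use that ub in auto)
    then show ?thesis by simp
  qed
  have ge0: "0 \<le> u t x" if "0 \<le> t" "x \<in> {\<alpha>..\<beta>}" for t x
  proof -
    have "- u t x \<le> 0"
    proof (rule parabolic_maximum_principle[where d = "\<lambda>t x. - u t x" and T = t and a = \<alpha> and b = \<beta>
          and dt = "\<lambda>t x. - ut t x" and dxx = "\<lambda>t x. - uxx t x" and L = 0])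
      show "continuous_on ({0..t} \<times> {\<alpha>..\<beta>}) (\<lambda>(t, x). - u t x)"
        using continuous_on_minus[OF cs] by (simp add: case_prod_unfold)
    next
      fix s y :: real assume s: "0 < s"
      show "((\<lambda>s. - u s y) has_real_derivative - ut s y) (at s)" by (rule DERIV_minus[OF dt[OF s]])
      show "\<exists>d'. (\<forall>\<^sub>F y in nhds y. ((\<lambda>y. - u s y) has_real_derivative d' y) (at y)) \<and>
          (d' has_real_derivative - uxx s y) (at y)"
        using DERIV_minus[OF dx[OF s]] DERIV_minus[OF dxx[OF s]]
        by (intro exI[of _ "\<lambda>y. - ux s y"] conjI always_eventually) auto
      assume "0 < - u s y"
      then show "- ut s y \<le> - uxx s y + 0 * (- u s y)"
        using truncated_nonlinearity_nonpos[of "- u s y"] eq[OF s, of y] by simp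
    next
      show "- u 0 y \<le> 0" if "\<alpha> \<le> y" "y \<le> \<beta>" for y using that by (simp add: u0 datum_inside)
    qed (use that ub in auto)
    then show ?thesis by simp
  qed
  have eq': "ut t x = uxx t x + log_nonlinearity (u t x)" if "0 < t" "x \<in> {\<alpha>..\<beta>}" for t x
    using eq[OF that(1), of x] le1[of t x] ge0[of t x] that by (simp add: truncated_nonlinearity_eq)
  have sol: "log_heat_solution \<alpha> \<beta> ?g u"
    unfolding log_heat_solution_def
  proof (intro conjI allI impI cs, rule exI[of _ ut], rule exI[of _ ux], rule exI[of _ uxx], intro conjI ballI)
    fix T :: real
    show "continuous_on ({0<..T} \<times> {\<alpha><..<\<beta>}) (\<lambda>(t, x). ut t x)"
      "continuous_on ({0<..T} \<times> {\<alpha><..<\<beta>}) (\<lambda>(t, x). ux t x)"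
      "continuous_on ({0<..T} \<times> {\<alpha><..<\<beta>}) (\<lambda>(t, x). uxx t x)"
      by (rule continuous_on_subset[OF c(1)] continuous_on_subset[OF c(2)] continuous_on_subset[OF c(3)]; auto)+
  next
    show "\<forall>x\<in>{\<alpha>..\<beta>}. u 0 x = (if x \<in> {\<alpha><..<\<beta>} then ?g x else 0)"
      using datum_boundary by (auto simp: u0 less_le)
  qed (auto intro: dt dx dxx eq' simp: ub)
  obtain K where K: "0 \<le> K" and sub: "\<And>x. \<lbrakk>\<alpha> < x; x < \<beta>; 1/2 < sin (freq * (x - \<alpha>))\<rbrakk> \<Longrightarrow>
      - log_nonlinearity (exp K * ?g x) \<le>
        exp K * (2 * freq\<^sup>2 * (cos (freq * (x - \<alpha>)))\<^sup>2 - 2 * freq\<^sup>2 * (sin (freq * (x - \<alpha>)) - 1/2) * sin (freq * (x - \<alpha>)))"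
    using datum_subsolution by blast
  define E where "E t = exp (- K * exp (2 * t))" for t :: real
  define w where "w t x = E t * (exp K * ?g x)" for t x
  have E': "(E has_real_derivative - 2 * K * exp (2 * t) * E t) (at t)" for t
    unfolding E_def by (auto intro!: derivative_eq_intros)
  have E1: "0 < E t" "0 \<le> t \<Longrightarrow> E t \<le> 1" for t using K by (auto simp: E_def)
  have lower: "w t x \<le> u t x" if tx: "0 \<le> t" "x \<in> {\<alpha>..\<beta>}" for t x
  proof -
    define phi1 where "phi1 x = 2 * freq * (sin (freq * (x - \<alpha>)) - 1/2) * cos (freq * (x - \<alpha>))" for x
    define phi2 where "phi2 x = 2 * freq\<^sup>2 * (cos (freq * (x - \<alpha>)))\<^sup>2 - 2 * freq\<^sup>2 * (sin (freq * (x - \<alpha>)) - 1/2) * sin (freq * (x - \<alpha>))" for x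
    have "w t x - u t x \<le> 0"
    proof (rule parabolic_maximum_principle[where d = "\<lambda>t x. w t x - u t x" and T = t and a = \<alpha> and b = \<beta>
          and dt = "\<lambda>t x. - 2 * K * exp (2 * t) * w t x - ut t x" and dxx = "\<lambda>t x. E t * (exp K * phi2 x) - uxx t x"
          and L = "2 * (1 + ln (exp K))"])
      have "continuous_on UNIV E" using E' by (auto intro!: DERIV_continuous_on)
      then have "continuous_on S (\<lambda>p. E (fst p) * (exp K * ?g (snd p)))" for S
        by (intro continuous_intros continuous_on_compose2[OF _ continuous_on_fst[OF continuous_on_id]]
            continuous_on_compose2[OF g(1) continuous_on_snd[OF continuous_on_id]]) auto
      then show "continuous_on ({0..t} \<times> {\<alpha>..\<beta>}) (\<lambda>(t, x). w t x - u t x)"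
        using continuous_on_diff[OF _ cs] by (simp add: w_def case_prod_unfold)
    next
      fix s y :: real assume s: "0 < s" "s \<le> t" and y: "\<alpha> < y" "y < \<beta>"
      show "((\<lambda>s. w s y - u s y) has_real_derivative - 2 * K * exp (2 * s) * w s y - ut s y) (at s)"
        unfolding w_def
        using DERIV_diff[OF DERIV_cmult_right[OF E'[of s], of "exp K * ?g y"] dt[OF s(1), of y]]
        by (simp add: mult_ac)
      assume pos: "0 < w s y - u s y"
      \<comment> \<open>Since \<open>u\<close> is nonnegative, the barrier can exceed it only where
        the datum is positive. There the datum is the smooth function
        \<open>(sin (freq * (y - \<alpha>)) - 1/2)^2\<close>, so its jump in the second derivative
        is never met.\<close>
      have uy: "0 \<le> u s y" "u s y \<le> 1" using ge0[of s y] le1[of s y] s y by auto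
      then have "0 < w s y" using pos by linarith
      then have gpos: "0 < ?g y" using E1(1)[of s] by (simp add: w_def zero_less_mult_iff)
      then have sy: "1/2 < sin (freq * (y - \<alpha>))" using y by (auto simp: datum_inside max_def split: if_splits)
      show "\<exists>d'. (\<forall>\<^sub>F y in nhds y. ((\<lambda>y. w s y - u s y) has_real_derivative d' y) (at y)) \<and>
          (d' has_real_derivative E s * (exp K * phi2 y) - uxx s y) (at y)"
      proof (intro exI[of _ "\<lambda>y. E s * (exp K * phi1 y) - ux s y"] conjI)
        define O' where "O' = {\<alpha><..<\<beta>} \<inter> {x. 1/2 < sin (freq * (x - \<alpha>))}"
        have O': "open O'" unfolding O'_def by (intro open_Int open_Collect_less continuous_intros) auto
        have "\<forall>\<^sub>F z in nhds y. z \<in> O'" using O' y sy by (intro eventually_nhds_in_open) (auto simp: O'_def)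
        then show "\<forall>\<^sub>F z in nhds y. ((\<lambda>y. w s y - u s y) has_real_derivative E s * (exp K * phi1 z) - ux s z) (at z)"
        proof eventually_elim
          case (elim z)
          have "((\<lambda>x. (sin (freq * (x - \<alpha>)) - 1/2)\<^sup>2) has_real_derivative phi1 z) (at z)"
            by (auto intro!: derivative_eq_intros simp: phi1_def)
          then have "(?g has_real_derivative phi1 z) (at z)"
            by (rule has_field_derivative_transform_within_open[OF _ O' elim]) (auto simp: O'_def datum_inside)
          then show ?case unfolding w_def by (intro DERIV_diff DERIV_cmult dx s)
        qed
        have "(phi1 has_real_derivative phi2 y) (at y)"
          unfolding phi1_def[abs_def] phi2_def
          by (auto intro!: derivative_eq_intros simp: power2_eq_square algebra_simps)
        then show "((\<lambda>y. E s * (exp K * phi1 y) - ux s y) has_real_derivative E s * (exp K * phi2 y) - uxx s y) (at y)"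
          by (intro DERIV_diff DERIV_cmult dxx s)
      qed
      \<comment> \<open>Both functions are bounded by \<open>exp K\<close>, which is at least
        \<open>1\<close> since \<open>K \<ge> 0\<close>; this is the height in the Lipschitz bound
        and the origin of \<open>L\<close>.\<close>
      have "?g y \<le> 1" using abs_datum_le[of y] by (simp add: abs_le_iff)
      then have "w s y \<le> 1 * (exp K * 1)"
        unfolding w_def using E1[of s] s gpos by (intro mult_mono) auto
      then have "log_nonlinearity (w s y) - log_nonlinearity (u s y) \<le> 2 * (1 + ln (exp K)) * (w s y - u s y)"
        using pos uy K by (intro log_nonlinearity_minus_le) (auto intro: order_trans[of _ 1])
      \<comment> \<open>The linear term of the scaling equals the time derivative of
        \<open>w\<close>, so the two cancel and the stationary inequality, multiplied by
        \<open>E s\<close>, is what remains.\<close>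
      moreover have "log_nonlinearity (w s y) = E s * log_nonlinearity (exp K * ?g y) - 2 * K * exp (2 * s) * w s y"
        unfolding w_def E_def log_nonlinearity_mult_exp[of "- K * exp (2 * s)"] by simp
      moreover have "E s * - log_nonlinearity (exp K * ?g y) \<le> E s * (exp K * phi2 y)"
        using sub[OF y sy] E1(1)[of s] unfolding phi2_def by (intro mult_left_mono) auto
      ultimately show "- 2 * K * exp (2 * s) * w s y - ut s y \<le>
          E s * (exp K * phi2 y) - uxx s y + 2 * (1 + ln (exp K)) * (w s y - u s y)"
        using eq'[of s y] s y by simp
    next
      show "w 0 y - u 0 y \<le> 0" for y by (simp add: w_def E_def u0 exp_minus field_simps)
    qed (use tx ub datum_boundary in \<open>auto simp: w_def\<close>)
    then show ?thesis by simp
  qed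
  show thesis by (rule that[OF sol K]) (use ge0 le1 lower in \<open>auto simp: w_def E_def\<close>)
qed

end

section \<open>Norms and the theorem\<close>

lemma square_set_integrable:
  fixes f :: "real \<Rightarrow> real"
  assumes "continuous_on {a..b} f"
  shows "set_integrable lborel {a<..<b} (\<lambda>x. (f x)\<^sup>2)"
  by (rule set_integrable_subset[OF borel_integrable_atLeastAtMost']) (auto intro!: continuous_intros assms)

lemma Linf_norm_on_interval:
  fixes f :: "real \<Rightarrow> real"
  assumes ab: "a < b" and f: "continuous_on {a..b} f" and B: "\<And>x. x \<in> {a<..<b} \<Longrightarrow> \<bar>f x\<bar> \<le> B"
  shows "Linf_norm_on {a<..<b} f \<le> B"
    and "L2_norm_on {a<..<b} f \<le> sqrt (b - a) * Linf_norm_on {a<..<b} f"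
proof -
  define M where "M = restrict_space lborel {a<..<b}"
  define E where "E = esssup M (\<lambda>x. ereal \<bar>f x\<bar>)"
  have "continuous_on {a<..<b} f" using f by (rule continuous_on_subset) auto
  then have "f \<in> borel_measurable (restrict_space borel {a<..<b})"
    by (rule borel_measurable_continuous_on_restrict)
  moreover have "sets M = sets (restrict_space borel {a<..<b})" by (simp add: M_def sets_restrict_space)
  ultimately have "f \<in> borel_measurable M" using measurable_cong_sets by blast
  then have fm: "(\<lambda>x. ereal \<bar>f x\<bar>) \<in> borel_measurable M" by simp
  have "emeasure M (space M) = emeasure lborel {a<..<b}"
    by (simp add: M_def space_restrict_space emeasure_restrict_space)
  also have "\<dots> \<noteq> 0" using ab by simp
  finally have M0: "emeasure M (space M) \<noteq> 0" .
  have "E \<le> ereal B"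
    unfolding E_def using fm B by (intro esssup_I AE_I2) (auto simp: M_def space_restrict_space)
  \<comment> \<open>Together with the upper bound this makes the essential supremum finite, so that
    its conversion to a real number is faithful. The interval has positive measure, hence the
    constant \<open>0\<close> has essential supremum \<open>0\<close>.\<close>
  moreover have "0 \<le> E"
  proof -
    have "esssup M (\<lambda>x. 0 :: ereal) \<le> E" unfolding E_def by (rule esssup_mono) auto
    then show ?thesis using esssup_const[OF M0, of "0 :: ereal"] by simp
  qed
  ultimately obtain e where e: "E = ereal e" "0 \<le> e" "e \<le> B" by (cases E) auto
  have Linf: "Linf_norm_on {a<..<b} f = e"
    using e by (simp add: Linf_norm_on_def E_def M_def)
  then show "Linf_norm_on {a<..<b} f \<le> B" using e by simp
  have "AE x in M. ereal \<bar>f x\<bar> \<le> E" unfolding E_def by (rule esssup_AE)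
  then have "AE x in M. \<bar>f x\<bar> \<le> e" using e by simp
  then have "AE x in lborel. x \<in> {a<..<b} \<longrightarrow> \<bar>f x\<bar> \<le> e"
    unfolding M_def by (subst (asm) AE_restrict_space_iff) auto
  then have ae: "AE x in lborel. indicator {a<..<b} x * (f x)\<^sup>2 \<le> indicator {a<..<b} x * e\<^sup>2"
    by (rule AE_mp) (auto intro!: AE_I2 simp: indicator_def abs_le_square_iff[symmetric] e)
  have "set_integrable lborel {a<..<b} (\<lambda>x. e\<^sup>2)"
    using square_set_integrable[of a b "\<lambda>_. e"] by simp
  then have "(\<integral>x. indicator {a<..<b} x * (f x)\<^sup>2 \<partial>lborel) \<le> (\<integral>x. indicator {a<..<b} x * e\<^sup>2 \<partial>lborel)"
    using square_set_integrable[OF f] ae by (intro integral_mono_AE) (auto simp: set_integrable_def)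
  also have "\<dots> = (b - a) * e\<^sup>2" using ab by simp
  finally have "L2_norm_on {a<..<b} f \<le> sqrt ((b - a) * e\<^sup>2)"
    by (simp add: L2_norm_on_def set_lebesgue_integral_def)
  then show "L2_norm_on {a<..<b} f \<le> sqrt (b - a) * Linf_norm_on {a<..<b} f"
    using e by (simp add: Linf real_sqrt_mult)
qed

lemma L2_norm_on_mono:
  fixes f g :: "real \<Rightarrow> real"
  assumes f: "continuous_on {a..b} f" and g: "continuous_on {a..b} g" and c: "0 \<le> c"
    and le: "\<And>x. x \<in> {a<..<b} \<Longrightarrow> 0 \<le> g x \<and> c * g x \<le> f x"
  shows "c * L2_norm_on {a<..<b} g \<le> L2_norm_on {a<..<b} f"
proof -
  have "c\<^sup>2 * (LINT x:{a<..<b}|lborel. (g x)\<^sup>2) = (LINT x:{a<..<b}|lborel. (c * g x)\<^sup>2)"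
    by (simp add: power_mult_distrib)
  also have "\<dots> \<le> (LINT x:{a<..<b}|lborel. (f x)\<^sup>2)"
    using c le by (intro set_integral_mono square_set_integrable f continuous_intros g power_mono) auto
  finally show ?thesis
    using c real_sqrt_le_mono by (fastforce simp: L2_norm_on_def real_sqrt_mult)
qed

text \<open>A zero norm would make the open set where \<open>f\<close> is nonzero a null set, yet it
  contains \<open>x\<close>.\<close>

lemma L2_norm_on_pos:
  fixes f :: "real \<Rightarrow> real"
  assumes f: "continuous_on {a..b} f" and x: "x \<in> {a<..<b}" "f x \<noteq> 0"
  shows "0 < L2_norm_on {a<..<b} f"
proof -
  define F where "F x = indicator {a<..<b} x * (f x)\<^sup>2" for x
  have F: "integrable lborel F" using square_set_integrable[OF f] by (simp add: set_integrable_def F_def[abs_def])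
  have "(\<integral>x. F x \<partial>lborel) \<noteq> 0"
  proof
    assume "(\<integral>x. F x \<partial>lborel) = 0"
    moreover have "AE x in lborel. 0 \<le> F x" by (simp add: F_def)
    ultimately have "AE x in lborel. F x = 0" using integral_nonneg_eq_0_iff_AE[OF F] by blast
    moreover define U where "U = {x \<in> {a<..<b}. f x \<noteq> 0}"
    have "open U"
    proof -
      have "continuous_on {a<..<b} f" using f by (rule continuous_on_subset) auto
      then have "open ({a<..<b} \<inter> f -` (- {0}))" by (intro continuous_open_preimage) auto
      moreover have "U = {a<..<b} \<inter> f -` (- {0})" by (auto simp: U_def)
      ultimately show ?thesis by simp
    qed
    ultimately have "AE x in lborel. x \<notin> U" by (auto simp: F_def U_def indicator_def elim!: eventually_mono)
    then have "U \<in> null_sets lborel" using \<open>open U\<close> by (subst AE_iff_null_sets) auto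
    then have "negligible U" using null_sets_completionI negligible_iff_null_sets by blast
    moreover have "U \<noteq> {}" using x by (auto simp: U_def)
    ultimately show False using open_not_negligible[OF \<open>open U\<close>] by blast
  qed
  moreover have "0 \<le> (\<integral>x. F x \<partial>lborel)" by (simp add: F_def)
  ultimately have "0 < (\<integral>x. F x \<partial>lborel)" by linarith
  then show ?thesis by (simp add: L2_norm_on_def set_lebesgue_integral_def F_def)
qed

lemma log_heat_solution_slice:
  assumes "log_heat_solution \<alpha> \<beta> u0 u" "0 \<le> t"
  shows "continuous_on {\<alpha>..\<beta>} (u t)"
proof -
  have "continuous_on ({0..t + 1} \<times> {\<alpha>..\<beta>}) (\<lambda>(t, x). u t x)"
    using log_heat_solutionE[OF assms(1), of "t + 1"] assms(2) by auto
  then have "continuous_on {\<alpha>..\<beta>} (\<lambda>x. case (t, x) of (t, x) \<Rightarrow> u t x)"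
    by (rule continuous_on_compose2) (use assms(2) in \<open>auto intro!: continuous_intros\<close>)
  then show ?thesis by simp
qed

theorem proposition1p3:
  fixes \<alpha> \<beta> :: real
  assumes "\<alpha> < \<beta>"
  shows "(\<exists>u0 \<in> C1_compact_support {\<alpha><..<\<beta>}. (\<forall>x\<in>{\<alpha><..<\<beta>}. 0 \<le> u0 x) \<and>
           (\<exists>u. unique_log_heat_solution \<alpha> \<beta> u0 u \<and>
             (\<exists>C>0. \<exists>\<eta>>0. \<forall>t\<ge>0.
                L2_norm_on {\<alpha><..<\<beta>} (u t) \<le> sqrt (\<beta> - \<alpha>) * Linf_norm_on {\<alpha><..<\<beta>} (u t) \<and>
                sqrt (\<beta> - \<alpha>) * Linf_norm_on {\<alpha><..<\<beta>} (u t) \<le> C * exp (- \<eta> * exp (2 * t)))))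
       \<and> (\<exists>u0 \<in> C1_compact_support {\<alpha><..<\<beta>}. (\<forall>x\<in>{\<alpha><..<\<beta>}. 0 \<le> u0 x) \<and>
           (\<exists>u. unique_log_heat_solution \<alpha> \<beta> u0 u \<and>
             (\<exists>C>0. \<exists>\<eta>>0. \<forall>t\<ge>0.
                sqrt (\<beta> - \<alpha>) * Linf_norm_on {\<alpha><..<\<beta>} (u t) \<ge> L2_norm_on {\<alpha><..<\<beta>} (u t) \<and>
                L2_norm_on {\<alpha><..<\<beta>} (u t) \<ge> C * exp (\<eta> * exp (2 * t)))))"
proof -
  let ?S = "{\<alpha><..<\<beta>}" and ?g = "datum \<alpha> \<beta>"
  obtain u K where sol: "log_heat_solution \<alpha> \<beta> ?g u" and K: "0 \<le> K"
    and u01: "\<And>t x. 0 \<le> t \<Longrightarrow> x \<in> {\<alpha>..\<beta>} \<Longrightarrow> 0 \<le> u t x \<and> u t x \<le> 1"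
    and lower: "\<And>t x. 0 \<le> t \<Longrightarrow> x \<in> {\<alpha>..\<beta>} \<Longrightarrow> exp (- K * exp (2 * t)) * (exp K * ?g x) \<le> u t x"
    using datum_solution[OF assms] by metis
  have g0: "0 \<le> ?g x" if "x \<in> ?S" for x using that by (simp add: datum_inside[OF assms])
  define v where "v c t x = exp (c * exp (2 * t)) * u t x" for c t x
  have v: "log_heat_solution \<alpha> \<beta> (\<lambda>x. exp c * ?g x) (v c)" for c
    using log_heat_solution_scale[OF sol, of c] by (simp add: v_def[abs_def])
  have vc: "continuous_on {\<alpha>..\<beta>} (v c t)" if "0 \<le> t" for c t
    by (rule log_heat_solution_slice[OF v that])
  have vb: "\<bar>v c t x\<bar> \<le> exp (c * exp (2 * t))" if "0 \<le> t" "x \<in> ?S" for c t x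
    using u01[of t x] that by (simp add: v_def abs_mult)
  have datum: "(\<lambda>x. exp c * ?g x) \<in> C1_compact_support ?S \<and> (\<forall>x\<in>?S. 0 \<le> exp c * ?g x)
      \<and> unique_log_heat_solution \<alpha> \<beta> (\<lambda>x. exp c * ?g x) (v c)" for c
    using datum_C1_compact_support[OF assms] g0 log_heat_solution_unique[OF v] by simp
  have norms: "L2_norm_on ?S (v c t) \<le> sqrt (\<beta> - \<alpha>) * Linf_norm_on ?S (v c t)" if "0 \<le> t" for c t
    by (rule Linf_norm_on_interval(2)[OF assms vc[OF that] vb[OF that]])
  have decay: "sqrt (\<beta> - \<alpha>) * Linf_norm_on ?S (v (- 1) t) \<le> sqrt (\<beta> - \<alpha>) * exp (- 1 * exp (2 * t))" if "0 \<le> t" for t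
    using assms by (intro mult_left_mono Linf_norm_on_interval(1)[OF assms vc[OF that] vb[OF that]]) auto
  \<comment> \<open>The constant is the norm of the stationary barrier; it is positive because the
    sine equals \<open>1\<close> at the midpoint, where the datum is \<open>1/4\<close>.\<close>
  define C where "C = exp K * L2_norm_on ?S ?g"
  have gc: "continuous_on {\<alpha>..\<beta>} ?g" by (rule continuous_datum[OF assms])
  have C: "0 < C"
  proof -
    let ?m = "(\<alpha> + \<beta>) / 2"
    have "pi / (\<beta> - \<alpha>) * (?m - \<alpha>) = pi / 2" using assms by (simp add: field_simps)
    then have "?g ?m = 1/4" by (simp add: datum_def bump_def power2_eq_square)
    then have "0 < L2_norm_on ?S ?g" using assms by (intro L2_norm_on_pos[OF gc, of ?m]) auto
    then show ?thesis by (simp add: C_def)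
  qed
  have growth: "C * exp (1 * exp (2 * t)) \<le> L2_norm_on ?S (v (K + 1) t)" if t: "0 \<le> t" for t
  proof -
    have "(exp K * exp (exp (2 * t))) * L2_norm_on ?S ?g \<le> L2_norm_on ?S (v (K + 1) t)"
    proof (rule L2_norm_on_mono[OF vc[OF t] gc])
      fix x assume x: "x \<in> ?S"
      have "exp ((K + 1) * exp (2 * t)) * (exp (- K * exp (2 * t)) * (exp K * ?g x)) \<le> v (K + 1) t x"
        unfolding v_def using lower[OF t, of x] x by (intro mult_left_mono) auto
      \<comment> \<open>The scaling exponent \<open>K + 1\<close> exceeds the decay exponent
        \<open>K\<close> of the lower barrier by \<open>1\<close>, which is the growth rate
        obtained.\<close>
      moreover have "exp ((K + 1) * exp (2 * t)) * exp (- K * exp (2 * t)) = exp (exp (2 * t))"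
        by (simp add: exp_add[symmetric] algebra_simps)
      ultimately show "0 \<le> ?g x \<and> exp K * exp (exp (2 * t)) * ?g x \<le> v (K + 1) t x"
        using g0[OF x] by (metis mult.assoc mult.commute)
    qed simp
    then show ?thesis by (simp add: C_def mult_ac)
  qed
  show ?thesis
  proof (intro conjI)
    show "\<exists>u0 \<in> C1_compact_support ?S. (\<forall>x\<in>?S. 0 \<le> u0 x) \<and>
        (\<exists>u. unique_log_heat_solution \<alpha> \<beta> u0 u \<and>
          (\<exists>C>0. \<exists>\<eta>>0. \<forall>t\<ge>0.
             L2_norm_on ?S (u t) \<le> sqrt (\<beta> - \<alpha>) * Linf_norm_on ?S (u t) \<and>
             sqrt (\<beta> - \<alpha>) * Linf_norm_on ?S (u t) \<le> C * exp (- \<eta> * exp (2 * t))))"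
      using datum[of "- 1"] norms[of _ "- 1"] decay assms
      by (intro bexI[of _ "\<lambda>x. exp (- 1) * ?g x"] conjI exI[of _ "v (- 1)"]
          exI[of _ "sqrt (\<beta> - \<alpha>)"] exI[of _ "1::real"]) auto
    show "\<exists>u0 \<in> C1_compact_support ?S. (\<forall>x\<in>?S. 0 \<le> u0 x) \<and>
        (\<exists>u. unique_log_heat_solution \<alpha> \<beta> u0 u \<and>
          (\<exists>C>0. \<exists>\<eta>>0. \<forall>t\<ge>0.
             sqrt (\<beta> - \<alpha>) * Linf_norm_on ?S (u t) \<ge> L2_norm_on ?S (u t) \<and>
             L2_norm_on ?S (u t) \<ge> C * exp (\<eta> * exp (2 * t))))"
      using datum[of "K + 1"] norms[of _ "K + 1"] growth C
      by (intro bexI[of _ "\<lambda>x. exp (K + 1) * ?g x"] conjI exI[of _ "v (K + 1)"]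
          exI[of _ C] exI[of _ "1::real"]) auto
  qed
qed

end
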